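(* Let $\psi_1,\psi_2$ be approximating functions and let $\mathcal{C}$ be a $C^{(3)}$ non-degenerate planar curve. If $$\sum_{h=1}^\infty \psi_1(h)\psi_2(h)=\infty,$$ then $\mathcal{C}\cap\mathcal{S}_2(\psi_1,\psi_2)$ has full one-dimensional Lebesgue measure on $\mathcal{C}$, i.e. $|\mathcal{C}\setminus\mathcal{S}_2(\psi_1,\psi_2)|_{\mathcal{C}}=0$.
   Context: An approximating function is a decreasing function $\psi:\mathbb{R}^+\to\mathbb{R}^+$ (with positive real values). For $x\in\mathbb{R}$ put $\|x\|=\min\{|x-m|:m\in\mathbb{Z}\}$. For approximating functions $\psi_1,\psi_2$, $\mathcal{S}_2(\psi_1,\psi_2)$ is the set of $(y_1,y_2)\in\mathbb{R}^2$ for which there are infinitely many $q\in\mathbb{N}$ such that both $\|qy_1\|<\psi_1(q)$ and $\|qy_2\|<\psi_2(q)$. A $C^{(3)}$ planar curve is a three times continuously differentiable one-dimensional submanifold $\mathcal{C}$ of $\mathbb{R}^2$; it is non-degenerate if the set of points of $\mathcal{C}$ at which the curvature vanishes has one-dimensional Lebesgue measure zero. $|\cdot|_{\mathcal{C}}$ denotes the induced one-dimensional Lebesgue measure on $\mathcal{C}$. *)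

theory Defs
  imports "HOL-Analysis.Analysis"
begin

section \<open>Simultaneous approximation\<close>

definition approximating_function :: "(real \<Rightarrow> real) \<Rightarrow> bool" where
  "approximating_function \<psi> \<longleftrightarrow> (\<forall>x>0. 0 < \<psi> x) \<and> antimono_on {0<..} \<psi>"

text \<open>The infimum over the integers defining \<^const>\<open>infdist\<close> is attained, so this is the minimum
  of \<open>\<bar>x - m\<bar>\<close> over integers \<open>m\<close>.\<close>

definition dist_nearest_int :: "real \<Rightarrow> real" where
  "dist_nearest_int x = infdist x \<int>"

definition simul_approx :: "(real \<Rightarrow> real) \<Rightarrow> (real \<Rightarrow> real) \<Rightarrow> (real \<times> real) set" where
  "simul_approx \<psi>1 \<psi>2 = {(y1, y2). infinite {q::nat. 1 \<le> q \<and>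
      dist_nearest_int (real q * y1) < \<psi>1 (real q) \<and>
      dist_nearest_int (real q * y2) < \<psi>2 (real q)}}"

section \<open>Planar curves\<close>

text \<open>\<open>C_diff_on k f S\<close>: \<open>f\<close> is \<open>k\<close> times continuously differentiable on the open set \<open>S\<close>.\<close>

primrec C_diff_on :: "nat \<Rightarrow> (real \<Rightarrow> 'a::real_normed_vector) \<Rightarrow> real set \<Rightarrow> bool" where
  "C_diff_on 0 f S \<longleftrightarrow> continuous_on S f"
| "C_diff_on (Suc k) f S \<longleftrightarrow>
     (\<exists>f'. (\<forall>t\<in>S. (f has_vector_derivative f' t) (at t)) \<and> C_diff_on k f' S)"

text \<open>A local parametrization of \<open>C\<close>: a regular \<open>C\<^sup>k\<close> map on an open interval \<open>I\<close> (possibly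
  unbounded or empty) that is a homeomorphism onto a relatively open subset of \<open>C\<close>.\<close>

definition local_param :: "nat \<Rightarrow> (real \<times> real) set \<Rightarrow> (real \<Rightarrow> real \<times> real) \<Rightarrow> real set \<Rightarrow> bool" where
  "local_param k C \<gamma> I \<longleftrightarrow>
     open I \<and> is_interval I \<and> C_diff_on k \<gamma> I \<and>
     (\<forall>t\<in>I. vector_derivative \<gamma> (at t) \<noteq> 0) \<and>
     openin (top_of_set C) (\<gamma> ` I) \<and> (\<exists>g. homeomorphism I (\<gamma> ` I) \<gamma> g)"

definition planar_curve :: "nat \<Rightarrow> (real \<times> real) set \<Rightarrow> bool" where
  "planar_curve k C \<longleftrightarrow> (\<forall>p\<in>C. \<exists>\<gamma> I. local_param k C \<gamma> I \<and> p \<in> \<gamma> ` I)"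

subsection \<open>Curvature\<close>

definition param_curvature :: "(real \<Rightarrow> real \<times> real) \<Rightarrow> real \<Rightarrow> real" where
  "param_curvature \<gamma> t =
    (let d1 = vector_derivative \<gamma> (at t);
         d2 = vector_derivative (\<lambda>s. vector_derivative \<gamma> (at s)) (at t)
     in \<bar>fst d1 * snd d2 - snd d1 * fst d2\<bar> / norm d1 ^ 3)"

text \<open>The value does not depend on the choice of the local parametrization.\<close>

definition has_curvature :: "(real \<times> real) set \<Rightarrow> real \<times> real \<Rightarrow> real \<Rightarrow> bool" where
  "has_curvature C p \<kappa> \<longleftrightarrow>
     (\<exists>\<gamma> I t. local_param 3 C \<gamma> I \<and> t \<in> I \<and> \<gamma> t = p \<and> param_curvature \<gamma> t = \<kappa>)"

subsection \<open>Induced one-dimensional Lebesgue measure\<close>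

definition arc_length :: "(real \<Rightarrow> real \<times> real) \<Rightarrow> real \<Rightarrow> real \<Rightarrow> real" where
  "arc_length \<gamma> a b = integral {a..b} (\<lambda>t. norm (vector_derivative \<gamma> (at t)))"

text \<open>The Lebesgue outer measure of \<open>A \<subseteq> C\<close> with respect to arc length on \<open>C\<close>: the infimum of the
  total length over all covers of \<open>A\<close> by countably many compact arcs of \<open>C\<close>. It agrees with the
  induced (arc-length) measure on measurable subsets of \<open>C\<close>. Arcs with \<open>a n > b n\<close> are empty,
  so finite covers are included.\<close>

definition curve_measure :: "(real \<times> real) set \<Rightarrow> (real \<times> real) set \<Rightarrow> ennreal" where
  "curve_measure C A = Inf {(\<Sum>n. ennreal (arc_length (\<gamma> n) (a n) (b n))) | \<gamma> I a b.
      (\<forall>n::nat. local_param 1 C (\<gamma> n) (I n) \<and> {a n..b n} \<subseteq> I n) \<and>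
      A \<subseteq> (\<Union>n. \<gamma> n ` {a n..b n})}"

definition nondegenerate_curve :: "(real \<times> real) set \<Rightarrow> bool" where
  "nondegenerate_curve C \<longleftrightarrow> curve_measure C {p \<in> C. has_curvature C p 0} = 0"

end

(* Represent the curve locally as a graph y = f x with f'' of constant sign, over the coordinate with
the smaller of the two functions; by Cauchy condensation the scales t with 2^t max(psi1,psi2)^2 < (3/4)^t
are negligible.  At a scale N = 2^t, Dirichlet's pigeonhole principle applied to the forms q, q x - p and
q f(x) - r - f'(x) (q x - p) gives for every x a rational point near the curve whose first coordinate
is close to x, with q <= N.  Quantitative nondivergence (Kleinbock-Margulis), which for lattices in
dimension three follows from a two-step dyadic stopping argument, shows that q >= c N for x outside at
most half of any given interval.  Hence the first coordinates of these rational points form a ubiquitous system: a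
maximal separated subset has the right cardinality, neighbourhoods at different scales are
quasi-independent on average, and the second moment method shows that the approximable points fill a
fixed proportion of every interval.  By a density argument they have full measure. *)

theory Submission
  imports Defs
begin

section \<open>Outer measure bounds and dyadic stopping\<close>

text \<open>The tangent form \<open>q f(x) - r - f'(x) (q x - p)\<close> is \<open>q\<close> times
  the height of the tangent line above \<open>p / q\<close>, minus \<open>r\<close>; by Taylor it
  differs from \<open>q f(p/q) - r\<close> by at most a constant times
  \<open>(q x - p)^2 / q\<close>. Dirichlet alone may return a small \<open>q\<close>, which would
  leave \<open>p / q\<close> too far from \<open>x\<close>; this is the obstacle that nondivergence
  removes. The scales match as follows: a tolerance of order \<open>\<psi>2 N\<close> in the second
  coordinate goes with fractions spaced by about \<open>1 / (\<psi>2 N * N^2)\<close>, each serving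
  a neighbourhood of radius about \<open>\<psi>1 N / N\<close>. The proportion covered is of order
  \<open>N * \<psi>1 N * \<psi>2 N\<close>, a term of the condensed series. With the smaller
  function on the first coordinate, the variation of \<open>q f\<close> over such a neighbourhood
  stays within the tolerance, because \<open>f\<close> is Lipschitz. The ratio 3/4 stands for any
  number strictly between 1/2 and 1: below 1, so that the discarded scales are summable; above 1/2,
  so that \<open>2^t * \<psi>2 (2^t)\<close> tends to infinity, as the nondivergence estimate
  requires.\<close>

text \<open>A bound for Lebesgue outer measure, witnessed by a Borel cover. The exceptional sets are
  defined through quantifiers over integer vectors, and this form avoids any discussion of their
  measurability.\<close>

definition outer_le :: "real set \<Rightarrow> real \<Rightarrow> bool" where
  "outer_le S e \<longleftrightarrow> (\<exists>Z\<in>sets lborel. S \<subseteq> Z \<and> emeasure lborel Z \<le> ennreal e)"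

lemma outer_le_mono: "outer_le S e \<Longrightarrow> S' \<subseteq> S \<Longrightarrow> e \<le> e' \<Longrightarrow> outer_le S' e'"
  unfolding outer_le_def by (meson ennreal_leI order_trans subset_trans)

lemma outer_le_empty: "outer_le {} e"
  unfolding outer_le_def by (rule bexI[of _ "{}"]) auto

lemma outer_le_interval: "a \<le> b \<Longrightarrow> outer_le {a..b} (b - a)"
  unfolding outer_le_def by (rule bexI[of _ "{a..b}"]) auto

lemma outer_le_Un:
  assumes "outer_le S a" "outer_le T b" "0 \<le> a" "0 \<le> b"
  shows "outer_le (S \<union> T) (a + b)"
proof -
  obtain X where X: "X \<in> sets lborel" "S \<subseteq> X" "emeasure lborel X \<le> ennreal a"
    using assms(1) unfolding outer_le_def by blast
  obtain Y where Y: "Y \<in> sets lborel" "T \<subseteq> Y" "emeasure lborel Y \<le> ennreal b"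
    using assms(2) unfolding outer_le_def by blast
  have "emeasure lborel (X \<union> Y) \<le> emeasure lborel X + emeasure lborel Y"
    using X Y by (intro emeasure_subadditive) auto
  also have "\<dots> \<le> ennreal (a + b)"
    using X Y assms by (simp add: add_mono)
  finally show ?thesis
    unfolding outer_le_def using X Y by (intro bexI[of _ "X \<union> Y"]) auto
qed

text \<open>The factor 2 comes from covering by the interval of radius \<open>d\<close> about an
  arbitrary point of the set.\<close>

lemma outer_le_small_diameter:
  assumes "\<And>x y. x \<in> S \<Longrightarrow> y \<in> S \<Longrightarrow> \<bar>x - y\<bar> \<le> d" "0 \<le> d"
  shows "outer_le S (2 * d)"
proof (cases "S = {}")
  case True
  then show ?thesis by (simp add: outer_le_empty)
next
  case False
  then obtain x where x: "x \<in> S" by blast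
  have "outer_le {x - d..x + d} (2 * d)"
    using outer_le_interval[of "x - d" "x + d"] assms(2) by simp
  moreover have "S \<subseteq> {x - d..x + d}"
  proof
    fix y assume "y \<in> S"
    from assms(1)[OF x this] show "y \<in> {x - d..x + d}" by auto
  qed
  ultimately show ?thesis by (rule outer_le_mono) simp
qed

text \<open>Stopping along the dyadic subintervals: a cell is retained when some \<open>g v\<close> stays below \<open>1\<close>
  on it, but none does so on its parent.\<close>

lemma dyadic_stopping:
  fixes g :: "'v \<Rightarrow> real \<Rightarrow> real"
  assumes L: "0 < L" and \<kappa>: "0 \<le> \<kappa>"
    and cont: "\<And>v. v \<in> V \<Longrightarrow> continuous_on {\<alpha>..<\<alpha>+L} (g v)"
    and P0: "s0 \<le> \<alpha>" "\<alpha> + L \<le> e0" "e0 - s0 \<le> 2 * L" "\<And>v. v \<in> V \<Longrightarrow> \<exists>y\<in>{s0..<e0}. 1 \<le> g v y"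
    and cell: "\<And>u w s e v. \<lbrakk>\<alpha> \<le> u; u < w; w \<le> \<alpha> + L; s0 \<le> s; s \<le> u; w \<le> e; e \<le> e0;
        e - s \<le> 2 * (w - u); v \<in> V; \<forall>y\<in>{u..<w}. g v y < 1; \<forall>v\<in>V. \<exists>y\<in>{s..<e}. 1 \<le> g v y\<rbrakk>
        \<Longrightarrow> outer_le {x\<in>{u..<w}. \<not> good x} (\<kappa> * (w - u))"
    and good: "\<And>x. x \<in> {\<alpha>..<\<alpha>+L} \<Longrightarrow> \<forall>v\<in>V. 1 \<le> g v x \<Longrightarrow> good x"
  shows "outer_le {x\<in>{\<alpha>..<\<alpha>+L}. \<not> good x} (\<kappa> * L)"
proof -
  define idx where "idx = (\<lambda>(n::nat) x. \<lfloor>(x - \<alpha>) * 2^n / L\<rfloor>)"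
  define D where "D = (\<lambda>n i. {x. idx n x = i})"
  have D_eq: "D n i = {\<alpha> + real_of_int i * (L / 2^n) ..< \<alpha> + (real_of_int i + 1) * (L / 2^n)}" for n i
  proof -
    have "idx n x = i \<longleftrightarrow> real_of_int i \<le> (x - \<alpha>) * 2^n / L \<and> (x - \<alpha>) * 2^n / L < real_of_int i + 1" for x
      unfolding idx_def by (simp add: floor_eq_iff)
    moreover have "real_of_int i \<le> (x - \<alpha>) * 2^n / L \<longleftrightarrow> \<alpha> + real_of_int i * (L / 2^n) \<le> x" for x
      using L by (simp add: field_simps)
    moreover have "(x - \<alpha>) * 2^n / L < real_of_int i + 1 \<longleftrightarrow> x < \<alpha> + (real_of_int i + 1) * (L / 2^n)" for x
      using L by (simp add: field_simps)
    ultimately show ?thesis unfolding D_def by auto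
  qed
  have D0: "D 0 0 = {\<alpha>..<\<alpha>+L}" by (simp add: D_eq)
  have idx_Suc: "idx n x = idx (Suc n) x div 2" for n x
  proof -
    have "(x - \<alpha>) * 2^n / L = ((x - \<alpha>) * 2^Suc n / L) / real_of_int 2" by simp
    then show ?thesis unfolding idx_def by (subst floor_divide_real_eq_div[symmetric]) simp_all
  qed
  have idx_le: "idx n y = idx n x" if "idx (n + k) y = idx (n + k) x" for n k x y
    using that by (induction k) (auto simp: idx_Suc[of "n + _"])
  have idx_le': "idx n y = idx n x" if "idx m y = idx m x" "n \<le> m" for n m x y
    using idx_le[of n "m - n" y x] that by simp
  define stop where "stop = (\<lambda>n i. \<exists>v\<in>V. \<forall>y\<in>D n i. g v y < 1)"
  have stop_mono: "stop m (idx m x)" if "stop n (idx n x)" "n \<le> m" for n m x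
  proof -
    have "D m (idx m x) \<subseteq> D n (idx n x)" unfolding D_def by (auto intro: idx_le'[OF _ that(2)])
    then show ?thesis using that(1) unfolding stop_def by blast
  qed
  define St where "St = {(n, i). D n i \<subseteq> {\<alpha>..<\<alpha>+L} \<and> stop n i \<and> (n = 0 \<or> \<not> stop (n - 1) (i div 2))}"
  have disj: "disjoint_family_on (\<lambda>(n, i). D n i) St"
  proof -
    have aux: "False" if "(n, i) \<in> St" "(m, j) \<in> St" "x \<in> D n i" "x \<in> D m j" "n < m" for n i m j x
    proof -
      have e: "i = idx n x" "j = idx m x" using that by (auto simp: D_def)
      have "j div 2 = idx (m - 1) x" using idx_Suc[of "m - 1" x] that(5) e by simp
      moreover have "stop (m - 1) (idx (m - 1) x)"
        using stop_mono[of n x "m - 1"] that e by (auto simp: St_def)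
      ultimately show False using that by (auto simp: St_def)
    qed
    show ?thesis unfolding disjoint_family_on_def
    proof (intro ballI impI)
      fix p q assume pq: "p \<in> St" "q \<in> St" "p \<noteq> q"
      obtain n i m j where e: "p = (n, i)" "q = (m, j)" by (metis surj_pair)
      have "False" if x: "x \<in> D n i" "x \<in> D m j" for x
      proof -
        have "n = m" using aux[OF _ _ x] aux[OF _ _ x(2,1)] pq e by (metis linorder_neqE_nat)
        then show False using pq e x by (auto simp: D_def)
      qed
      then show "(case p of (n, i) \<Rightarrow> D n i) \<inter> (case q of (n, i) \<Rightarrow> D n i) = {}"
        using e by auto
    qed
  qed
  have cells: "\<exists>Z\<in>sets lborel. {x\<in>D n i. \<not> good x} \<subseteq> Z \<and> emeasure lborel Z \<le> ennreal (\<kappa> * (L / 2^n))"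
    if St: "(n, i) \<in> St" for n i
  proof -
    define u where "u = \<alpha> + real_of_int i * (L / 2^n)"
    define w where "w = \<alpha> + (real_of_int i + 1) * (L / 2^n)"
    have wu1: "w - u = L / 2^n" by (simp add: u_def w_def distrib_right add_divide_distrib)
    have wu: "w - u = L / 2^n" "u < w" using wu1 divide_pos_pos[OF L, of "2^n"] by auto
    have Du: "D n i = {u..<w}" by (simp add: D_eq u_def w_def)
    have J: "\<alpha> \<le> u" "w \<le> \<alpha> + L" using St wu(2) by (auto simp: St_def Du)
    obtain v where v: "v \<in> V" "\<forall>y\<in>{u..<w}. g v y < 1"
      using St by (auto simp: St_def stop_def Du)
    \<comment> \<open>A surrounding interval of at most twice the length on which every
      \<open>g v\<close> reaches 1: the parent cell, or \<open>{s0..<e0}\<close> for the root.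
      Prescribing the root's surroundings is what lets this argument be run again inside a cell of
      another stopping.\<close>
    have "\<exists>s e. s0 \<le> s \<and> s \<le> u \<and> w \<le> e \<and> e \<le> e0 \<and> e - s \<le> 2 * (w - u) \<and> (\<forall>v\<in>V. \<exists>y\<in>{s..<e}. 1 \<le> g v y)"
    proof (cases n)
      case 0
      then have "w - u = L" using wu by simp
      then show ?thesis using J P0 by (intro exI[of _ s0] exI[of _ e0]) auto
    next
      case (Suc k)
      have ns: "\<not> stop k (i div 2)" using St Suc by (auto simp: St_def)
      define s where "s = \<alpha> + real_of_int (i div 2) * (L / 2^k)"
      define e where "e = \<alpha> + (real_of_int (i div 2) + 1) * (L / 2^k)"
      have De: "D k (i div 2) = {s..<e}" by (simp add: D_eq s_def e_def)
      have es: "e - s = 2 * (w - u)" unfolding wu using Suc by (simp add: s_def e_def distrib_right add_divide_distrib)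
      have sub: "D n i \<subseteq> D k (i div 2)" using Suc unfolding D_def by (auto simp: idx_Suc[of k])
      have su: "s \<le> u" "w \<le> e" using sub wu(2) unfolding Du De by auto
      have "D k (i div 2) \<subseteq> D 0 0"
      proof
        fix y assume y: "y \<in> D k (i div 2)"
        have "u \<in> D n i" using wu Du by auto
        then have "u \<in> D k (i div 2)" "u \<in> D 0 0" using sub J wu(2) unfolding D0 by auto
        then show "y \<in> D 0 0" using idx_le'[of k y u 0] y by (auto simp: D_def)
      qed
      then have "\<alpha> \<le> s" "e \<le> \<alpha> + L" unfolding D0 De using es wu(2) by auto
      moreover have "\<forall>v\<in>V. \<exists>y\<in>{s..<e}. 1 \<le> g v y" using ns unfolding stop_def De by (meson not_le)
      ultimately show ?thesis using su es P0(1,2) by (intro exI[of _ s] exI[of _ e]) auto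
    qed
    then obtain s e where se: "s0 \<le> s" "s \<le> u" "w \<le> e" "e \<le> e0" "e - s \<le> 2 * (w - u)"
      "\<forall>v\<in>V. \<exists>y\<in>{s..<e}. 1 \<le> g v y" by blast
    from cell[OF J(1) wu(2) J(2) se(1-5) v se(6)]
    show ?thesis unfolding outer_le_def Du wu .
  qed
  then have "\<exists>Zf. \<forall>p\<in>St. Zf p \<in> sets lborel \<and> {x\<in>D (fst p) (snd p). \<not> good x} \<subseteq> Zf p \<and>
      emeasure lborel (Zf p) \<le> ennreal (\<kappa> * (L / 2^fst p))"
    by (intro bchoice) (auto simp: Bex_def)
  then obtain Zf where Zf: "\<And>p. p \<in> St \<Longrightarrow> Zf p \<in> sets lborel"
      "\<And>p. p \<in> St \<Longrightarrow> {x\<in>D (fst p) (snd p). \<not> good x} \<subseteq> Zf p"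
      "\<And>p. p \<in> St \<Longrightarrow> emeasure lborel (Zf p) \<le> ennreal (\<kappa> * (L / 2^fst p))" by blast
  \<comment> \<open>Cutting the covers down to their disjoint cells makes the measures add up to at
    most \<open>\<kappa>\<close> times the measure of the union of the cells.\<close>
  define Z where "Z = (\<lambda>p. Zf p \<inter> D (fst p) (snd p))"
  have cSt: "countable St" by (rule countableI_type)
  have Dm: "D n i \<in> sets lborel" for n i by (simp add: D_eq)
  have Dme: "emeasure lborel (D n i) = ennreal (L / 2^n)" for n i
    using L by (simp add: D_eq distrib_right add_divide_distrib)
  have Zm: "Z p \<in> sets lborel" if "p \<in> St" for p using Zf(1)[OF that] Dm by (simp add: Z_def)
  have Zle: "emeasure lborel (Z p) \<le> ennreal \<kappa> * emeasure lborel (D (fst p) (snd p))" if "p \<in> St" for p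
  proof -
    have "emeasure lborel (Z p) \<le> emeasure lborel (Zf p)"
      using Zf(1)[OF that] by (intro emeasure_mono) (auto simp: Z_def)
    also have "\<dots> \<le> ennreal (\<kappa> * (L / 2^fst p))" using Zf(3)[OF that] .
    finally show ?thesis unfolding Dme using L \<kappa> by (simp add: ennreal_mult[symmetric])
  qed
  have "emeasure lborel (\<Union>p\<in>St. Z p) = (\<integral>\<^sup>+p. emeasure lborel (Z p) \<partial>count_space St)"
  proof (rule emeasure_UN_countable)
    show "disjoint_family_on Z St" using disj unfolding disjoint_family_on_def Z_def by fastforce
  qed (use Zm cSt in auto)
  also have "\<dots> \<le> (\<integral>\<^sup>+p. ennreal \<kappa> * emeasure lborel (D (fst p) (snd p)) \<partial>count_space St)"
    by (intro nn_integral_mono) (use Zle in auto)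
  also have "\<dots> = ennreal \<kappa> * (\<integral>\<^sup>+p. emeasure lborel (D (fst p) (snd p)) \<partial>count_space St)"
    by (intro nn_integral_cmult) auto
  also have "(\<integral>\<^sup>+p. emeasure lborel (D (fst p) (snd p)) \<partial>count_space St) = emeasure lborel (\<Union>p\<in>St. D (fst p) (snd p))"
  proof (rule emeasure_UN_countable[symmetric])
    show "disjoint_family_on (\<lambda>p. D (fst p) (snd p)) St" using disj by (simp add: case_prod_beta')
  qed (use Dm cSt in auto)
  also have "\<dots> \<le> emeasure lborel {\<alpha>..<\<alpha>+L}"
    by (intro emeasure_mono) (auto simp: St_def)
  also have "ennreal \<kappa> * emeasure lborel {\<alpha>..<\<alpha>+L} = ennreal (\<kappa> * L)"
    using L \<kappa> by (simp add: ennreal_mult)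
  finally have "emeasure lborel (\<Union>p\<in>St. Z p) \<le> ennreal (\<kappa> * L)" by (simp add: mult_left_mono)
  moreover have "(\<Union>p\<in>St. Z p) \<in> sets lborel" using Zm cSt by (intro sets.countable_UN') auto
  moreover have "{x\<in>{\<alpha>..<\<alpha>+L}. \<not> good x} \<subseteq> (\<Union>p\<in>St. Z p)"
  proof
    fix x assume x: "x \<in> {x\<in>{\<alpha>..<\<alpha>+L}. \<not> good x}"
    then have "\<exists>v\<in>V. g v x < 1" using good[of x] by (metis (no_types, lifting) mem_Collect_eq not_le)
    then obtain v where v: "v \<in> V" "g v x < 1" by blast
    \<comment> \<open>By continuity \<open>g v\<close> stays below 1 near \<open>x\<close>, so all
      sufficiently fine cells around \<open>x\<close> are stopped; the coarsest stopped one belongs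
      to \<open>St\<close>.\<close>
    have "\<exists>d>0. \<forall>y\<in>{\<alpha>..<\<alpha>+L}. dist y x < d \<longrightarrow> dist (g v y) (g v x) < 1 - g v x"
      using cont[OF v(1)] x v(2) unfolding continuous_on_iff by (smt (verit) mem_Collect_eq)
    then obtain d where d: "d > 0" "\<And>y. y \<in> {\<alpha>..<\<alpha>+L} \<Longrightarrow> dist y x < d \<Longrightarrow> g v y < 1"
      by (fastforce simp: dist_real_def)
    obtain n where n: "L / d < 2^n" using real_arch_pow[of 2 "L/d"] by auto
    have Dx: "D m (idx m x) \<subseteq> {\<alpha>..<\<alpha>+L}" for m
    proof -
      have "D m (idx m x) \<subseteq> D 0 (idx 0 x)" unfolding D_def by (auto intro: idx_le'[of m _ x 0])
      moreover have "idx 0 x = 0" using x unfolding mem_Collect_eq D0[symmetric] by (auto simp: D_def)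
      ultimately show ?thesis unfolding D0[symmetric] by simp
    qed
    have "stop n (idx n x)" unfolding stop_def
    proof (intro bexI[OF _ v(1)] ballI)
      fix y assume y: "y \<in> D n (idx n x)"
      have "x \<in> D n (idx n x)" by (simp add: D_def)
      then have "\<bar>y - x\<bar> < L / 2^n" using y unfolding D_eq distrib_right by auto
      also have "\<dots> < d" using n d by (simp add: field_simps)
      finally have "dist y x < d" by (simp add: dist_real_def)
      moreover have "y \<in> {\<alpha>..<\<alpha>+L}" using y Dx by blast
      ultimately show "g v y < 1" by (rule d(2)[rotated])
    qed
    then obtain k where k: "stop k (idx k x)" "\<And>m. m < k \<Longrightarrow> \<not> stop m (idx m x)"
      using exists_least_iff[of "\<lambda>k. stop k (idx k x)"] by blast
    have "(k, idx k x) \<in> St" unfolding St_def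
      using Dx k idx_Suc[of "k - 1" x] by (cases k) (auto simp: idx_Suc[symmetric])
    moreover have "x \<in> Z (k, idx k x)" using Zf(2)[OF calculation] x by (auto simp: Z_def D_def)
    ultimately show "x \<in> (\<Union>p\<in>St. Z p)" by blast
  qed
  ultimately show ?thesis unfolding outer_le_def by blast
qed

section \<open>Nondivergence for integer vectors in dimension three\<close>

fun idot :: "int \<times> int \<times> int \<Rightarrow> int \<times> int \<times> int \<Rightarrow> int" where
  "idot (a, b, c) (x, y, z) = a * x + b * y + c * z"

fun icross :: "int \<times> int \<times> int \<Rightarrow> int \<times> int \<times> int \<Rightarrow> int \<times> int \<times> int" where
  "icross (a, b, c) (x, y, z) = (b * z - c * y, c * x - a * z, a * y - b * x)"

fun iscale :: "int \<Rightarrow> int \<times> int \<times> int \<Rightarrow> int \<times> int \<times> int" where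
  "iscale k (x, y, z) = (k * x, k * y, k * z)"

text \<open>The Bezout form of "the entries have gcd 1". The witness \<open>u\<close> gives an
  integer coefficient directly when a vector parallel to \<open>v\<close> is to be written as a
  multiple of \<open>v\<close>.\<close>

definition primitive :: "int \<times> int \<times> int \<Rightarrow> bool" where
  "primitive v \<longleftrightarrow> (\<exists>u. idot u v = 1)"

lemma primitive_nonzero: "primitive v \<Longrightarrow> v \<noteq> 0"
  by (auto simp: primitive_def zero_prod_def)

lemma idot_commute: "idot v w = idot w v"
  by (cases v; cases w) (simp add: algebra_simps)

lemma idot_iscale: "idot (iscale k v) w = k * idot v w"
  by (cases v; cases w) (simp add: algebra_simps)

lemma idot_icross: "idot (icross v w) w = 0" "idot (icross v w) v = 0"
  by (cases v; cases w; simp add: algebra_simps)+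

text \<open>The triple product expansion: \<open>(v x w) x a\<close> equals
  \<open>(a . v) w - (a . w) v\<close>. Hence a vector orthogonal to both \<open>v\<close> and
  \<open>w\<close> is parallel to their cross product.\<close>

lemma icross_icross_eq_0: "idot a v = 0 \<Longrightarrow> idot a w = 0 \<Longrightarrow> icross (icross v w) a = 0"
proof (cases a; cases v; cases w)
  fix a1 a2 a3 v1 v2 v3 w1 w2 w3
  assume e: "a = (a1, a2, a3)" "v = (v1, v2, v3)" "w = (w1, w2, w3)" and "idot a v = 0" "idot a w = 0"
  then have h: "a1 * v1 + a2 * v2 + a3 * v3 = 0" "a1 * w1 + a2 * w2 + a3 * w3 = 0" by auto
  have "(v3*w1 - v1*w3)*a3 - (v1*w2 - v2*w1)*a2 = w1 * (a1 * v1 + a2 * v2 + a3 * v3) - v1 * (a1 * w1 + a2 * w2 + a3 * w3)"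
    "(v1*w2 - v2*w1)*a1 - (v2*w3 - v3*w2)*a3 = w2 * (a1 * v1 + a2 * v2 + a3 * v3) - v2 * (a1 * w1 + a2 * w2 + a3 * w3)"
    "(v2*w3 - v3*w2)*a2 - (v3*w1 - v1*w3)*a1 = w3 * (a1 * v1 + a2 * v2 + a3 * v3) - v3 * (a1 * w1 + a2 * w2 + a3 * w3)"
    by (simp_all add: algebra_simps)
  then show ?thesis using e h by (simp add: zero_prod_def)
qed

text \<open>With \<open>u . v = 1\<close>, expanding \<open>u x (w x v) = 0\<close> gives
  \<open>w = (u . w) v\<close>, and the coefficient is an integer.\<close>

lemma primitive_icross_eq_0:
  assumes "primitive v" "icross w v = 0"
  shows "\<exists>k. w = iscale k v"
proof -
  obtain u where u: "idot u v = 1" using assms(1) primitive_def by blast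
  obtain u1 u2 u3 v1 v2 v3 w1 w2 w3 where e: "u = (u1, u2, u3)" "v = (v1, v2, v3)" "w = (w1, w2, w3)"
    by (metis surj_pair)
  have h: "w2 * v3 - w3 * v2 = 0" "w3 * v1 - w1 * v3 = 0" "w1 * v2 - w2 * v1 = 0"
      "u1 * v1 + u2 * v2 + u3 * v3 = 1"
    using assms(2) u e by (auto simp: zero_prod_def)
  have "w1 * (u1 * v1 + u2 * v2 + u3 * v3) = (u1 * w1 + u2 * w2 + u3 * w3) * v1
       + u2 * (w1 * v2 - w2 * v1) - u3 * (w3 * v1 - w1 * v3)"
    "w2 * (u1 * v1 + u2 * v2 + u3 * v3) = (u1 * w1 + u2 * w2 + u3 * w3) * v2
       + u3 * (w2 * v3 - w3 * v2) - u1 * (w1 * v2 - w2 * v1)"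
    "w3 * (u1 * v1 + u2 * v2 + u3 * v3) = (u1 * w1 + u2 * w2 + u3 * w3) * v3
       + u1 * (w3 * v1 - w1 * v3) - u2 * (w2 * v3 - w3 * v2)"
    by (simp_all add: algebra_simps)
  then have "w = iscale (u1 * w1 + u2 * w2 + u3 * w3) v" using h e by simp
  then show ?thesis ..
qed

lemma ex_primitive_multiple:
  assumes "v \<noteq> 0"
  shows "\<exists>k w. v = iscale k w \<and> k \<noteq> 0 \<and> primitive w"
proof -
  obtain a b c where e: "v = (a, b, c)" by (metis surj_pair)
  define d where "d = gcd a (gcd b c)"
  have d0: "d \<noteq> 0" using assms e by (auto simp: d_def zero_prod_def)
  have "d dvd a" "d dvd b" "d dvd c" unfolding d_def by (auto intro: dvd_trans)
  then obtain x y z where xyz: "a = d * x" "b = d * y" "c = d * z" by (auto simp: dvd_def)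
  obtain s t where st: "s * b + t * c = gcd b c" using bezout_int by blast
  obtain p q where pq: "p * a + q * gcd b c = d" using bezout_int unfolding d_def by blast
  have "p * a + q * (s * b + t * c) = d" using st pq by simp
  then have "d * (p * x + (q * s) * y + (q * t) * z) = d * 1" unfolding xyz by (simp add: algebra_simps)
  then have "idot (p, q * s, q * t) (x, y, z) = 1" unfolding mult_left_cancel[OF d0] by simp
  then have "primitive (x, y, z)" unfolding primitive_def by blast
  moreover have "v = iscale d (x, y, z)" using e xyz by simp
  ultimately show ?thesis using d0 by blast
qed

text \<open>The index \<open>b\<close> distinguishes the lattice from its dual, so \<open>icross\<close> exchanges the two norms.\<close>

locale dual_norms =
  fixes N :: "bool \<Rightarrow> int \<times> int \<times> int \<Rightarrow> real \<Rightarrow> real"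
  assumes nonneg: "0 \<le> N b v x"
    and scale: "N b (iscale k v) x = \<bar>real_of_int k\<bar> * N b v x"
    and dot: "\<bar>real_of_int (idot v w)\<bar> \<le> 3 * N b v x * N (\<not> b) w x"
    and cross: "N (\<not> b) (icross v w) x \<le> 2 * N b v x * N b w x"
begin

lemma norm_multiple_ge: "k \<noteq> 0 \<Longrightarrow> N b v x \<le> N b (iscale k v) x"
  using mult_right_mono[of 1 "\<bar>real_of_int k\<bar>" "N b v x"] nonneg[of b v x] by (simp add: scale)

text \<open>An integer of absolute value less than 1 vanishes: sufficiently short vectors of the
  lattice and of its dual are orthogonal.\<close>

lemma idot_eq_0:
  assumes "N b v x \<le> c" "N (\<not> b) w x \<le> d" "3 * c * d < 1"
  shows "idot v w = 0"
proof -
  have "N b v x * N (\<not> b) w x \<le> c * d"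
    using assms(1,2) nonneg[of b v x] nonneg[of "\<not> b" w x] by (intro mult_mono) auto
  then have "\<bar>real_of_int (idot v w)\<bar> < 1" using dot[of v w b x] assms(3) by linarith
  then show ?thesis by linarith
qed

text \<open>A flag consisting of \<open>v\<close> and possibly \<open>a\<close>, all of whose members have norm in \<open>[\<eta>, 1)\<close> and
  which is maximal among the vectors of norm less than \<open>1\<close>, excludes much shorter vectors.\<close>

lemma no_short_vector_of_flag:
  assumes \<eta>: "0 < \<eta>" "\<eta> < 1" and v: "primitive v" "\<eta> \<le> N b v x" "N b v x < 1"
    and flag: "(\<forall>a. primitive a \<longrightarrow> idot a v = 0 \<longrightarrow> 1 \<le> N (\<not> b) a x) \<or>
      (\<exists>a. primitive a \<and> idot a v = 0 \<and> \<eta> \<le> N (\<not> b) a x \<and> N (\<not> b) a x < 1)"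
    and w: "w \<noteq> 0"
  shows "\<eta> / 3 \<le> N b' w x"
proof (rule ccontr)
  assume "\<not> ?thesis"
  then have small: "N b' w x < \<eta> / 3" by simp
  \<comment> \<open>A short nonzero \<open>c\<close> orthogonal to \<open>v\<close> has a primitive
    part that is at least as short. This contradicts the first alternative of \<open>flag\<close>,
    so the second one supplies \<open>a\<close>.\<close>
  have key: "\<exists>a. primitive a \<and> idot a v = 0 \<and> \<eta> \<le> N (\<not> b) a x \<and> N (\<not> b) a x < 1"
    if c: "c \<noteq> 0" "idot c v = 0" "N (\<not> b) c x < \<eta>" for c
  proof -
    obtain k c' where k: "c = iscale k c'" "k \<noteq> 0" "primitive c'" using ex_primitive_multiple[OF c(1)] by blast
    then have "N (\<not> b) c' x < 1" "idot c' v = 0"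
      using norm_multiple_ge[of k "\<not> b" c' x] c \<eta> by (auto simp: idot_iscale)
    then have "\<not> 1 \<le> N (\<not> b) c' x" by simp
    then show ?thesis using flag k(3) \<open>idot c' v = 0\<close> by blast
  qed
  \<comment> \<open>A nonzero vector parallel to a primitive one is an integer multiple of it, hence
    not shorter.\<close>
  have mult: False if h: "primitive a" "\<eta> \<le> N b'' a x" "icross c a = 0" "c \<noteq> 0" "N b'' c x < \<eta>" for a c b''
  proof -
    obtain k where k: "c = iscale k a" using primitive_icross_eq_0 h by blast
    then have "k \<noteq> 0" using h(4) by (cases a) (auto simp: zero_prod_def)
    then show False using norm_multiple_ge[of k b'' a x] h k by simp
  qed
  \<comment> \<open>The divisor 3 in \<open>\<eta> / 3\<close> is used here: the factor 2 of the
    cross product bound still leaves the norm below \<open>\<eta>\<close>.\<close>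
  have cr: "N (\<not> b'') (icross c a) x < \<eta>" if "N b'' c x < \<eta> / 3" "N b'' a x < 1" for c a b''
  proof -
    have "N b'' c x * N b'' a x \<le> (\<eta> / 3) * 1"
      using that \<eta> nonneg by (intro mult_mono) auto
    then show ?thesis using cross[of b'' c a x] \<eta> by linarith
  qed
  show False
  proof (cases "b' = b")
    case True
    \<comment> \<open>If \<open>w\<close> is in the same lattice as \<open>v\<close>, then
      \<open>c\<close> is a short dual vector orthogonal to \<open>v\<close>, so the member
      \<open>a\<close> of the flag exists. It is orthogonal to \<open>w\<close> as well as to
      \<open>v\<close>, hence parallel to \<open>c\<close>, although \<open>c\<close> is too short
      for that.\<close>
    define c where "c = icross w v"
    have c0: "c \<noteq> 0" using mult[of v b w] v w small True \<eta> unfolding c_def by auto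
    have cN: "N (\<not> b) c x < \<eta>" unfolding c_def using cr[of b w v] small True v by simp
    have cv: "idot c v = 0" by (simp add: c_def idot_icross)
    obtain a where a: "primitive a" "idot a v = 0" "\<eta> \<le> N (\<not> b) a x" "N (\<not> b) a x < 1"
      using key[OF c0 cv cN] by blast
    have "idot w a = 0" using idot_eq_0[of b w x "\<eta> / 3" a 1] small True a \<eta> by simp
    then have "icross c a = 0" unfolding c_def
      using icross_icross_eq_0[of a w v] a(2) by (simp add: idot_commute)
    then show False using mult[of a "\<not> b" c] a c0 cN by simp
  next
    case False
    then have b': "b' = (\<not> b)" by auto
    have wv: "idot w v = 0" using idot_eq_0[of "\<not> b" w x "\<eta> / 3" v 1] small b' v \<eta> by simp
    obtain a where a: "primitive a" "idot a v = 0" "\<eta> \<le> N (\<not> b) a x" "N (\<not> b) a x < 1"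
      using key[OF w wv] small b' \<eta> by auto
    \<comment> \<open>If \<open>w\<close> is a dual vector, it is orthogonal to \<open>v\<close>, so
      \<open>a\<close> exists; now \<open>c\<close> is a short vector orthogonal to both
      \<open>w\<close> and \<open>a\<close>, as is \<open>v\<close>, and hence a multiple of
      \<open>v\<close>.\<close>
    define c where "c = icross w a"
    have c0: "c \<noteq> 0" using mult[of a "\<not> b" w] a w small b' \<eta> unfolding c_def by auto
    have cN: "N b c x < \<eta>" unfolding c_def using cr[of "\<not> b" w a] small b' a by simp
    have "icross c v = 0" unfolding c_def
      using icross_icross_eq_0[of v w a] a(2) wv by (simp add: idot_commute)
    then show False using mult[of v b c] v c0 cN by simp
  qed
qed

text \<open>The outer stopping selects a primitive \<open>v\<close> that is below 1 on a cell but
  not on its parent, the inner one a primitive dual \<open>a\<close> orthogonal to \<open>v\<close>.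
  Where neither drops below \<open>\<eta>\<close> they form a flag that excludes short vectors. Each
  drop is controlled by \<open>good\<close> on a parent of at most twice the length of the cell, so
  each of the two stoppings costs \<open>2 * \<kappa>\<close>.\<close>

theorem quantitative_nondivergence:
  assumes L: "0 < L" and \<eta>: "0 < \<eta>" "\<eta> < 1" and \<kappa>: "0 \<le> \<kappa>"
    and cont: "\<And>b v. continuous_on {\<alpha>..<\<alpha>+L} (N b v)"
    and sup: "\<And>b v. v \<noteq> 0 \<Longrightarrow> \<exists>y\<in>{\<alpha>..<\<alpha>+L}. 1 \<le> N b v y"
    and good: "\<And>b v s e. \<lbrakk>v \<noteq> 0; \<alpha> \<le> s; s < e; e \<le> \<alpha> + L; \<exists>y\<in>{s..<e}. 1 \<le> N b v y\<rbrakk>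
       \<Longrightarrow> outer_le {x\<in>{s..<e}. N b v x < \<eta>} (\<kappa> * (e - s))"
  shows "outer_le {x\<in>{\<alpha>..<\<alpha>+L}. \<exists>b v. v \<noteq> 0 \<and> N b v x < \<eta> / 3} (4 * \<kappa> * L)"
proof -
  define ok where "ok = (\<lambda>x. \<forall>b v. v \<noteq> 0 \<longrightarrow> \<eta> / 3 \<le> N b v x)"
  have "outer_le {x\<in>{\<alpha>..<\<alpha>+L}. \<not> ok x} ((4 * \<kappa>) * L)"
  proof (rule dyadic_stopping[where V = "{p. primitive (snd p)}" and g = "\<lambda>p. N (fst p) (snd p)"
        and ?s0.0 = \<alpha> and ?e0.0 = "\<alpha> + L"])
    fix x assume a: "\<forall>p\<in>{p. primitive (snd p)}. 1 \<le> N (fst p) (snd p) x"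
    show "ok x" unfolding ok_def
    proof (intro allI impI)
      fix b and v :: "int \<times> int \<times> int" assume "v \<noteq> 0"
      then obtain k w where k: "v = iscale k w" "k \<noteq> 0" "primitive w" using ex_primitive_multiple by blast
      then have "1 \<le> N b w x" using a by (metis (mono_tags) fst_conv mem_Collect_eq snd_conv)
      then show "\<eta> / 3 \<le> N b v x" using norm_multiple_ge[of k b w x] k \<eta> by simp
    qed
  next
    fix u w s e p
    assume I: "\<alpha> \<le> u" "u < w" "w \<le> \<alpha> + L" "\<alpha> \<le> s" "s \<le> u" "w \<le> e" "e \<le> \<alpha> + L" "e - s \<le> 2 * (w - u)"
      and p: "p \<in> {p. primitive (snd p)}" "\<forall>y\<in>{u..<w}. N (fst p) (snd p) y < 1"
      and par: "\<forall>p\<in>{p. primitive (snd p)}. \<exists>y\<in>{s..<e}. 1 \<le> N (fst p) (snd p) y"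
    obtain b v where bv: "p = (b, v)" by (cases p)
    have v: "primitive v" "\<And>y. y \<in> {u..<w} \<Longrightarrow> N b v y < 1" using p bv by auto
    have par': "\<exists>y\<in>{s..<e}. 1 \<le> N b' v' y" if "primitive v'" for b' v' using bspec[OF par, of "(b', v')"] that by simp
    \<comment> \<open>The second stopping runs inside the cell and starts from the parent
      \<open>{s..<e}\<close> of the first: there all primitive vectors of both kinds reach 1, in
      particular the dual ones orthogonal to \<open>v\<close>.\<close>
    have "outer_le {x\<in>{u..<u+(w-u)}. \<not> (N b v x < \<eta> \<or> ok x)} ((2 * \<kappa>) * (w - u))"
    proof (rule dyadic_stopping[where V = "{a. primitive a \<and> idot a v = 0}" and g = "N (\<not> b)"
        and ?s0.0 = s and ?e0.0 = e])
      show "continuous_on {u..<u + (w - u)} (N (\<not> b) a)" for a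
        using cont by (rule continuous_on_subset) (use I in auto)
      show "\<exists>y\<in>{s..<e}. 1 \<le> N (\<not> b) a y" if "a \<in> {a. primitive a \<and> idot a v = 0}" for a
        using par' that by blast
    next
      fix x assume x: "x \<in> {u..<u + (w - u)}" and a: "\<forall>a\<in>{a. primitive a \<and> idot a v = 0}. 1 \<le> N (\<not> b) a x"
      show "N b v x < \<eta> \<or> ok x"
      proof (cases "N b v x < \<eta>")
        case False
        then show ?thesis unfolding ok_def
          using no_short_vector_of_flag[OF \<eta> v(1), of b x] v(2)[of x] a x by auto
      qed simp
    next
      fix u' w' s' e' a
      assume I': "u \<le> u'" "u' < w'" "w' \<le> u + (w - u)" "s \<le> s'" "s' \<le> u'" "w' \<le> e'" "e' \<le> e"
         "e' - s' \<le> 2 * (w' - u')"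
       and a: "a \<in> {a. primitive a \<and> idot a v = 0}" "\<forall>y\<in>{u'..<w'}. N (\<not> b) a y < 1"
       and apar: "\<forall>a\<in>{a. primitive a \<and> idot a v = 0}. \<exists>y\<in>{s'..<e'}. 1 \<le> N (\<not> b) a y"
      have "outer_le {x\<in>{s'..<e'}. N (\<not> b) a x < \<eta>} (\<kappa> * (e' - s'))"
        using bspec[OF apar a(1)] a(1) I I' by (intro good primitive_nonzero) (blast | linarith)+
      then show "outer_le {x \<in> {u'..<w'}. \<not> (N b v x < \<eta> \<or> ok x)} ((2 * \<kappa>) * (w' - u'))"
      proof (rule outer_le_mono)
        show "\<kappa> * (e' - s') \<le> 2 * \<kappa> * (w' - u')"
          using mult_left_mono[OF I'(8) \<kappa>] by (simp add: algebra_simps)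
        show "{x \<in> {u'..<w'}. \<not> (N b v x < \<eta> \<or> ok x)} \<subseteq> {x \<in> {s'..<e'}. N (\<not> b) a x < \<eta>}"
        proof
          fix x assume "x \<in> {x \<in> {u'..<w'}. \<not> (N b v x < \<eta> \<or> ok x)}"
          then have x: "u' \<le> x" "x < w'" "\<not> ok x" "\<eta> \<le> N b v x" by auto
          have "N (\<not> b) a x < \<eta>"
          proof (rule ccontr)
            assume n: "\<not> ?thesis"
            have xu: "x \<in> {u..<w}" "x \<in> {u'..<w'}" using x I' by auto
            have "primitive a \<and> idot a v = 0 \<and> \<eta> \<le> N (\<not> b) a x \<and> N (\<not> b) a x < 1"
              using a n xu by auto
            then have "\<eta> / 3 \<le> N b' c x" if "c \<noteq> 0" for b' c
              using no_short_vector_of_flag[OF \<eta> v(1) x(4) v(2)[OF xu(1)] _ that] by blast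
            then show False using x(3) unfolding ok_def by blast
          qed
          then show "x \<in> {x \<in> {s'..<e'}. N (\<not> b) a x < \<eta>}" using x I' by auto
        qed
      qed
    qed (use I \<kappa> in auto)
    moreover have "outer_le {x\<in>{s..<e}. N b v x < \<eta>} (\<kappa> * (e - s))"
      using par'[OF v(1), of b] v(1) I by (intro good primitive_nonzero) (blast | linarith)+
    ultimately have "outer_le ({x\<in>{u..<u+(w-u)}. \<not> (N b v x < \<eta> \<or> ok x)} \<union> {x\<in>{s..<e}. N b v x < \<eta>})
        ((2 * \<kappa>) * (w - u) + \<kappa> * (e - s))"
      using I \<kappa> by (intro outer_le_Un) auto
    then show "outer_le {x \<in> {u..<w}. \<not> ok x} (4 * \<kappa> * (w - u))"
    proof (rule outer_le_mono)
      show "2 * \<kappa> * (w - u) + \<kappa> * (e - s) \<le> 4 * \<kappa> * (w - u)"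
        using mult_left_mono[OF I(8) \<kappa>] by (simp add: algebra_simps)
    qed (use I in auto)
  qed (use L \<kappa> cont sup primitive_nonzero in auto)
  then show ?thesis unfolding ok_def by (simp add: not_le)
qed

end

section \<open>Sublevel sets\<close>

text \<open>The scale \<open>k\<close>, which will contain the size of an integer vector, must not
  enter the bound. Since \<open>\<bar>g\<bar>\<close> rises from below 1/2 to 1 inside the interval,
  \<open>k\<close> is at least of order \<open>1 / (c2 * (e - s))\<close>, and the lower Lipschitz
  bound turns this into a bound for the diameter of the sublevel set.\<close>

lemma bilipschitz_sublevel:
  fixes g :: "real \<Rightarrow> real"
  assumes c: "0 < c1" "c1 \<le> c2" and k: "0 \<le> k" and se: "s < e" and \<eta>: "0 < \<eta>" "\<eta> \<le> 1/2"
    and lower: "\<And>x y. x \<in> {s..e} \<Longrightarrow> y \<in> {s..e} \<Longrightarrow> c1 * k * \<bar>x - y\<bar> \<le> \<bar>g x - g y\<bar>"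
    and upper: "\<And>x y. x \<in> {s..e} \<Longrightarrow> y \<in> {s..e} \<Longrightarrow> \<bar>g x - g y\<bar> \<le> c2 * k * \<bar>x - y\<bar>"
    and big: "y0 \<in> {s..e}" "1 \<le> \<bar>g y0\<bar>"
  shows "outer_le {x\<in>{s..e}. \<bar>g x\<bar> < \<eta>} (8 * (c2 / c1) * \<eta> * (e - s))"
proof -
  have "outer_le {x\<in>{s..e}. \<bar>g x\<bar> < \<eta>} (2 * (4 * (c2 / c1) * \<eta> * (e - s)))"
  proof (rule outer_le_small_diameter)
    fix x y assume x: "x \<in> {x\<in>{s..e}. \<bar>g x\<bar> < \<eta>}" and y: "y \<in> {x\<in>{s..e}. \<bar>g x\<bar> < \<eta>}"
    have "1/2 \<le> \<bar>g y0 - g x\<bar>" using abs_triangle_ineq2[of "g y0" "g x"] big x \<eta> by auto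
    also have "\<dots> \<le> c2 * k * \<bar>y0 - x\<bar>" using upper big x by auto
    also have "\<dots> \<le> c2 * k * (e - s)" using big x c k by (intro mult_left_mono) auto
    finally have 1: "1 \<le> 2 * (c2 * k * (e - s))" by simp
    have 2: "c1 * k * \<bar>x - y\<bar> \<le> 2 * \<eta>" using lower[of x y] x y by auto
    have "c1 * \<bar>x - y\<bar> * 1 \<le> c1 * \<bar>x - y\<bar> * (2 * (c2 * k * (e - s)))"
      using c 1 by (intro mult_left_mono) auto
    also have "\<dots> = (c1 * k * \<bar>x - y\<bar>) * (2 * c2 * (e - s))" by simp
    also have "\<dots> \<le> (2 * \<eta>) * (2 * c2 * (e - s))" using 2 c se by (intro mult_right_mono) auto
    finally show "\<bar>x - y\<bar> \<le> 4 * (c2 / c1) * \<eta> * (e - s)" using c by (simp add: field_simps)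
  qed (use c \<eta> se in auto)
  then show ?thesis by (rule outer_le_mono) (auto simp: mult_ac)
qed

text \<open>\<open>g\<close> behaves like \<open>k * (x - x0)^2 / 2\<close> plus a constant, with
  the critical point \<open>x0\<close> inside or outside the interval. On either side of
  \<open>x0\<close> the sublevel set has diameter at most \<open>d\<close>; each side costs
  \<open>2 * d\<close>, and \<open>4 * d\<close> is the asserted bound. As before, the value at
  \<open>y0\<close> eliminates \<open>k\<close>.\<close>

lemma quadratic_sublevel:
  fixes g g' :: "real \<Rightarrow> real"
  assumes c: "0 < c1" "c1 \<le> c2" and k: "0 \<le> k" and se: "s < e" and \<eta>: "0 < \<eta>" "\<eta> \<le> 1/2"
    and deriv: "\<And>x. x \<in> {s..e} \<Longrightarrow> (g has_real_derivative g' x) (at x)"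
    and right: "\<And>x. x \<in> {s..e} \<Longrightarrow> x0 \<le> x \<Longrightarrow> k * c1 * (x - x0) \<le> g' x \<and> g' x \<le> k * c2 * (x - x0)"
    and left: "\<And>x. x \<in> {s..e} \<Longrightarrow> x \<le> x0 \<Longrightarrow> k * c1 * (x0 - x) \<le> - g' x \<and> - g' x \<le> k * c2 * (x0 - x)"
    and big: "y0 \<in> {s..e}" "1 \<le> \<bar>g y0\<bar>"
  shows "outer_le {x\<in>{s..e}. \<bar>g x\<bar> < \<eta>} (32 * (c2 / c1) * sqrt \<eta> * (e - s))"
proof -
  define l where "l = e - s"
  define D where "D = max \<bar>s - x0\<bar> \<bar>e - x0\<bar>"
  define d where "d = 8 * (c2 / c1) * sqrt \<eta> * l"
  have l: "0 < l" using se by (simp add: l_def)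
  have r: "1 \<le> c2 / c1" using c by simp
  have d0: "0 \<le> d" using c \<eta> l by (simp add: d_def)
  have xD: "\<bar>x - x0\<bar> \<le> D" "D - l \<le> \<bar>x - x0\<bar>" if "x \<in> {s..e}" for x
    using that by (auto simp: D_def l_def)
  have D0: "0 \<le> D" by (simp add: D_def)
  have g'_le: "\<bar>g' x\<bar> \<le> k * c2 * D" if "x \<in> {s..e}" for x
  proof -
    have p: "0 \<le> k * c1" "0 \<le> k * c2" using c k by auto
    have "\<bar>g' x\<bar> \<le> k * c2 * \<bar>x - x0\<bar>"
    proof (cases "x0 \<le> x")
      case True
      then have "0 \<le> k * c1 * (x - x0)" using p by simp
      then show ?thesis using right[OF that True] True by auto
    next
      case False
      then have "0 \<le> k * c1 * (x0 - x)" using p by simp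
      then show ?thesis using left[OF that] False by auto
    qed
    also have "\<dots> \<le> k * c2 * D" using xD(1)[OF that] p by (intro mult_left_mono) auto
    finally show ?thesis .
  qed
  have osc: "\<bar>g y - g x\<bar> \<le> k * c2 * D * l" if xy: "x \<in> {s..e}" "y \<in> {s..e}" "x < y" for x y
  proof -
    have "\<exists>z. x < z \<and> z < y \<and> g y - g x = (y - x) * g' z"
      using xy by (intro MVT2 deriv) auto
    then obtain z where z: "x < z" "z < y" "g y - g x = (y - x) * g' z" by blast
    have "\<bar>g y - g x\<bar> = \<bar>g' z\<bar> * (y - x)" using z xy by (simp add: abs_mult)
    also have "\<dots> \<le> (k * c2 * D) * l"
      using g'_le[of z] z xy D0 k c by (intro mult_mono) (auto simp: l_def)
    finally show ?thesis by simp
  qed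
  have lower: "k * c1 / 2 * (b - a) * \<bar>a + b - 2 * x0\<bar> \<le> \<bar>g b - g a\<bar>"
    if ab: "a \<in> {s..e}" "b \<in> {s..e}" "a < b" "x0 \<le> a \<or> b \<le> x0" for a b
  proof -
    \<comment> \<open>After subtraction of the extremal parabola the function is monotone on each
      side of \<open>x0\<close>; comparing the values at \<open>a\<close> and \<open>b\<close> gives
      the factorized difference of two squares.\<close>
    define G where "G = (\<lambda>x. g x - k * c1 / 2 * (x - x0)\<^sup>2)"
    show ?thesis
    proof (cases "x0 \<le> a")
      case True
      have "G a \<le> G b"
      proof (rule DERIV_nonneg_imp_nondecreasing[where f = G])
        fix x assume "a \<le> x" "x \<le> b"
        then have x: "x \<in> {s..e}" "x0 \<le> x" using ab True by auto
        have "(G has_real_derivative g' x - k * c1 * (x - x0)) (at x)"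
          unfolding G_def by (rule derivative_eq_intros deriv[OF x(1)] refl | simp)+
        then show "\<exists>y. (G has_real_derivative y) (at x) \<and> 0 \<le> y" using right[OF x] by force
      qed (use ab in simp)
      then have "k * c1 / 2 * (b - a) * (a + b - 2 * x0) \<le> g b - g a"
        unfolding G_def by (simp add: power2_eq_square field_simps)
      moreover have "\<bar>a + b - 2 * x0\<bar> = a + b - 2 * x0" using True ab by simp
      ultimately show ?thesis using abs_ge_self[of "g b - g a"] by linarith
    next
      case False
      then have bx: "b \<le> x0" using ab by simp
      have "G b \<le> G a"
      proof (rule DERIV_nonpos_imp_nonincreasing[where f = G])
        fix x assume "a \<le> x" "x \<le> b"
        then have x: "x \<in> {s..e}" "x \<le> x0" using ab bx by auto
        have "(G has_real_derivative g' x - k * c1 * (x - x0)) (at x)"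
          unfolding G_def by (rule derivative_eq_intros deriv[OF x(1)] refl | simp)+
        moreover have "g' x - k * c1 * (x - x0) \<le> 0" using left[OF x] by (simp add: algebra_simps)
        ultimately show "\<exists>y. (G has_real_derivative y) (at x) \<and> y \<le> 0" by blast
      qed (use ab in simp)
      then have "k * c1 / 2 * (b - a) * (2 * x0 - a - b) \<le> g a - g b"
        unfolding G_def by (simp add: power2_eq_square field_simps)
      moreover have e: "\<bar>a + b - 2 * x0\<bar> = 2 * x0 - a - b" using bx ab by simp
      moreover have "g a - g b \<le> \<bar>g b - g a\<bar>" by simp
      ultimately show ?thesis unfolding e by (meson order_trans)
    qed
  qed
  have diam: "b - a \<le> d" if ab: "a \<in> {s..e}" "b \<in> {s..e}" "a < b" "x0 \<le> a \<or> b \<le> x0"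
      "\<bar>g a\<bar> < \<eta>" "\<bar>g b\<bar> < \<eta>" for a b
  proof -
    have "1/2 \<le> \<bar>g y0 - g a\<bar>" using abs_triangle_ineq2[of "g y0" "g a"] big ab \<eta> by auto
    also have "\<dots> \<le> k * c2 * D * l"
      using osc[of a y0] osc[of y0 a] ab(1) big k c D0 l by (cases y0 a rule: linorder_cases) auto
    finally have k1: "1 \<le> 2 * (k * c2 * D * l)" by simp
    have low: "k * c1 / 2 * (b - a) * \<bar>a + b - 2 * x0\<bar> \<le> 2 * \<eta>"
      using lower[OF ab(1-4)] ab(5,6) by linarith
    show ?thesis
    \<comment> \<open>If \<open>x0\<close> is near the interval,
      \<open>b - a \<le> \<bar>a + b - 2 * x0\<bar>\<close> bounds \<open>(b - a)\<^sup>2\<close>,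
      which produces the square root. If it is far away, \<open>g\<close> is essentially of constant
      slope, of order \<open>k * D\<close>, and the bound is linear in
      \<open>\<eta>\<close>.\<close>
    proof (cases "D \<le> 2 * l")
      case True
      have "k * c2 * D * l \<le> k * c2 * (2 * l) * l"
        using True k c l by (intro mult_right_mono mult_left_mono) auto
      then have k2: "1 \<le> 4 * k * c2 * l\<^sup>2" using k1 by (simp add: power2_eq_square)
      have "k * c1 / 2 * (b - a) * (b - a) \<le> k * c1 / 2 * (b - a) * \<bar>a + b - 2 * x0\<bar>"
        using ab k c by (intro mult_left_mono) auto
      then have "k * c1 * (b - a)\<^sup>2 \<le> 4 * \<eta>" using low by (simp add: power2_eq_square)
      then have "k * c1 * (b - a)\<^sup>2 * (4 * c2 * l\<^sup>2) \<le> 4 * \<eta> * (4 * c2 * l\<^sup>2)"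
        using c by (intro mult_right_mono) auto
      moreover have "c1 * (b - a)\<^sup>2 * 1 \<le> c1 * (b - a)\<^sup>2 * (4 * k * c2 * l\<^sup>2)"
        using c k2 by (intro mult_left_mono) auto
      ultimately have "c1 * (b - a)\<^sup>2 \<le> 16 * \<eta> * c2 * l\<^sup>2" by (simp add: mult_ac)
      then have "(b - a)\<^sup>2 \<le> 16 * \<eta> * (c2 / c1) * l\<^sup>2" using c by (simp add: field_simps)
      also have "\<dots> \<le> 64 * \<eta> * ((c2 / c1) * (c2 / c1)) * l\<^sup>2"
      proof -
        have "16 * (c2 / c1) \<le> 64 * ((c2 / c1) * (c2 / c1))"
          using mult_left_mono[OF r, of "c2 / c1"] r by linarith
        then have "16 * (c2 / c1) * (\<eta> * l\<^sup>2) \<le> 64 * ((c2 / c1) * (c2 / c1)) * (\<eta> * l\<^sup>2)"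
          using \<eta> by (intro mult_right_mono) auto
        then show ?thesis by (simp add: mult_ac)
      qed
      also have "\<dots> = d\<^sup>2" using \<eta> by (simp add: d_def power_mult_distrib power2_eq_square)
      finally show ?thesis using d0 by (rule power2_le_imp_le)
    next
      case False
      have "D \<le> \<bar>a + b - 2 * x0\<bar>" using xD[OF ab(1)] xD[OF ab(2)] ab(3,4) False by auto
      then have "k * c1 / 2 * (b - a) * D \<le> k * c1 / 2 * (b - a) * \<bar>a + b - 2 * x0\<bar>"
        using ab k c by (intro mult_left_mono) auto
      then have "k * c1 * (b - a) * D \<le> 4 * \<eta>" using low by simp
      then have "k * c1 * (b - a) * D * (2 * c2 * l) \<le> 4 * \<eta> * (2 * c2 * l)"
        using c l by (intro mult_right_mono) auto
      moreover have "c1 * (b - a) * 1 \<le> c1 * (b - a) * (2 * (k * c2 * D * l))"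
        using c k1 ab by (intro mult_left_mono) auto
      ultimately have "c1 * (b - a) \<le> 8 * \<eta> * c2 * l" by (simp add: mult_ac)
      then have "b - a \<le> 8 * (c2 / c1) * \<eta> * l" using c by (simp add: field_simps)
      also have "\<dots> \<le> d"
      proof -
        have "\<eta> \<le> sqrt \<eta>" using \<eta> by (intro real_le_rsqrt) (simp add: power2_eq_square mult_le_cancel_left1)
        then show ?thesis unfolding d_def using r l by (intro mult_right_mono mult_left_mono) auto
      qed
      finally show ?thesis .
    qed
  qed
  have "outer_le {x\<in>{s..e}. x0 \<le> x \<and> \<bar>g x\<bar> < \<eta>} (2 * d)"
  proof (rule outer_le_small_diameter[OF _ d0])
    fix x y assume "x \<in> {x\<in>{s..e}. x0 \<le> x \<and> \<bar>g x\<bar> < \<eta>}" "y \<in> {x\<in>{s..e}. x0 \<le> x \<and> \<bar>g x\<bar> < \<eta>}"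
    then show "\<bar>x - y\<bar> \<le> d" using diam[of x y] diam[of y x] d0 by (cases x y rule: linorder_cases) auto
  qed
  moreover have "outer_le {x\<in>{s..e}. x \<le> x0 \<and> \<bar>g x\<bar> < \<eta>} (2 * d)"
  proof (rule outer_le_small_diameter[OF _ d0])
    fix x y assume "x \<in> {x\<in>{s..e}. x \<le> x0 \<and> \<bar>g x\<bar> < \<eta>}" "y \<in> {x\<in>{s..e}. x \<le> x0 \<and> \<bar>g x\<bar> < \<eta>}"
    then show "\<bar>x - y\<bar> \<le> d" using diam[of x y] diam[of y x] d0 by (cases x y rule: linorder_cases) auto
  qed
  ultimately have "outer_le ({x\<in>{s..e}. x0 \<le> x \<and> \<bar>g x\<bar> < \<eta>} \<union> {x\<in>{s..e}. x \<le> x0 \<and> \<bar>g x\<bar> < \<eta>}) (2 * d + 2 * d)"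
    using d0 by (intro outer_le_Un) auto
  then show ?thesis by (rule outer_le_mono) (auto simp: d_def l_def)
qed

text \<open>Reduction to the quadratic case: \<open>g'\<close> is increasing, and its zero serves as
  \<open>x0\<close>. If \<open>g'\<close> has no zero in the interval, it is extended linearly
  beyond the nearer end with the minimal slope \<open>k * c1\<close>, and the zero of the extension
  is used; both slope bounds persist because \<open>c1 \<le> c2\<close>.\<close>

lemma convex_sublevel:
  fixes g g' :: "real \<Rightarrow> real"
  assumes c: "0 < c1" "c1 \<le> c2" and k: "0 < k" and se: "s < e" and \<eta>: "0 < \<eta>" "\<eta> \<le> 1/2"
    and deriv: "\<And>x. x \<in> {s..e} \<Longrightarrow> (g has_real_derivative g' x) (at x)"
    and slope: "\<And>x y. x \<in> {s..e} \<Longrightarrow> y \<in> {s..e} \<Longrightarrow> x \<le> y \<Longrightarrow>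
       k * c1 * (y - x) \<le> g' y - g' x \<and> g' y - g' x \<le> k * c2 * (y - x)"
    and big: "y0 \<in> {s..e}" "1 \<le> \<bar>g y0\<bar>"
  shows "outer_le {x\<in>{s..e}. \<bar>g x\<bar> < \<eta>} (32 * (c2 / c1) * sqrt \<eta> * (e - s))"
proof -
  have kc: "0 < k * c1" "k * c1 \<le> k * c2" using k c by auto
  note q = quadratic_sublevel[OF c less_imp_le[OF k] se \<eta> deriv _ _ big]
  consider "\<exists>x0\<in>{s..e}. g' x0 = 0" | "0 < g' s" | "g' e < 0"
  proof -
    have "continuous_on {s..e} g'"
    proof (rule continuous_on_subset[OF lipschitz_on_continuous_on[of "k * c2" _ g']])
      show "(k * c2)-lipschitz_on {s..e} g'"
      proof (rule lipschitz_onI)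
        fix x y assume xy: "x \<in> {s..e}" "y \<in> {s..e}"
        show "dist (g' x) (g' y) \<le> k * c2 * dist x y"
        proof (cases "x \<le> y")
          case True
          then have "0 \<le> k * c1 * (y - x)" using kc by simp
          then show ?thesis using slope[OF xy True] True by (auto simp: dist_real_def)
        next
          case False
          then have "0 \<le> k * c1 * (x - y)" using kc by simp
          then show ?thesis using slope[OF xy(2,1)] False by (auto simp: dist_real_def)
        qed
      qed (use kc in auto)
    qed auto
    then have "g' s \<le> 0 \<Longrightarrow> 0 \<le> g' e \<Longrightarrow> \<exists>x\<ge>s. x \<le> e \<and> g' x = 0"
      using se by (intro IVT') auto
    then show thesis using that by (metis atLeastAtMost_iff linorder_not_less)
  qed
  then show ?thesis
  proof cases
    case 1
    then obtain x0 where x0: "x0 \<in> {s..e}" "g' x0 = 0" by blast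
    show ?thesis
    proof (rule q)
      fix x assume "x \<in> {s..e}" "x0 \<le> x"
      then show "k * c1 * (x - x0) \<le> g' x \<and> g' x \<le> k * c2 * (x - x0)" using slope[of x0 x] x0 by auto
    next
      fix x assume "x \<in> {s..e}" "x \<le> x0"
      then show "k * c1 * (x0 - x) \<le> - g' x \<and> - g' x \<le> k * c2 * (x0 - x)" using slope[of x x0] x0 by auto
    qed
  next
    case 2
    define x0 where "x0 = s - g' s / (k * c1)"
    have x0: "g' s = k * c1 * (s - x0)" "x0 < s" using kc 2 by (auto simp: x0_def)
    have x0': "g' s \<le> k * c2 * (s - x0)" using kc x0 by (auto intro: mult_right_mono)
    show ?thesis
    proof (rule q)
      fix x assume x: "x \<in> {s..e}" "x0 \<le> x"
      have "k * c1 * (x - s) \<le> g' x - g' s \<and> g' x - g' s \<le> k * c2 * (x - s)" using slope[of s x] x by auto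
      then show "k * c1 * (x - x0) \<le> g' x \<and> g' x \<le> k * c2 * (x - x0)" using x0 x0' by (simp add: algebra_simps)
    next
      fix x assume "x \<in> {s..e}" "x \<le> x0"
      then show "k * c1 * (x0 - x) \<le> - g' x \<and> - g' x \<le> k * c2 * (x0 - x)" using x0 by auto
    qed
  next
    case 3
    define x0 where "x0 = e - g' e / (k * c1)"
    have x0: "- g' e = k * c1 * (x0 - e)" "e < x0" using kc 3 by (auto simp: x0_def divide_neg_pos)
    have x0': "- g' e \<le> k * c2 * (x0 - e)" using kc x0 by (auto intro: mult_right_mono)
    show ?thesis
    proof (rule q)
      fix x assume "x \<in> {s..e}" "x0 \<le> x"
      then show "k * c1 * (x - x0) \<le> g' x \<and> g' x \<le> k * c2 * (x - x0)" using x0 by auto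
    next
      fix x assume x: "x \<in> {s..e}" "x \<le> x0"
      have "k * c1 * (e - x) \<le> g' e - g' x \<and> g' e - g' x \<le> k * c2 * (e - x)" using slope[of x e] x by auto
      then show "k * c1 * (x0 - x) \<le> - g' x \<and> - g' x \<le> k * c2 * (x0 - x)" using x0 x0' by (simp add: algebra_simps)
    qed
  qed
qed

section \<open>Lattices attached to a convex graph\<close>

lemma max3_le: "max a (max b c) \<le> M \<longleftrightarrow> a \<le> M \<and> b \<le> M \<and> c \<le> (M::real)"
  by auto

lemma mult_le_of_factors:
  fixes u v s t :: real
  assumes "s * u \<le> M" "t * v \<le> N" "0 \<le> u" "0 \<le> v" "0 < s" "0 < t"
  shows "s * t * (u * v) \<le> M * N"
proof -
  have "(s * u) * (t * v) \<le> M * N"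
    using assms by (intro mult_mono order_trans[OF _ assms(1)]) auto
  then show ?thesis by (simp add: mult_ac)
qed

lemma abs_diff_mult_le:
  fixes s t u v u' v' :: real
  assumes "s * \<bar>u\<bar> \<le> M" "t * \<bar>v\<bar> \<le> M" "s * \<bar>u'\<bar> \<le> N" "t * \<bar>v'\<bar> \<le> N" "0 < s" "0 < t"
  shows "s * t * \<bar>u * v' - v * u'\<bar> \<le> 2 * M * N"
proof -
  have "\<bar>u * v' - v * u'\<bar> \<le> \<bar>u\<bar> * \<bar>v'\<bar> + \<bar>u'\<bar> * \<bar>v\<bar>"
    using abs_triangle_ineq4[of "u * v'" "v * u'"] by (simp add: abs_mult mult_ac)
  then have "s * t * \<bar>u * v' - v * u'\<bar> \<le> s * t * (\<bar>u\<bar> * \<bar>v'\<bar> + \<bar>u'\<bar> * \<bar>v\<bar>)"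
    using assms by (intro mult_left_mono) auto
  also have "\<dots> = s * t * (\<bar>u\<bar> * \<bar>v'\<bar>) + s * t * (\<bar>u'\<bar> * \<bar>v\<bar>)" by (rule distrib_left)
  also have "\<dots> \<le> M * N + N * M"
    using assms by (intro add_mono mult_le_of_factors) auto
  finally show ?thesis by (simp add: mult_ac)
qed

text \<open>The vector \<open>(q, p, r)\<close> stands for the rational point \<open>(p / q, r / q)\<close>; the last entry of its
  norm measures how far that point is from the tangent line at \<open>x\<close>. The dual vector \<open>(a, b, c)\<close>
  stands for the function \<open>a + b x + c f(x)\<close>.\<close>

locale convex_graph =
  fixes f f1 f2 :: "real \<Rightarrow> real" and A B c1 c2 :: real
  assumes AB: "A < B" and c1: "0 < c1"
    and f1: "\<And>x. x \<in> {A..B} \<Longrightarrow> (f has_real_derivative f1 x) (at x)"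
    and f2: "\<And>x. x \<in> {A..B} \<Longrightarrow> (f1 has_real_derivative f2 x) (at x)"
    and f2_bounds: "\<And>x. x \<in> {A..B} \<Longrightarrow> c1 \<le> f2 x \<and> f2 x \<le> c2"
begin

lemma c12: "c1 \<le> c2"
  using f2_bounds[of A] AB by auto

text \<open>The three forms have determinant 1 in \<open>(q, p, r)\<close> and the weights
  \<open>1 / Q\<close>, \<open>Q * d\<close>, \<open>1 / d\<close> multiply to 1: for each
  \<open>x\<close> this is the maximum norm on a unimodular lattice in dimension three.\<close>

definition primal_norm :: "real \<Rightarrow> real \<Rightarrow> int \<times> int \<times> int \<Rightarrow> real \<Rightarrow> real" where
  "primal_norm Q d = (\<lambda>(q, p, r) x. max (\<bar>q\<bar> / Q) (max (Q * d * \<bar>q * x - p\<bar>)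
      (\<bar>q * f x - r - f1 x * (q * x - p)\<bar> / d)))"

text \<open>The forms dual to those of \<open>primal_norm\<close> up to sign, in reverse order and
  with the reciprocal weights.\<close>

definition dual_norm :: "real \<Rightarrow> real \<Rightarrow> int \<times> int \<times> int \<Rightarrow> real \<Rightarrow> real" where
  "dual_norm Q d = (\<lambda>(a, b, c) x. max (d * \<bar>c\<bar>) (max (\<bar>b + c * f1 x\<bar> / (Q * d))
      (Q * \<bar>a + b * x + c * f x\<bar>)))"

definition both_norm :: "real \<Rightarrow> real \<Rightarrow> bool \<Rightarrow> int \<times> int \<times> int \<Rightarrow> real \<Rightarrow> real" where
  "both_norm Q d b = (if b then primal_norm Q d else dual_norm Q d)"

text \<open>The pairing of two integer vectors equals the signed sum of products of corresponding
  entries, and corresponding weights cancel. The entries of a cross product are 2 by 2 minors of the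
  entries of its factors; since the weights multiply to 1, the weight of each minor is the product
  of the two weights involved.\<close>

lemma dual_norms_both_norm:
  assumes Q: "0 < Q" and d: "0 < d"
  shows "dual_norms (both_norm Q d)"
proof
  fix b :: bool and v :: "int \<times> int \<times> int" and x :: real
  show "0 \<le> both_norm Q d b v x"
    using Q d by (cases v) (auto simp: both_norm_def primal_norm_def dual_norm_def le_max_iff_disj)
next
  fix b :: bool and k :: int and v :: "int \<times> int \<times> int" and x :: real
  obtain v1 v2 v3 where v: "v = (v1, v2, v3)" by (metis surj_pair)
  have e: "real_of_int (k * v1) * x - real_of_int (k * v2) = k * (v1 * x - v2)"
    "real_of_int (k * v1) * f x - real_of_int (k * v3) - f1 x * (k * (v1 * x - v2))
      = k * (v1 * f x - v3 - f1 x * (v1 * x - v2))"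
    "real_of_int (k * v2) + real_of_int (k * v3) * f1 x = k * (v2 + v3 * f1 x)"
    "real_of_int (k * v1) + real_of_int (k * v2) * x + real_of_int (k * v3) * f x = k * (v1 + v2 * x + v3 * f x)"
    by (simp_all add: algebra_simps)
  have "primal_norm Q d (iscale k v) x = \<bar>real_of_int k\<bar> * primal_norm Q d v x"
    unfolding v iscale.simps primal_norm_def prod.case e
    by (simp add: max_mult_distrib_left abs_mult mult.left_commute mult.assoc)
  moreover have "dual_norm Q d (iscale k v) x = \<bar>real_of_int k\<bar> * dual_norm Q d v x"
    unfolding v iscale.simps dual_norm_def prod.case e
    by (simp add: max_mult_distrib_left abs_mult mult.left_commute mult.assoc)
  ultimately show "both_norm Q d b (iscale k v) x = \<bar>real_of_int k\<bar> * both_norm Q d b v x"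
    by (simp add: both_norm_def)
next
  fix b :: bool and v w :: "int \<times> int \<times> int" and x :: real
  obtain v1 v2 v3 where v: "v = (v1, v2, v3)" by (metis surj_pair)
  obtain w1 w2 w3 where w: "w = (w1, w2, w3)" by (metis surj_pair)
  have main: "\<bar>q * a + p * b + r * c\<bar> \<le> 3 * primal_norm Q d (q, p, r) x * dual_norm Q d (a, b, c) x"
    for q p r a b c :: int
  proof -
    define y where "y = q * x - p"
    define T where "T = q * f x - r - f1 x * y"
    define F where "F = a + b * x + c * f x"
    define E where "E = b + c * f1 x"
    define M where "M = primal_norm Q d (q, p, r) x"
    define N where "N = dual_norm Q d (a, b, c) x"
    have M: "1 / Q * \<bar>real_of_int q\<bar> \<le> M" "Q * d * \<bar>y\<bar> \<le> M" "1 / d * \<bar>T\<bar> \<le> M"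
      unfolding M_def primal_norm_def y_def T_def by auto
    have N: "d * \<bar>real_of_int c\<bar> \<le> N" "1 / (Q * d) * \<bar>E\<bar> \<le> N" "Q * \<bar>F\<bar> \<le> N"
      unfolding N_def dual_norm_def E_def F_def by auto
    have "\<bar>real_of_int q\<bar> * \<bar>F\<bar> \<le> M * N" "\<bar>y\<bar> * \<bar>E\<bar> \<le> M * N" "\<bar>T\<bar> * \<bar>real_of_int c\<bar> \<le> M * N"
      using mult_le_of_factors[OF M(1) N(3)] mult_le_of_factors[OF M(2) N(2)]
        mult_le_of_factors[OF M(3) N(1)] Q d by auto
    moreover have "real_of_int (q * a + p * b + r * c) = q * F - E * y - c * T"
      unfolding y_def T_def F_def E_def by (simp add: algebra_simps)
    moreover have "\<bar>q * F - E * y - c * T\<bar> \<le> \<bar>q * F\<bar> + \<bar>E * y\<bar> + \<bar>c * T\<bar>"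
      using abs_triangle_ineq4[of "q * F - E * y" "c * T"] abs_triangle_ineq4[of "q * F" "E * y"] by linarith
    moreover have "\<bar>q * F\<bar> = \<bar>real_of_int q\<bar> * \<bar>F\<bar>" "\<bar>E * y\<bar> = \<bar>y\<bar> * \<bar>E\<bar>" "\<bar>c * T\<bar> = \<bar>T\<bar> * \<bar>real_of_int c\<bar>"
      by (simp_all add: abs_mult mult.commute)
    ultimately have "\<bar>real_of_int (q * a + p * b + r * c)\<bar> \<le> 3 * (M * N)" by simp
    then show ?thesis unfolding M_def N_def by simp
  qed
  show "\<bar>real_of_int (idot v w)\<bar> \<le> 3 * both_norm Q d b v x * both_norm Q d (\<not> b) w x"
    using main[of v1 w1 v2 w2 v3 w3] main[of w1 v1 w2 v2 w3 v3]
    unfolding v w both_norm_def by (simp add: mult_ac)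
  show "both_norm Q d (\<not> b) (icross v w) x \<le> 2 * both_norm Q d b v x * both_norm Q d b w x"
  proof (cases b)
    case True
    define y y' where "y = v1 * x - v2" and "y' = w1 * x - w2"
    define T T' where "T = v1 * f x - v3 - f1 x * y" and "T' = w1 * f x - w3 - f1 x * y'"
    define M where "M = primal_norm Q d v x"
    define N where "N = primal_norm Q d w x"
    have M: "1 / Q * \<bar>real_of_int v1\<bar> \<le> M" "Q * d * \<bar>y\<bar> \<le> M" "1 / d * \<bar>T\<bar> \<le> M"
      unfolding M_def v primal_norm_def y_def T_def by auto
    have N: "1 / Q * \<bar>real_of_int w1\<bar> \<le> N" "Q * d * \<bar>y'\<bar> \<le> N" "1 / d * \<bar>T'\<bar> \<le> N"
      unfolding N_def w primal_norm_def y'_def T'_def by auto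
    have e: "real_of_int (v1 * w2 - v2 * w1) = y * w1 - v1 * y'"
      "real_of_int (v3 * w1 - v1 * w3) + real_of_int (v1 * w2 - v2 * w1) * f1 x = v1 * T' - T * w1"
      "real_of_int (v2 * w3 - v3 * w2) + real_of_int (v3 * w1 - v1 * w3) * x
        + real_of_int (v1 * w2 - v2 * w1) * f x = y * T' - T * y'"
      unfolding y_def y'_def T_def T'_def by (simp_all add: algebra_simps)
    have "d * \<bar>y * w1 - v1 * y'\<bar> \<le> 2 * M * N"
      using abs_diff_mult_le[OF M(2) M(1) N(2) N(1)] Q d by simp
    moreover have "\<bar>v1 * T' - T * w1\<bar> / (Q * d) \<le> 2 * M * N"
      using abs_diff_mult_le[OF M(1) M(3) N(1) N(3)] Q d by simp
    moreover have "Q * \<bar>y * T' - T * y'\<bar> \<le> 2 * M * N"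
      using abs_diff_mult_le[OF M(2) M(3) N(2) N(3)] Q d by simp
    ultimately have "dual_norm Q d (icross v w) x \<le> 2 * M * N"
      unfolding v w icross.simps dual_norm_def prod.case e(2,3) unfolding e(1) max3_le by blast
    then show ?thesis unfolding M_def N_def both_norm_def using True by simp
  next
    case False
    define F F' where "F = v1 + v2 * x + v3 * f x" and "F' = w1 + w2 * x + w3 * f x"
    define E E' where "E = v2 + v3 * f1 x" and "E' = w2 + w3 * f1 x"
    define M where "M = dual_norm Q d v x"
    define N where "N = dual_norm Q d w x"
    have M: "d * \<bar>real_of_int v3\<bar> \<le> M" "1 / (Q * d) * \<bar>E\<bar> \<le> M" "Q * \<bar>F\<bar> \<le> M"
      unfolding M_def v dual_norm_def E_def F_def by auto
    have N: "d * \<bar>real_of_int w3\<bar> \<le> N" "1 / (Q * d) * \<bar>E'\<bar> \<le> N" "Q * \<bar>F'\<bar> \<le> N"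
      unfolding N_def w dual_norm_def E'_def F'_def by auto
    have e: "real_of_int (v2 * w3 - v3 * w2) = E * w3 - v3 * E'"
      "real_of_int (v2 * w3 - v3 * w2) * x - real_of_int (v3 * w1 - v1 * w3) = F * w3 - v3 * F'"
      "real_of_int (v2 * w3 - v3 * w2) * f x - real_of_int (v1 * w2 - v2 * w1)
        - f1 x * (F * w3 - v3 * F') = E * F' - F * E'"
      unfolding E_def E'_def F_def F'_def by (simp_all add: algebra_simps)
    have "\<bar>E * w3 - v3 * E'\<bar> / Q \<le> 2 * M * N"
      using abs_diff_mult_le[OF M(2) M(1) N(2) N(1)] Q d by simp
    moreover have "Q * d * \<bar>F * w3 - v3 * F'\<bar> \<le> 2 * M * N"
      using abs_diff_mult_le[OF M(3) M(1) N(3) N(1)] Q d by simp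
    moreover have "\<bar>E * F' - F * E'\<bar> / d \<le> 2 * M * N"
      using abs_diff_mult_le[OF M(2) M(3) N(2) N(3)] Q d by simp
    ultimately have "primal_norm Q d (icross v w) x \<le> 2 * M * N"
      unfolding v w icross.simps primal_norm_def prod.case e(2) unfolding e(3) unfolding e(1) max3_le by blast
    then show ?thesis unfolding M_def N_def both_norm_def using False by simp
  qed
qed

lemma f1_slope:
  assumes "x \<in> {A..B}" "y \<in> {A..B}" "x \<le> y"
  shows "c1 * (y - x) \<le> f1 y - f1 x \<and> f1 y - f1 x \<le> c2 * (y - x)"
proof (cases "x = y")
  case False
  then have "\<exists>z. x < z \<and> z < y \<and> f1 y - f1 x = (y - x) * f2 z"
    using assms by (intro MVT2 f2) auto
  then obtain z where z: "x < z" "z < y" "f1 y - f1 x = (y - x) * f2 z" by blast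
  then have "c1 \<le> f2 z \<and> f2 z \<le> c2" using assms by (intro f2_bounds) auto
  then show ?thesis using z assms by (auto simp: mult.commute intro: mult_left_mono)
qed simp

lemma f1_bilipschitz:
  assumes "x \<in> {A..B}" "y \<in> {A..B}"
  shows "c1 * \<bar>x - y\<bar> \<le> \<bar>f1 x - f1 y\<bar>" "\<bar>f1 x - f1 y\<bar> \<le> c2 * \<bar>x - y\<bar>"
proof -
  have "0 \<le> c1 * \<bar>x - y\<bar>" using c1 by simp
  then show "c1 * \<bar>x - y\<bar> \<le> \<bar>f1 x - f1 y\<bar>" "\<bar>f1 x - f1 y\<bar> \<le> c2 * \<bar>x - y\<bar>"
    using f1_slope[OF assms] f1_slope[OF assms(2,1)] by (cases "x \<le> y"; force)+
qed

lemma continuous_both_norm: "S \<subseteq> {A..B} \<Longrightarrow> continuous_on S (both_norm Q d b v)"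
proof -
  assume S: "S \<subseteq> {A..B}"
  have [continuous_intros]: "continuous_on S f"
    by (rule DERIV_continuous_on[where D = f1]) (use S f1 in \<open>blast intro: has_field_derivative_at_within\<close>)
  have [continuous_intros]: "continuous_on S f1"
    by (rule DERIV_continuous_on[where D = f2]) (use S f2 in \<open>blast intro: has_field_derivative_at_within\<close>)
  show ?thesis
    by (cases v) (auto simp: both_norm_def primal_norm_def dual_norm_def divide_inverse intro!: continuous_intros)
qed

text \<open>The norm is a maximum of three entries, and one of them reaches 1 at \<open>y\<close>.
  The sublevel set of the norm lies in that of this entry, which is constant, bilipschitz, or
  quadratic in the sense above, with constants that do not depend on the vector.\<close>

lemma sublevel_both_norm:
  assumes Q: "0 < Q" and d: "0 < d" and \<eta>: "0 < \<eta>" "\<eta> \<le> 1/2"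
    and se: "s < e" "{s..e} \<subseteq> {A..B}" and big: "\<exists>y\<in>{s..<e}. 1 \<le> both_norm Q d b v y"
  shows "outer_le {x\<in>{s..<e}. both_norm Q d b v x < \<eta>} (32 * (c2 / c1) * sqrt \<eta> * (e - s))"
proof -
  obtain y where y: "y \<in> {s..<e}" "1 \<le> both_norm Q d b v y" using big by blast
  have ye: "y \<in> {s..e}" using y by auto
  note cc = c1 c12
  have \<eta>_le: "\<eta> \<le> sqrt \<eta>" using \<eta> by (intro real_le_rsqrt) (simp add: power2_eq_square mult_le_cancel_left1)
  have comp: "outer_le {x\<in>{s..<e}. both_norm Q d b v x < \<eta>} (32 * (c2 / c1) * sqrt \<eta> * (e - s))"
    if "\<And>x. \<bar>g x\<bar> \<le> both_norm Q d b v x" "outer_le {x\<in>{s..e}. \<bar>g x\<bar> < \<eta>} M"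
      "M \<le> 32 * (c2 / c1) * sqrt \<eta> * (e - s)" for g :: "real \<Rightarrow> real" and M
    by (rule outer_le_mono[OF that(2) _ that(3)]) (use that(1) in \<open>auto intro: le_less_trans\<close>)
  have wide: "8 * r * \<eta> * (e - s) \<le> 32 * (c2 / c1) * sqrt \<eta> * (e - s)" if "1 \<le> r" "r \<le> c2 / c1" for r
    using that \<eta> \<eta>_le se(1) by (intro mult_right_mono mult_mono) auto
  have r1: "1 \<le> c2 / c1" using cc by simp
  have const: ?thesis if "\<And>x. m \<le> both_norm Q d b v x" "1 \<le> m" for m
  proof -
    have "\<not> both_norm Q d b v x < \<eta>" for x using that(1)[of x] that(2) \<eta> by linarith
    then show ?thesis by (simp add: outer_le_empty)
  qed
  show ?thesis
  proof (cases b)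
    case True
    obtain q p r where v: "v = (q, p, r)" by (metis surj_pair)
    have N: "both_norm Q d b v = primal_norm Q d (q, p, r)" by (simp add: both_norm_def True v)
    define g1 where "g1 = (\<lambda>x::real. Q * d * (q * x - p))"
    define g2 where "g2 = (\<lambda>x::real. (q * f x - r - f1 x * (q * x - p)) / d)"
    have Ng: "\<bar>real_of_int q\<bar> / Q \<le> both_norm Q d b v x" "\<bar>g1 x\<bar> \<le> both_norm Q d b v x" "\<bar>g2 x\<bar> \<le> both_norm Q d b v x" for x
      unfolding N primal_norm_def g1_def g2_def using Q d by (auto simp: abs_mult)
    consider "1 \<le> \<bar>real_of_int q\<bar> / Q" | "1 \<le> \<bar>g1 y\<bar>" | "1 \<le> \<bar>g2 y\<bar>"
      using y(2) Q d unfolding N primal_norm_def g1_def g2_def by (auto simp: abs_mult le_max_iff_disj)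
    then show ?thesis
    proof cases
      case 1
      then show ?thesis using const Ng(1) by blast
    next
      case 2
      have g: "\<bar>g1 x - g1 z\<bar> = Q * d * \<bar>real_of_int q\<bar> * \<bar>x - z\<bar>" for x z
      proof -
        have "g1 x - g1 z = Q * d * q * (x - z)" by (simp add: g1_def algebra_simps)
        then show ?thesis using Q d by (simp add: abs_mult)
      qed
      have "outer_le {x\<in>{s..e}. \<bar>g1 x\<bar> < \<eta>} (8 * (1 / 1) * \<eta> * (e - s))"
        by (rule bilipschitz_sublevel[where g = g1 and k = "Q * d * \<bar>real_of_int q\<bar>", OF _ _ _ se(1) \<eta> _ _ ye 2])
          (use Q d g in auto)
      then show ?thesis by (rule comp[OF Ng(2)]) (use wide[of 1] r1 in simp)
    next
      case 3
      show ?thesis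
      proof (cases "q = 0")
        case True
        have g: "\<bar>g2 x - g2 z\<bar> = \<bar>real_of_int p\<bar> / d * \<bar>f1 x - f1 z\<bar>" for x z
        proof -
          have "g2 x - g2 z = p / d * (f1 x - f1 z)" using d by (simp add: g2_def True field_simps)
          then show ?thesis using d by (simp add: abs_mult)
        qed
        have "outer_le {x\<in>{s..e}. \<bar>g2 x\<bar> < \<eta>} (8 * (c2 / c1) * \<eta> * (e - s))"
        proof (rule bilipschitz_sublevel[where g = g2 and k = "\<bar>real_of_int p\<bar> / d", OF cc _ se(1) \<eta> _ _ ye 3])
          fix x z assume "x \<in> {s..e}" "z \<in> {s..e}"
          then have xz: "x \<in> {A..B}" "z \<in> {A..B}" using se by auto
          show "c1 * (\<bar>real_of_int p\<bar> / d) * \<bar>x - z\<bar> \<le> \<bar>g2 x - g2 z\<bar>"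
            using mult_left_mono[OF f1_bilipschitz(1)[OF xz], of "\<bar>real_of_int p\<bar> / d"] d
            unfolding g by (simp add: mult_ac)
          show "\<bar>g2 x - g2 z\<bar> \<le> c2 * (\<bar>real_of_int p\<bar> / d) * \<bar>x - z\<bar>"
            using mult_left_mono[OF f1_bilipschitz(2)[OF xz], of "\<bar>real_of_int p\<bar> / d"] d
            unfolding g by (simp add: mult_ac)
        qed (use d in auto)
        then show ?thesis by (rule comp[OF Ng(3)]) (use wide[OF r1 order_refl] in simp)
      next
        case False
        define x0 where "x0 = real_of_int p / real_of_int q"
        define k where "k = \<bar>real_of_int q\<bar> / d"
        define g where "g = (\<lambda>x::real. - sgn (real_of_int q) * g2 x)"
        have k0: "0 \<le> k" using d by (simp add: k_def)
        have gg: "\<bar>g x\<bar> = \<bar>g2 x\<bar>" for x using False by (simp add: g_def abs_mult abs_sgn_eq)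
        have deriv: "(g has_real_derivative k * f2 x * (x - x0)) (at x)" if x: "x \<in> {s..e}" for x
        proof -
          have "x \<in> {A..B}" using x se by auto
          then have D: "(f has_real_derivative f1 x) (at x)" "(f1 has_real_derivative f2 x) (at x)" using f1 f2 by auto
          \<comment> \<open>The terms with \<open>f1\<close> cancel. What remains vanishes only at
            \<open>p / q\<close>, and its size is governed by the bounds on \<open>f2\<close>
            alone.\<close>
          have "((\<lambda>x. q * f x - r - f1 x * (q * x - p)) has_real_derivative - (f2 x * (q * x - p))) (at x)"
            by (auto intro!: derivative_eq_intros D)
          from DERIV_cmult[OF DERIV_cdivide[OF this, of d], of "- sgn (real_of_int q)"]
          have D': "(g has_real_derivative - sgn (real_of_int q) * (- (f2 x * (q * x - p)) / d)) (at x)"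
            unfolding g_def g2_def .
          have e: "- sgn (real_of_int q) * (- (f2 x * (q * x - p)) / d) = (sgn (real_of_int q) * q) / d * f2 x * (x - x0)"
            using False d by (simp add: x0_def field_simps)
          have "sgn (real_of_int q) * q = \<bar>real_of_int q\<bar>" by (simp add: abs_sgn mult.commute)
          then show ?thesis using D' unfolding e k_def by metis
        qed
        have "outer_le {x\<in>{s..e}. \<bar>g x\<bar> < \<eta>} (32 * (c2 / c1) * sqrt \<eta> * (e - s))"
        proof (rule quadratic_sublevel[where g = g, OF cc k0 se(1) \<eta> deriv _ _ ye])
          fix x assume x: "x \<in> {s..e}" "x0 \<le> x"
          then have "c1 \<le> f2 x \<and> f2 x \<le> c2" using se by (intro f2_bounds) auto
          then show "k * c1 * (x - x0) \<le> k * f2 x * (x - x0) \<and> k * f2 x * (x - x0) \<le> k * c2 * (x - x0)"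
            using k0 x by (auto intro!: mult_right_mono mult_left_mono)
        next
          fix x assume x: "x \<in> {s..e}" "x \<le> x0"
          then have "c1 \<le> f2 x \<and> f2 x \<le> c2" using se by (intro f2_bounds) auto
          then have "k * c1 * (x0 - x) \<le> k * f2 x * (x0 - x) \<and> k * f2 x * (x0 - x) \<le> k * c2 * (x0 - x)"
            using k0 x by (auto intro!: mult_right_mono mult_left_mono)
          moreover have "- (k * f2 x * (x - x0)) = k * f2 x * (x0 - x)" by (simp add: algebra_simps)
          ultimately show "k * c1 * (x0 - x) \<le> - (k * f2 x * (x - x0)) \<and> - (k * f2 x * (x - x0)) \<le> k * c2 * (x0 - x)"
            by simp
        qed (use 3 gg in auto)
        then show ?thesis unfolding gg by (rule comp[OF Ng(3)]) simp
      qed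
    qed
  next
    case False
    obtain v1 v2 v3 where v: "v = (v1, v2, v3)" by (metis surj_pair)
    have N: "both_norm Q d b v = dual_norm Q d (v1, v2, v3)" by (simp add: both_norm_def False v)
    define g1 where "g1 = (\<lambda>x::real. (v2 + v3 * f1 x) / (Q * d))"
    define g2 where "g2 = (\<lambda>x::real. Q * (v1 + v2 * x + v3 * f x))"
    have Ng: "d * \<bar>real_of_int v3\<bar> \<le> both_norm Q d b v x" "\<bar>g1 x\<bar> \<le> both_norm Q d b v x" "\<bar>g2 x\<bar> \<le> both_norm Q d b v x" for x
      unfolding N dual_norm_def g1_def g2_def using Q d by (auto simp: abs_mult)
    consider "1 \<le> d * \<bar>real_of_int v3\<bar>" | "1 \<le> \<bar>g1 y\<bar>" | "1 \<le> \<bar>g2 y\<bar>"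
      using y(2) Q d unfolding N dual_norm_def g1_def g2_def by (auto simp: abs_mult le_max_iff_disj)
    then show ?thesis
    proof cases
      case 1
      then show ?thesis using const Ng(1) by blast
    next
      case 2
      have g: "\<bar>g1 x - g1 z\<bar> = \<bar>real_of_int v3\<bar> / (Q * d) * \<bar>f1 x - f1 z\<bar>" for x z
      proof -
        have "g1 x - g1 z = v3 / (Q * d) * (f1 x - f1 z)"
          using Q d by (simp add: g1_def diff_divide_distrib[symmetric] algebra_simps)
        then show ?thesis using Q d by (simp add: abs_mult)
      qed
      have "outer_le {x\<in>{s..e}. \<bar>g1 x\<bar> < \<eta>} (8 * (c2 / c1) * \<eta> * (e - s))"
      proof (rule bilipschitz_sublevel[where g = g1 and k = "\<bar>real_of_int v3\<bar> / (Q * d)", OF cc _ se(1) \<eta> _ _ ye 2])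
        fix x z assume "x \<in> {s..e}" "z \<in> {s..e}"
        then have xz: "x \<in> {A..B}" "z \<in> {A..B}" using se by auto
        show "c1 * (\<bar>real_of_int v3\<bar> / (Q * d)) * \<bar>x - z\<bar> \<le> \<bar>g1 x - g1 z\<bar>"
          using mult_left_mono[OF f1_bilipschitz(1)[OF xz], of "\<bar>real_of_int v3\<bar> / (Q * d)"] Q d
          unfolding g by (simp add: mult_ac)
        show "\<bar>g1 x - g1 z\<bar> \<le> c2 * (\<bar>real_of_int v3\<bar> / (Q * d)) * \<bar>x - z\<bar>"
          using mult_left_mono[OF f1_bilipschitz(2)[OF xz], of "\<bar>real_of_int v3\<bar> / (Q * d)"] Q d
          unfolding g by (simp add: mult_ac)
      qed (use Q d in auto)
      then show ?thesis by (rule comp[OF Ng(2)]) (use wide[OF r1 order_refl] in simp)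
    next
      case 3
      show ?thesis
      proof (cases "v3 = 0")
        case True
        have g: "\<bar>g2 x - g2 z\<bar> = Q * \<bar>real_of_int v2\<bar> * \<bar>x - z\<bar>" for x z
        proof -
          have "g2 x - g2 z = Q * v2 * (x - z)" by (simp add: g2_def True algebra_simps)
          then show ?thesis using Q by (simp add: abs_mult)
        qed
        have "outer_le {x\<in>{s..e}. \<bar>g2 x\<bar> < \<eta>} (8 * (1 / 1) * \<eta> * (e - s))"
          by (rule bilipschitz_sublevel[where g = g2 and k = "Q * \<bar>real_of_int v2\<bar>", OF _ _ _ se(1) \<eta> _ _ ye 3])
            (use Q g in auto)
        then show ?thesis by (rule comp[OF Ng(3)]) (use wide[of 1] r1 in simp)
      next
        case False
        \<comment> \<open>Multiplication by the sign of \<open>v3\<close> makes the function convex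
          without changing its absolute value.\<close>
        define \<sigma> where "\<sigma> = sgn (real_of_int v3)"
        have \<sigma>: "\<sigma> * v3 = \<bar>real_of_int v3\<bar>" "\<bar>\<sigma>\<bar> = 1"
          using False by (auto simp: \<sigma>_def abs_sgn_eq sgn_if)
        define g where "g = (\<lambda>x::real. \<sigma> * g2 x)"
        have gg: "\<bar>g x\<bar> = \<bar>g2 x\<bar>" for x using \<sigma> by (simp add: g_def abs_mult)
        have "outer_le {x\<in>{s..e}. \<bar>g x\<bar> < \<eta>} (32 * (c2 / c1) * sqrt \<eta> * (e - s))"
        proof (rule convex_sublevel[where g = g and k = "Q * \<bar>real_of_int v3\<bar>" and g' = "\<lambda>x. \<sigma> * (Q * (v2 + v3 * f1 x))",
              OF cc _ se(1) \<eta> _ _ ye])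
          fix x assume "x \<in> {s..e}"
          then have "x \<in> {A..B}" using se by auto
          then have D: "(f has_real_derivative f1 x) (at x)" using f1 by auto
          show "(g has_real_derivative \<sigma> * (Q * (v2 + v3 * f1 x))) (at x)"
            unfolding g_def g2_def by (rule derivative_eq_intros D refl | simp)+
        next
          fix x z assume "x \<in> {s..e}" "z \<in> {s..e}" "x \<le> z"
          then have xz: "c1 * (z - x) \<le> f1 z - f1 x" "f1 z - f1 x \<le> c2 * (z - x)"
            using f1_slope[of x z] se by auto
          have "\<sigma> * (Q * (v2 + v3 * f1 z)) - \<sigma> * (Q * (v2 + v3 * f1 x)) = Q * (\<sigma> * v3) * (f1 z - f1 x)"
            by (simp add: algebra_simps)
          then show "Q * \<bar>real_of_int v3\<bar> * c1 * (z - x) \<le> \<sigma> * (Q * (v2 + v3 * f1 z)) - \<sigma> * (Q * (v2 + v3 * f1 x)) \<and>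
             \<sigma> * (Q * (v2 + v3 * f1 z)) - \<sigma> * (Q * (v2 + v3 * f1 x)) \<le> Q * \<bar>real_of_int v3\<bar> * c2 * (z - x)"
            using mult_left_mono[OF xz(1), of "Q * \<bar>real_of_int v3\<bar>"] mult_left_mono[OF xz(2), of "Q * \<bar>real_of_int v3\<bar>"] Q
            unfolding \<sigma> by (simp add: mult.assoc)
        qed (use 3 gg False Q in auto)
        then show ?thesis unfolding gg by (rule comp[OF Ng(3)]) simp
      qed
    qed
  qed
qed

end

section \<open>Rational points near a convex graph\<close>

lemma tangent_pigeonhole:
  fixes x y t :: real and n m N :: nat
  assumes n: "0 < n" and m: "0 < m" and nm: "n * m \<le> N"
  shows "\<exists>(q::int) (p::int) (r::int). 1 \<le> q \<and> q \<le> int N \<and> \<bar>q * x - p\<bar> < 1 / m \<and> \<bar>q * y - r - t * (q * x - p)\<bar> < 1 / n"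
proof -
  \<comment> \<open>The boxes are chosen for \<open>q * x\<close> and for
    \<open>q * y - t * frac (q * x)\<close>. The correction anticipates the third form: for the
    difference of two indices, \<open>q * x - p\<close> is the difference of the fractional parts of
    the multiples of \<open>x\<close>.\<close>
  define Y where "Y = (\<lambda>q::nat. q * y - t * frac (q * x))"
  define \<Phi> where "\<Phi> = (\<lambda>q::nat. (nat \<lfloor>m * frac (q * x)\<rfloor>, nat \<lfloor>n * frac (Y q)\<rfloor>))"
  have box: "nat \<lfloor>real k * frac z\<rfloor> < k" if "0 < k" for k :: nat and z :: real
  proof -
    have "real k * frac z < real k" using that frac_lt_1[of z] by simp
    then have "\<lfloor>real k * frac z\<rfloor> < int k" by (simp add: floor_less_iff)
    then show ?thesis using that by linarith
  qed
  have "\<Phi> ` {0..N} \<subseteq> {..<m} \<times> {..<n}" using box n m by (auto simp: \<Phi>_def)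
  then have "card (\<Phi> ` {0..N}) \<le> card ({..<m} \<times> {..<n})" by (rule card_mono[rotated]) simp
  also have "\<dots> < card {0..N}" using nm by (simp add: mult.commute)
  finally have "\<not> inj_on \<Phi> {0..N}" by (rule pigeonhole)
  then obtain a b where ab: "a \<le> N" "b \<le> N" "a < b" "\<Phi> a = \<Phi> b"
    unfolding inj_on_def by (metis atLeastAtMost_iff linorder_neqE_nat)
  have close: "\<bar>frac u - frac z\<bar> < 1 / k"
    if "0 < k" "nat \<lfloor>real k * frac u\<rfloor> = nat \<lfloor>real k * frac z\<rfloor>" for k :: nat and u z :: real
  proof -
    have "\<lfloor>real k * frac u\<rfloor> = \<lfloor>real k * frac z\<rfloor>"
      using that(2) by (simp add: eq_nat_nat_iff frac_ge_0)
    then have "\<bar>real k * frac u - real k * frac z\<bar> < 1" by linarith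
    then have "\<bar>real k * (frac u - frac z)\<bar> < 1" by (simp only: right_diff_distrib)
    then have "real k * \<bar>frac u - frac z\<bar> < 1" by (simp add: abs_mult)
    then show ?thesis using that(1) by (simp add: field_simps)
  qed
  define q p r where "q = int b - int a" and "p = \<lfloor>b * x\<rfloor> - \<lfloor>a * x\<rfloor>" and "r = \<lfloor>Y b\<rfloor> - \<lfloor>Y a\<rfloor>"
  have qp: "q * x - p = frac (b * x) - frac (a * x)" by (simp add: q_def p_def frac_def algebra_simps)
  have "q * y - r - t * (q * x - p) = frac (Y b) - frac (Y a)"
    unfolding qp by (simp add: q_def r_def frac_def[of "Y _"]) (simp add: Y_def algebra_simps)
  then have "\<bar>q * y - r - t * (q * x - p)\<bar> < 1 / n"
    using ab(4) close[OF n, of "Y b" "Y a"] by (simp add: \<Phi>_def)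
  moreover have "\<bar>q * x - p\<bar> < 1 / m"
    using ab(4) close[OF m, of "b * x" "a * x"] unfolding qp by (simp add: \<Phi>_def)
  moreover have "1 \<le> q" "q \<le> int N" using ab by (auto simp: q_def)
  ultimately show ?thesis by blast
qed

context convex_graph
begin

text \<open>An affine entry with nonzero integer slope moves by at least 2 over half the interval,
  and a constant nonzero entry is at least 1 by itself. For a dual vector with
  \<open>c \<noteq> 0\<close>, convexity makes a second difference of \<open>F\<close> at least
  \<open>c1 * L\<^sup>2 / 16\<close>; after multiplication by \<open>Q\<close> this is at least 4,
  so one of the four values involved is at least 1.\<close>

lemma sup_both_norm:
  assumes L: "0 < L" and J: "{\<alpha>..\<alpha>+L} \<subseteq> {A..B}" and d: "0 < d" "d \<le> 1" and Q: "1 \<le> Q" "1 \<le> Q * d"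
    "4 \<le> Q * d * L" "4 \<le> Q * L" "64 \<le> Q * c1 * L\<^sup>2" and v: "v \<noteq> 0"
  shows "\<exists>y\<in>{\<alpha>..<\<alpha>+L}. 1 \<le> both_norm Q d b v y"
proof -
  have pt: "\<alpha> \<in> {\<alpha>..<\<alpha>+L}" "\<alpha> + L/2 \<in> {\<alpha>..<\<alpha>+L}" "\<alpha> + L/4 \<in> {\<alpha>..<\<alpha>+L}" "\<alpha> + 3*L/4 \<in> {\<alpha>..<\<alpha>+L}"
    using L by auto
  have two: ?thesis if "2 \<le> \<bar>g \<alpha> - g (\<alpha> + L/2)\<bar>" "\<And>x. \<bar>g x\<bar> \<le> both_norm Q d b v x" for g :: "real \<Rightarrow> real"
  proof -
    have "1 \<le> \<bar>g \<alpha>\<bar> \<or> 1 \<le> \<bar>g (\<alpha> + L/2)\<bar>" using that(1) by linarith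
    then show ?thesis using pt that(2) by (meson order_trans)
  qed
  have lin: "2 \<le> \<bar>K * (u * \<alpha> + w) - K * (u * (\<alpha> + L/2) + w)\<bar>" if "u \<noteq> 0" "4 \<le> K * L" "0 < K" for K w :: real and u :: int
  proof -
    have "1 \<le> \<bar>real_of_int u\<bar>" using that(1) by linarith
    then have "K * L / 2 * 1 \<le> K * L / 2 * \<bar>real_of_int u\<bar>" using that L by (intro mult_left_mono) auto
    moreover have "K * (u * \<alpha> + w) - K * (u * (\<alpha> + L/2) + w) = (K * L / 2) * - u" by (simp add: algebra_simps)
    then have "\<bar>K * (u * \<alpha> + w) - K * (u * (\<alpha> + L/2) + w)\<bar> = K * L / 2 * \<bar>real_of_int u\<bar>"
      using that L by (simp add: abs_mult)
    ultimately show ?thesis using that(2) by linarith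
  qed
  show ?thesis
  proof (cases b)
    case True
    obtain q p r where e: "v = (q, p, r)" by (metis surj_pair)
    have N: "both_norm Q d b v = primal_norm Q d (q, p, r)" by (simp add: both_norm_def True e)
    have Ng: "\<bar>Q * d * (q * x + - p)\<bar> \<le> both_norm Q d b v x"
      "\<bar>q * f x - r - f1 x * (q * x - p)\<bar> / d \<le> both_norm Q d b v x" for x :: real
      unfolding N primal_norm_def using Q d by (auto simp: abs_mult)
    show ?thesis
    proof (cases "q = 0")
      case False
      then show ?thesis using two[of "\<lambda>x::real. Q * d * (q * x + - p)"] lin[of q "Q * d" "- p"] Q Ng by simp
    next
      case q: True
      show ?thesis
      proof (cases "p = 0")
        case False
        then have "1 \<le> \<bar>real_of_int p\<bar>" by linarith
        then have "1 * 1 \<le> (Q * d) * \<bar>real_of_int p\<bar>" using Q by (intro mult_mono) auto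
        then show ?thesis using Ng(1)[of \<alpha>] pt(1) q Q d by (intro bexI[of _ \<alpha>]) (auto simp: abs_mult)
      next
        case True
        then have "r \<noteq> 0" using v e q by (auto simp: zero_prod_def)
        then have "1 \<le> \<bar>real_of_int r\<bar>" by linarith
        then have "1 \<le> \<bar>real_of_int r\<bar> / d" using d by (simp add: field_simps)
        then show ?thesis using Ng(2)[of \<alpha>] pt(1) q True by (intro bexI[of _ \<alpha>]) auto
      qed
    qed
  next
    case False
    obtain a b' c where e: "v = (a, b', c)" by (metis surj_pair)
    define F where "F = (\<lambda>x::real. a + b' * x + c * f x)"
    have N: "both_norm Q d b v = dual_norm Q d (a, b', c)" by (simp add: both_norm_def False e)
    have Ng: "\<bar>Q * F x\<bar> \<le> both_norm Q d b v x" for x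
      unfolding N dual_norm_def F_def using Q d by (auto simp: abs_mult)
    show ?thesis
    proof (cases "c = 0")
      case c0: True
      show ?thesis
      proof (cases "b' = 0")
        case True
        then have "a \<noteq> 0" using v e c0 by (auto simp: zero_prod_def)
        then have "1 \<le> \<bar>real_of_int a\<bar>" by linarith
        then have "1 * 1 \<le> Q * \<bar>real_of_int a\<bar>" using Q by (intro mult_mono) auto
        then show ?thesis using Ng[of \<alpha>] pt(1) c0 True Q by (intro bexI[of _ \<alpha>]) (auto simp: abs_mult F_def)
      next
        case False
        then show ?thesis using two[of "\<lambda>x. Q * F x"] lin[of b' Q a] Q Ng c0 by (simp add: F_def add.commute)
      qed
    next
      case False
      have mvt: "\<exists>z. x < z \<and> z < x + L/4 \<and> F (x + L/4) - F x = L/4 * (b' + c * f1 z)" if "\<alpha> \<le> x" "x + L/4 \<le> \<alpha> + L" for x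
      proof -
        have "\<exists>z. x < z \<and> z < x + L/4 \<and> F (x + L/4) - F x = (x + L/4 - x) * (b' + c * f1 z)"
        proof (rule MVT2)
          fix z assume "x \<le> z" "z \<le> x + L/4"
          then have "z \<in> {A..B}" using that J by auto
          then have D: "(f has_real_derivative f1 z) (at z)" by (rule f1)
          show "(F has_real_derivative (b' + c * f1 z)) (at z)"
            unfolding F_def by (auto intro!: derivative_eq_intros D)
        qed (use L in simp)
        then show ?thesis by simp
      qed
      obtain z1 where z1: "\<alpha> < z1" "z1 < \<alpha> + L/4" "F (\<alpha> + L/4) - F \<alpha> = L/4 * (b' + c * f1 z1)"
        using mvt[of \<alpha>] L by auto
      obtain z2 where z2: "\<alpha> + L/2 < z2" "z2 < \<alpha> + L/2 + L/4" "F (\<alpha> + L/2 + L/4) - F (\<alpha> + L/2) = L/4 * (b' + c * f1 z2)"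
        using mvt[of "\<alpha> + L/2"] L by auto
      have "c1 * (L/4) \<le> c1 * (z2 - z1)" using z1 z2 c1 by (intro mult_left_mono) auto
      also have "\<dots> \<le> f1 z2 - f1 z1" using f1_slope[of z1 z2] z1 z2 J L by auto
      finally have s: "c1 * (L/4) \<le> \<bar>f1 z2 - f1 z1\<bar>" using abs_ge_self[of "f1 z2 - f1 z1"] by linarith
      have "1 \<le> \<bar>real_of_int c\<bar>" using False by linarith
      then have "1 * (c1 * (L/4)) \<le> \<bar>real_of_int c\<bar> * \<bar>f1 z2 - f1 z1\<bar>" using s c1 L by (intro mult_mono) auto
      then have "L/4 * (c1 * (L/4)) \<le> L/4 * (\<bar>real_of_int c\<bar> * \<bar>f1 z2 - f1 z1\<bar>)"
        using L by (intro mult_left_mono) auto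
      also have "\<dots> = \<bar>L/4 * (c * (f1 z2 - f1 z1))\<bar>" using L by (simp add: abs_mult)
      also have "L/4 * (c * (f1 z2 - f1 z1)) = (F (\<alpha> + L/2 + L/4) - F (\<alpha> + L/2)) - (F (\<alpha> + L/4) - F \<alpha>)"
        unfolding z1 z2 by (simp add: algebra_simps)
      finally have "L/4 * (c1 * (L/4)) \<le> \<bar>F (\<alpha> + L/2 + L/4)\<bar> + \<bar>F (\<alpha> + L/2)\<bar> + \<bar>F (\<alpha> + L/4)\<bar> + \<bar>F \<alpha>\<bar>"
        by linarith
      moreover have "L/4 * (c1 * (L/4)) = c1 * L\<^sup>2 / 16" by (simp add: power2_eq_square)
      ultimately have "c1 * L\<^sup>2 / 16 \<le> \<bar>F (\<alpha> + L/2 + L/4)\<bar> + \<bar>F (\<alpha> + L/2)\<bar> + \<bar>F (\<alpha> + L/4)\<bar> + \<bar>F \<alpha>\<bar>"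
        by linarith
      then have "Q * (c1 * L\<^sup>2 / 16) \<le> Q * (\<bar>F (\<alpha> + L/2 + L/4)\<bar> + \<bar>F (\<alpha> + L/2)\<bar> + \<bar>F (\<alpha> + L/4)\<bar> + \<bar>F \<alpha>\<bar>)"
        using Q by (intro mult_left_mono) auto
      moreover have "4 \<le> Q * (c1 * L\<^sup>2 / 16)" using Q(5) by simp
      moreover have "Q * \<bar>F x\<bar> = \<bar>Q * F x\<bar>" for x using Q by (simp add: abs_mult)
      ultimately have "4 \<le> \<bar>Q * F (\<alpha> + L/2 + L/4)\<bar> + \<bar>Q * F (\<alpha> + L/2)\<bar> + \<bar>Q * F (\<alpha> + L/4)\<bar> + \<bar>Q * F \<alpha>\<bar>"
        by (simp add: distrib_left)
      then have "1 \<le> \<bar>Q * F (\<alpha> + L/2 + L/4)\<bar> \<or> 1 \<le> \<bar>Q * F (\<alpha> + L/2)\<bar> \<or> 1 \<le> \<bar>Q * F (\<alpha> + L/4)\<bar> \<or> 1 \<le> \<bar>Q * F \<alpha>\<bar>"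
        by linarith
      moreover have "\<alpha> + L/2 + L/4 \<in> {\<alpha>..<\<alpha>+L}" using L by auto
      ultimately show ?thesis using pt Ng by (meson order_trans)
    qed
  qed
qed

text \<open>With \<open>\<eta> = 3 eps\<close> one has \<open>4 * 32 * (c2 / c1) * sqrt \<eta> = 1/2\<close>, so the exceptional set in
  the nondivergence estimate fills at most half of the interval.\<close>

definition eps :: real where "eps = (c1 / (256 * c2))\<^sup>2 / 3"

lemma eps: "0 < eps" "eps < 1"
proof -
  have c2: "0 < c2" using c1 c12 by linarith
  have "c1 / (256 * c2) \<le> 1" using c1 c12 c2 by simp
  then have "(c1 / (256 * c2))\<^sup>2 \<le> 1" using c1 c2 by (simp add: power_le_one)
  then show "0 < eps" "eps < 1" using c1 c2 by (auto simp: eps_def)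
qed

theorem few_short_vectors:
  assumes L: "0 < L" and J: "{\<alpha>..\<alpha>+L} \<subseteq> {A..B}" and d: "0 < d" "d \<le> 1" and Q: "1 \<le> Q" "1 \<le> Q * d"
    "4 \<le> Q * d * L" "4 \<le> Q * L" "64 \<le> Q * c1 * L\<^sup>2"
  shows "outer_le {x\<in>{\<alpha>..<\<alpha>+L}. \<exists>b v. v \<noteq> 0 \<and> both_norm Q d b v x < eps} (L / 2)"
proof -
  define \<eta> where "\<eta> = (c1 / (256 * c2))\<^sup>2"
  have c2: "0 < c2" using c1 c12 by linarith
  have r: "c1 / (256 * c2) \<le> 1 / 256" "0 < c1 / (256 * c2)" using c1 c12 c2 by (auto simp: field_simps)
  have "\<eta> \<le> (1/256)\<^sup>2" unfolding \<eta>_def using r by (intro power_mono) auto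
  moreover have "0 < \<eta>" unfolding \<eta>_def using r(2) by (rule zero_less_power)
  ultimately have \<eta>: "0 < \<eta>" "\<eta> \<le> 1/2" by (simp_all add: power2_eq_square)
  interpret dual_norms "both_norm Q d" by (rule dual_norms_both_norm) (use Q d in auto)
  have "outer_le {x\<in>{\<alpha>..<\<alpha>+L}. \<exists>b v. v \<noteq> 0 \<and> both_norm Q d b v x < \<eta> / 3} (4 * (32 * (c2 / c1) * sqrt \<eta>) * L)"
  proof (rule quantitative_nondivergence[OF L])
    show "continuous_on {\<alpha>..<\<alpha>+L} (both_norm Q d b v)" for b v
      by (rule continuous_both_norm) (use J in auto)
    show "\<exists>y\<in>{\<alpha>..<\<alpha>+L}. 1 \<le> both_norm Q d b v y" if "v \<noteq> 0" for b v
      using sup_both_norm[OF L J d Q that] .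
    show "outer_le {x\<in>{s..<e}. both_norm Q d b v x < \<eta>} (32 * (c2 / c1) * sqrt \<eta> * (e - s))"
      if "\<alpha> \<le> s" "s < e" "e \<le> \<alpha> + L" "\<exists>y\<in>{s..<e}. 1 \<le> both_norm Q d b v y" for b v s e
      by (rule sublevel_both_norm) (use that \<eta> Q d J in auto)
  qed (use \<eta> c1 c2 in auto)
  moreover have "sqrt \<eta> = c1 / (256 * c2)"
    unfolding \<eta>_def using r(2) by (simp only: real_sqrt_abs abs_of_pos)
  then have "4 * (32 * (c2 / c1) * sqrt \<eta>) * L = L / 2" using c1 c2 by simp
  moreover have "eps = \<eta> / 3" by (simp add: eps_def \<eta>_def)
  ultimately show ?thesis by (simp only:)
qed

lemma taylor_bound:
  assumes "x \<in> {A..B}" "z \<in> {A..B}"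
  shows "\<bar>f z - f x - f1 x * (z - x)\<bar> \<le> c2 * (z - x)\<^sup>2"
proof -
  have "\<exists>w\<in>{A..B}. \<bar>w - x\<bar> \<le> \<bar>z - x\<bar> \<and> f z - f x = (z - x) * f1 w"
  proof (cases x z rule: linorder_cases)
    case less
    then have "\<exists>w. x < w \<and> w < z \<and> f z - f x = (z - x) * f1 w" using assms by (intro MVT2 f1) auto
    then show ?thesis using assms by force
  next
    case greater
    then have "\<exists>w. z < w \<and> w < x \<and> f x - f z = (x - z) * f1 w" using assms by (intro MVT2 f1) auto
    then obtain w where "z < w" "w < x" "f x - f z = (x - z) * f1 w" by blast
    then show ?thesis using assms by (intro bexI[of _ w]) (auto simp: algebra_simps)
  qed (use assms in auto)
  then obtain w where w: "w \<in> {A..B}" "\<bar>w - x\<bar> \<le> \<bar>z - x\<bar>" "f z - f x = (z - x) * f1 w" by blast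
  have "f z - f x - f1 x * (z - x) = (z - x) * (f1 w - f1 x)" using w(3) by (simp add: algebra_simps)
  then have "\<bar>f z - f x - f1 x * (z - x)\<bar> = \<bar>z - x\<bar> * \<bar>f1 w - f1 x\<bar>" by (simp add: abs_mult)
  also have "\<dots> \<le> \<bar>z - x\<bar> * (c2 * \<bar>z - x\<bar>)"
  proof (rule mult_left_mono)
    have "c2 * \<bar>w - x\<bar> \<le> c2 * \<bar>z - x\<bar>" using w(2) c1 c12 by (intro mult_left_mono) auto
    then show "\<bar>f1 w - f1 x\<bar> \<le> c2 * \<bar>z - x\<bar>" using f1_bilipschitz(2)[OF w(1) assms(1)] by linarith
  qed simp
  finally show ?thesis by (simp add: power2_eq_square mult_ac)
qed

text \<open>Excluding vectors of norm less than \<open>eps\<close> in the suitably rescaled norm forces the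
  denominators found by the pigeonhole principle to be at least \<open>qfrac * N\<close>.\<close>

definition qfrac :: real where "qfrac = eps ^ 3 / 2"

lemma qfrac: "0 < qfrac" "qfrac < 1"
  using eps power_le_one[of eps 3] by (auto simp: qfrac_def)

text \<open>One half of the tolerance \<open>2 / n\<close> is the Dirichlet bound for the tangent
  form, the other half pays for replacing the tangent line by the graph.\<close>

definition good_fraction :: "nat \<Rightarrow> nat \<Rightarrow> int \<Rightarrow> int \<Rightarrow> bool" where
  "good_fraction N n q p \<longleftrightarrow> qfrac * N \<le> q \<and> q \<le> N \<and> (\<exists>r::int. \<bar>q * f (p / q) - r\<bar> \<le> 2 / n)"

text \<open>The exceptional points are those admitting a vector of norm below \<open>eps\<close>.
  Elsewhere the Dirichlet vector itself cannot be that short, and this forces its denominator up.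
  The restriction to \<open>p / q \<in> {A..B}\<close> is there because \<open>p / q\<close> may
  fall outside the interval on which \<open>f\<close> is controlled.\<close>

theorem good_fractions_cover:
  assumes L: "0 < L" and J: "{\<alpha>..\<alpha>+L} \<subseteq> {A..B}"
  shows "\<exists>K\<ge>1::real. \<forall>(N::nat) (n::nat). 1 / eps \<le> real n \<longrightarrow> K * real n \<le> real N \<longrightarrow>
    outer_le {x\<in>{\<alpha>..<\<alpha>+L}. \<not> (\<exists>q p. \<bar>x - p / q\<bar> < 2 * real n / (qfrac * (real N)\<^sup>2) \<and>
       (p / q \<in> {A..B} \<longrightarrow> good_fraction N n q p))} (L / 2)"
proof -
  have c2: "0 < c2" using c1 c12 by linarith
  \<comment> \<open>In this order the summands secure \<open>n \<le> N\<close>, the five conditions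
    on \<open>Q\<close> in \<open>few_short_vectors\<close>, and the smallness of the Taylor
    remainder.\<close>
  define K where "K = 1 + 2 / eps\<^sup>2 + 2 / eps + 8 / (eps * L) + 8 / (eps\<^sup>2 * L) + 128 / (eps\<^sup>2 * c1 * L\<^sup>2) + 4 * c2 / qfrac"
  have pos: "0 < 2 / eps\<^sup>2" "0 < 2 / eps" "0 < 8 / (eps * L)" "0 < 8 / (eps\<^sup>2 * L)" "0 < 128 / (eps\<^sup>2 * c1 * L\<^sup>2)" "0 < 4 * c2 / qfrac"
    using eps L c1 c2 qfrac by auto
  have Kge: "1 \<le> K" "2 / eps\<^sup>2 \<le> K" "2 / eps \<le> K" "8 / (eps * L) \<le> K" "8 / (eps\<^sup>2 * L) \<le> K"
    "128 / (eps\<^sup>2 * c1 * L\<^sup>2) \<le> K" "4 * c2 / qfrac \<le> K" using pos unfolding K_def by linarith+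
  show ?thesis
  proof (intro exI[of _ K] conjI allI impI)
    show "1 \<le> K" by (rule Kge)
    fix N n :: nat
    assume n: "1 / eps \<le> n" and KN: "K * n \<le> N"
    have "0 < 1 / eps" using eps by simp
    then have "0 < real n" using n by linarith
    then have n1: "1 \<le> real n" by simp
    have nN: "n \<le> N" using mult_right_mono[OF Kge(1), of n] KN by simp
    have K1: "K \<le> N / n" using KN n1 by (simp add: field_simps)
    have "real N * 1 \<le> real N * real n" using n1 by (intro mult_left_mono) auto
    then have "N / n \<le> N" using n1 by (simp add: field_simps)
    then have K2: "K \<le> N" using K1 by linarith
    \<comment> \<open>\<open>Q\<close> and \<open>d\<close> are tuned so that each Dirichlet bound
      becomes \<open>eps\<close>: \<open>Q * d * (2 * n / N) = eps\<close>,
      \<open>(1 / n) / d = eps\<close>, and \<open>qfrac * N = eps * Q\<close>.\<close>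
    define d where "d = 1 / (n * eps)"
    define Q where "Q = eps\<^sup>2 * N / 2"
    have Qd: "Q * d = eps * (N / n) / 2" using eps n1 by (simp add: Q_def d_def power2_eq_square field_simps)
    have Nge: "2 / eps\<^sup>2 \<le> N" "8 / (eps\<^sup>2 * L) \<le> N" "128 / (eps\<^sup>2 * c1 * L\<^sup>2) \<le> N" using Kge K2 by linarith+
    have Nge': "2 / eps \<le> N / n" "8 / (eps * L) \<le> N / n" "4 * c2 / qfrac \<le> N / n" using Kge K1 by linarith+
    have e: "2 \<le> N * eps\<^sup>2" "8 \<le> N * (eps\<^sup>2 * L)" "128 \<le> N * (eps\<^sup>2 * c1 * L\<^sup>2)"
      using Nge eps L c1 by (simp_all only: pos_divide_le_eq mult_pos_pos zero_less_power)
    have e': "2 \<le> N / n * eps" "8 \<le> N / n * (eps * L)"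
      using Nge' eps L by (simp_all only: pos_divide_le_eq mult_pos_pos)
    have few: "outer_le {x\<in>{\<alpha>..<\<alpha>+L}. \<exists>b v. v \<noteq> 0 \<and> both_norm Q d b v x < eps} (L / 2)"
    proof (rule few_short_vectors[OF L J])
      have "1 \<le> real n * eps" using n eps by (simp add: field_simps)
      then show "0 < d" "d \<le> 1" using n1 eps by (auto simp: d_def)
      show "1 \<le> Q" using e(1) by (simp add: Q_def mult.commute)
      have half: "b \<le> a / 2" if "2 * b \<le> a" for a b :: real using that by simp
      have qd: "Q * d = (N / n * eps) / 2" "Q * d * L = (N / n * (eps * L)) / 2" by (simp_all add: Qd)
      show "1 \<le> Q * d" unfolding qd(1) by (rule half) (use e'(1) in simp)
      show "4 \<le> Q * d * L" unfolding qd(2) by (rule half) (use e'(2) in simp)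
      show "4 \<le> Q * L" using e(2) by (simp add: Q_def mult_ac)
      show "64 \<le> Q * c1 * L\<^sup>2" using e(3) by (simp add: Q_def mult_ac)
    qed
    show "outer_le {x\<in>{\<alpha>..<\<alpha>+L}. \<not> (\<exists>q p. \<bar>x - p / q\<bar> < 2 * real n / (qfrac * (real N)\<^sup>2) \<and>
       (p / q \<in> {A..B} \<longrightarrow> good_fraction N n q p))} (L / 2)"
    proof (rule outer_le_mono[OF few _ order_refl], rule subsetI, rule ccontr)
      fix x assume x: "x \<in> {x\<in>{\<alpha>..<\<alpha>+L}. \<not> (\<exists>q p. \<bar>x - p / q\<bar> < 2 * real n / (qfrac * (real N)\<^sup>2) \<and>
         (p / q \<in> {A..B} \<longrightarrow> good_fraction N n q p))}"
        and nx: "x \<notin> {x\<in>{\<alpha>..<\<alpha>+L}. \<exists>b v. v \<noteq> 0 \<and> both_norm Q d b v x < eps}"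
      have xAB: "x \<in> {A..B}" using x J by auto
      \<comment> \<open>Rounding down costs at most a factor 2, since
        \<open>n \<le> N\<close>.\<close>
      define m where "m = N div n"
      have m: "0 < m" "n * m \<le> N" using nN n1 by (auto simp: m_def div_greater_zero_iff)
      have "N < n * (m + 1)" using n1 unfolding m_def by (simp add: dividend_less_times_div)
      also have "\<dots> \<le> n * (2 * m)" using m by (intro mult_left_mono) auto
      finally have "real N \<le> 2 * n * m" by (metis less_imp_le mult.assoc mult.left_commute of_nat_le_iff of_nat_mult of_nat_numeral)
      then have m1: "1 / m \<le> 2 * n / N" using m nN n1 by (simp add: field_simps)
      obtain q p r :: int where q: "1 \<le> q" "q \<le> N" and qp: "\<bar>q * x - p\<bar> < 1 / m"
        and qr: "\<bar>q * f x - r - f1 x * (q * x - p)\<bar> < 1 / n"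
        using tangent_pigeonhole[of n m N x "f x" "f1 x"] m n1 by auto
      have qp': "\<bar>q * x - p\<bar> < 2 * n / N" using qp m1 by linarith
      have N0: "0 < real N" using nN n1 by linarith
      have big: "qfrac * N \<le> q"
      proof (rule ccontr)
        assume "\<not> ?thesis"
        moreover have "qfrac * N = eps * Q" by (simp add: Q_def qfrac_def power3_eq_cube power2_eq_square)
        moreover have "0 < Q" using eps N0 by (simp add: Q_def)
        ultimately have "\<bar>real_of_int q\<bar> / Q < eps" using q by (simp add: pos_divide_less_eq)
        moreover have "Q * d * \<bar>q * x - p\<bar> < eps"
        proof -
          have "eps * (N / n) / 2 * \<bar>q * x - p\<bar> < eps * (N / n) / 2 * (2 * n / N)"
            using qp' eps N0 n1 by (intro mult_strict_left_mono) auto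
          also have "\<dots> = eps" using N0 n1 by simp
          finally show ?thesis unfolding Qd .
        qed
        moreover have "\<bar>q * f x - r - f1 x * (q * x - p)\<bar> / d < eps"
          using mult_strict_right_mono[OF qr, of "n * eps"] n1 eps by (simp add: d_def)
        ultimately have "both_norm Q d True (q, p, r) x < eps" by (simp add: both_norm_def primal_norm_def)
        moreover have "(q, p, r) \<noteq> 0" using q by (simp add: zero_prod_def)
        ultimately show False using nx x by blast
      qed
      have q0: "0 < real_of_int q" using q by linarith
      define z where "z = p / real_of_int q"
      have zx: "q * (x - z) = q * x - p" using q0 by (simp add: z_def field_simps)
      have "\<bar>x - z\<bar> = \<bar>q * x - p\<bar> / q" using q0 unfolding zx[symmetric] by (simp add: abs_mult)
      also have "\<dots> \<le> \<bar>q * x - p\<bar> / (qfrac * N)" using big qfrac N0 q0 by (intro divide_left_mono) auto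
      also have "\<dots> < (2 * n / N) / (qfrac * N)" using qp' qfrac N0 by (intro divide_strict_right_mono) auto
      also have "\<dots> = 2 * real n / (qfrac * (real N)\<^sup>2)" by (simp add: power2_eq_square field_simps)
      finally have close: "\<bar>x - z\<bar> < 2 * real n / (qfrac * (real N)\<^sup>2)" .
      have "good_fraction N n q p" if z: "z \<in> {A..B}"
      proof -
        have "q * f z - r = (q * f x - r - f1 x * (q * x - p)) + q * (f z - f x - f1 x * (z - x))"
          unfolding zx[symmetric] by (simp add: algebra_simps)
        then have "\<bar>q * f z - r\<bar> \<le> \<bar>q * f x - r - f1 x * (q * x - p)\<bar> + \<bar>q * (f z - f x - f1 x * (z - x))\<bar>"
          by linarith
        also have "\<bar>q * (f z - f x - f1 x * (z - x))\<bar> \<le> q * (c2 * (z - x)\<^sup>2)"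
          using taylor_bound[OF xAB z] q0 by (simp add: abs_mult)
        also have "q * (c2 * (z - x)\<^sup>2) = c2 * (q * x - p)\<^sup>2 / q"
          using q0 unfolding zx[symmetric] by (simp add: power2_eq_square field_simps)
        also have "\<dots> \<le> c2 * (2 * n / N)\<^sup>2 / (qfrac * N)"
        proof (rule frac_le)
          have "(q * x - p)\<^sup>2 \<le> (2 * n / N)\<^sup>2" using qp' by (intro abs_le_square_iff[THEN iffD1]) auto
          then show "c2 * (q * x - p)\<^sup>2 \<le> c2 * (2 * n / N)\<^sup>2" using c2 by simp
        qed (use big qfrac N0 c2 in auto)
        also have "\<dots> \<le> 1 / n"
        proof -
          have "4 * c2 / qfrac \<le> (N / n) * 1" using Nge' by simp
          also have "\<dots> \<le> (N / n) * (N / n)\<^sup>2"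
            using nN n1 N0 by (intro mult_left_mono one_le_power) (auto simp: field_simps)
          finally have "4 * c2 \<le> (N / n) * (N / n)\<^sup>2 * qfrac" using qfrac by (simp only: pos_divide_le_eq)
          then have "4 * c2 * n ^ 3 \<le> (N / n) * (N / n)\<^sup>2 * qfrac * n ^ 3" by (intro mult_right_mono) auto
          also have "\<dots> = qfrac * N ^ 3" using n1 by (simp add: power2_eq_square power3_eq_cube)
          finally have "c2 * (2 * n / N)\<^sup>2 * n \<le> qfrac * N"
            using N0 by (simp add: field_simps power2_eq_square power3_eq_cube)
          then show ?thesis using n1 N0 qfrac by (simp add: pos_divide_le_eq pos_le_divide_eq mult.commute)
        qed
        finally have "\<bar>q * f z - r\<bar> \<le> 2 / n" using qr by simp
        then show ?thesis using big q unfolding good_fraction_def z_def by auto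
      qed
      then show False using x close unfolding z_def by blast
    qed
  qed
qed

end

section \<open>Ubiquity and the second moment method\<close>

text \<open>A separated subset of maximal cardinality cannot be enlarged. The alternative
  \<open>x = y\<close> covers a nonpositive \<open>\<rho>\<close>.\<close>

lemma maximal_separated_subset:
  fixes S :: "real set"
  assumes "finite S"
  shows "\<exists>H\<subseteq>S. (\<forall>x\<in>H. \<forall>y\<in>H. x \<noteq> y \<longrightarrow> \<rho> \<le> \<bar>x - y\<bar>) \<and> (\<forall>x\<in>S. \<exists>y\<in>H. \<bar>x - y\<bar> < \<rho> \<or> x = y)"
proof -
  define P where "P = {H. H \<subseteq> S \<and> (\<forall>x\<in>H. \<forall>y\<in>H. x \<noteq> y \<longrightarrow> \<rho> \<le> \<bar>x - y\<bar>)}"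
  have "finite P" unfolding P_def using assms by (auto intro: finite_subset[of _ "Pow S"])
  moreover have "{} \<in> P" by (simp add: P_def)
  ultimately obtain H where H: "H \<in> P" "\<And>H'. H' \<in> P \<Longrightarrow> card H' \<le> card H"
    using obtains_MAX[of P card] by (metis empty_iff Max_ge finite_imageI imageI)
  have "\<exists>y\<in>H. \<bar>x - y\<bar> < \<rho> \<or> x = y" if x: "x \<in> S" for x
  proof (rule ccontr)
    assume n: "\<not> ?thesis"
    then have "insert x H \<in> P" using H(1) x by (auto simp: P_def not_less abs_minus_commute)
    moreover have "x \<notin> H" using n by auto
    moreover have "finite H" using H(1) assms by (auto simp: P_def intro: finite_subset)
    ultimately show False using H(2)[of "insert x H"] by simp
  qed
  then show ?thesis using H(1) unfolding P_def by blast
qed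

text \<open>Distinct points fall into distinct cells of a grid of mesh \<open>\<rho>\<close>
  starting at \<open>u\<close>.\<close>

lemma card_separated_le:
  fixes H :: "real set"
  assumes sep: "\<And>x y. x \<in> H \<Longrightarrow> y \<in> H \<Longrightarrow> x \<noteq> y \<Longrightarrow> \<rho> \<le> \<bar>x - y\<bar>" and \<rho>: "0 < \<rho>"
    and H: "H \<subseteq> {u..w}" and uw: "u \<le> w"
  shows "real (card H) \<le> (w - u) / \<rho> + 1"
proof -
  define \<phi> where "\<phi> = (\<lambda>x. \<lfloor>(x - u) / \<rho>\<rfloor>)"
  have "inj_on \<phi> H"
  proof (rule inj_onI, rule ccontr)
    fix x y assume xy: "x \<in> H" "y \<in> H" "\<phi> x = \<phi> y" "x \<noteq> y"
    then have "\<bar>(x - u) / \<rho> - (y - u) / \<rho>\<bar> < 1" unfolding \<phi>_def by linarith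
    moreover have "(x - u) / \<rho> - (y - u) / \<rho> = (x - y) / \<rho>" by (simp add: diff_divide_distrib)
    ultimately have "\<bar>x - y\<bar> < \<rho>" using \<rho> by (simp add: abs_divide)
    then show False using sep[OF xy(1,2,4)] by simp
  qed
  moreover have "\<phi> x \<in> {0..\<lfloor>(w - u) / \<rho>\<rfloor>}" if "x \<in> H" for x
  proof -
    have "u \<le> x" "x \<le> w" using that H by auto
    then show ?thesis using \<rho> by (auto simp: \<phi>_def intro!: floor_mono divide_right_mono)
  qed
  then have "\<phi> ` H \<subseteq> {0..\<lfloor>(w - u) / \<rho>\<rfloor>}" by blast
  ultimately have "card H \<le> card {0..\<lfloor>(w - u) / \<rho>\<rfloor>}" by (intro card_inj_on_le) auto
  also have "\<dots> = nat (\<lfloor>(w - u) / \<rho>\<rfloor> + 1)" by simp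
  finally have "real (card H) \<le> real (nat (\<lfloor>(w - u) / \<rho>\<rfloor> + 1))" by simp
  also have "\<dots> = real_of_int (\<lfloor>(w - u) / \<rho>\<rfloor> + 1)" using uw \<rho> by simp
  also have "\<dots> \<le> (w - u) / \<rho> + 1" by simp
  finally show ?thesis .
qed

lemma outer_le_UN_intervals:
  assumes "finite H" "0 \<le> r"
  shows "outer_le (\<Union>z\<in>H. {z - r..z + r}) (2 * r * card H)"
  using assms(1)
proof induction
  case (insert z H)
  have "outer_le {z - r..z + r} (2 * r)" using outer_le_interval[of "z - r" "z + r"] assms(2) by simp
  from outer_le_Un[OF this insert.IH] assms(2)
  have "outer_le ({z - r..z + r} \<union> (\<Union>z\<in>H. {z - r..z + r})) (2 * r + 2 * r * card H)" by simp
  then show ?case using insert.hyps by (simp add: algebra_simps)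
qed (simp add: outer_le_empty)

lemma outer_le_interval_imp:
  assumes "outer_le {u..<w} e" "0 \<le> e"
  shows "w - u \<le> e"
proof (cases "u \<le> w")
  case True
  obtain Z where Z: "Z \<in> sets lborel" "{u..<w} \<subseteq> Z" "emeasure lborel Z \<le> ennreal e"
    using assms unfolding outer_le_def by blast
  have "emeasure lborel {u..<w} \<le> emeasure lborel Z" using Z by (intro emeasure_mono) auto
  then have "ennreal (w - u) \<le> ennreal e" using Z(3) True by simp
  then show ?thesis using assms by (simp add: ennreal_le_iff)
qed (use assms in simp)

text \<open>Integrate \<open>1\<^bsub>X > 0\<^esub> \<ge> 2 \<lambda> X - \<lambda>\<^sup>2 X\<^sup>2\<close> for the counting function \<open>X\<close>, with \<open>\<lambda> = 1 / (K S)\<close>.\<close>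

lemma measure_UN_ge_second_moment:
  fixes E :: "'i \<Rightarrow> real set"
  assumes F: "finite F" and E: "\<And>i. i \<in> F \<Longrightarrow> E i \<in> lmeasurable"
    and S: "S = (\<Sum>i\<in>F. measure lebesgue (E i))" "0 < S" and K: "0 < K"
    and pairs: "(\<Sum>i\<in>F. \<Sum>j\<in>F. measure lebesgue (E i \<inter> E j)) \<le> K * S\<^sup>2"
  shows "1 / K \<le> measure lebesgue (\<Union>i\<in>F. E i)"
proof -
  define c where "c = 1 / (K * S)"
  define X where "X = (\<lambda>x. \<Sum>i\<in>F. indicator (E i) x :: real)"
  have U: "(\<Union>i\<in>F. E i) \<in> lmeasurable" using F E by (intro fmeasurable.finite_UN) auto
  have iE: "integrable lebesgue (indicator A :: real \<Rightarrow> real)" if "A \<in> lmeasurable" for A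
    using that by (intro integrable_real_indicator) (simp_all add: fmeasurable_def del: emeasure_completion)
  have iX: "integrable lebesgue X" unfolding X_def using E iE by (intro Bochner_Integration.integrable_sum) auto
  have X2: "(X x)\<^sup>2 = (\<Sum>i\<in>F. \<Sum>j\<in>F. indicator (E i \<inter> E j) x)" for x
    unfolding X_def power2_eq_square sum_product by (simp add: indicator_inter_arith)
  have EE: "E i \<inter> E j \<in> lmeasurable" if "i \<in> F" "j \<in> F" for i j
    using E that by (intro fmeasurable.Int) auto
  have iX2: "integrable lebesgue (\<lambda>x. (X x)\<^sup>2)" unfolding X2 using EE iE
    by (intro Bochner_Integration.integrable_sum) auto
  have mX: "(\<integral>x. X x \<partial>lebesgue) = S"
    unfolding X_def S(1) using E iE by (subst Bochner_Integration.integral_sum) auto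
  have mX2: "(\<integral>x. (X x)\<^sup>2 \<partial>lebesgue) = (\<Sum>i\<in>F. \<Sum>j\<in>F. measure lebesgue (E i \<inter> E j))"
  proof -
    have "(\<integral>x. (X x)\<^sup>2 \<partial>lebesgue) = (\<Sum>i\<in>F. \<integral>x. (\<Sum>j\<in>F. indicator (E i \<inter> E j) x) \<partial>lebesgue)"
      unfolding X2 using EE iE by (intro Bochner_Integration.integral_sum Bochner_Integration.integrable_sum) auto
    also have "\<dots> = (\<Sum>i\<in>F. \<Sum>j\<in>F. \<integral>x. indicator (E i \<inter> E j) x \<partial>lebesgue)"
      using EE iE by (intro sum.cong refl Bochner_Integration.integral_sum) auto
    finally show ?thesis by simp
  qed
  have "2 * c * X x - c\<^sup>2 * (X x)\<^sup>2 \<le> indicator (\<Union>i\<in>F. E i) x" for x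
  proof (cases "x \<in> (\<Union>i\<in>F. E i)")
    case True
    have "0 \<le> (1 - c * X x)\<^sup>2" by simp
    then show ?thesis using True by (simp add: power2_eq_square algebra_simps)
  next
    case False
    then have "X x = 0" unfolding X_def by (intro sum.neutral) auto
    then show ?thesis by simp
  qed
  then have "(\<integral>x. 2 * c * X x - c\<^sup>2 * (X x)\<^sup>2 \<partial>lebesgue) \<le> (\<integral>x. indicator (\<Union>i\<in>F. E i) x \<partial>lebesgue)"
    using iX iX2 iE[OF U] by (intro integral_mono) auto
  also have "\<dots> = measure lebesgue (\<Union>i\<in>F. E i)" by simp
  also have "(\<integral>x. 2 * c * X x - c\<^sup>2 * (X x)\<^sup>2 \<partial>lebesgue) = 2 * c * S - c\<^sup>2 * (\<Sum>i\<in>F. \<Sum>j\<in>F. measure lebesgue (E i \<inter> E j))"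
    using iX iX2 by (simp add: mX mX2)
  finally have "2 * c * S - c\<^sup>2 * (\<Sum>i\<in>F. \<Sum>j\<in>F. measure lebesgue (E i \<inter> E j)) \<le> measure lebesgue (\<Union>i\<in>F. E i)" .
  moreover have "c\<^sup>2 * (\<Sum>i\<in>F. \<Sum>j\<in>F. measure lebesgue (E i \<inter> E j)) \<le> c\<^sup>2 * (K * S\<^sup>2)"
    using pairs by (intro mult_left_mono) auto
  moreover have "c\<^sup>2 * (K * S\<^sup>2) = 1 / K" "c * S = 1 / K"
    using K S(2) by (auto simp: c_def power2_eq_square field_simps)
  ultimately show ?thesis by linarith
qed

section \<open>Neighbourhoods of separated finite sets and their overlaps\<close>

definition thicken :: "real set \<Rightarrow> real \<Rightarrow> real set" where
  "thicken H r = (\<Union>z\<in>H. {z - r..z + r})"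

lemma lmeasurable_thicken: "finite H \<Longrightarrow> thicken H r \<in> lmeasurable"
  unfolding thicken_def by (intro fmeasurable.finite_UN) auto

lemma measure_thicken:
  assumes H: "finite H" and sep: "\<And>x y. x \<in> H \<Longrightarrow> y \<in> H \<Longrightarrow> x \<noteq> y \<Longrightarrow> \<rho> \<le> \<bar>x - y\<bar>"
    and r: "0 \<le> r" "2 * r < \<rho>"
  shows "measure lebesgue (thicken H r) = 2 * r * card H"
proof -
  have "measure lebesgue (thicken H r) = (\<Sum>z\<in>H. measure lebesgue {z - r..z + r})"
    unfolding thicken_def
  proof (rule measure_finite_Union)
    show "disjoint_family_on (\<lambda>z. {z - r..z + r}) H"
      unfolding disjoint_family_on_def
    proof (intro ballI impI)
      fix x y assume "x \<in> H" "y \<in> H" "x \<noteq> y"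
      then have "\<rho> \<le> \<bar>x - y\<bar>" by (rule sep)
      then show "{x - r..x + r} \<inter> {y - r..y + r} = {}" using r by auto
    qed
  qed (use H r in auto)
  also have "\<dots> = (\<Sum>z\<in>H. 2 * r)" using r by (intro sum.cong) auto
  finally show ?thesis by simp
qed

lemma measure_thicken_le: "finite H \<Longrightarrow> 0 \<le> r \<Longrightarrow> measure lebesgue (thicken H r) \<le> 2 * r * card H"
proof -
  assume a: "finite H" "0 \<le> r"
  have "measure lebesgue (thicken H r) \<le> (\<Sum>z\<in>H. measure lebesgue {z - r..z + r})"
    unfolding thicken_def using a by (intro measure_UNION_le) auto
  also have "\<dots> = 2 * r * card H" using a by simp
  finally show ?thesis .
qed

text \<open>An interval of radius \<open>r\<close> is met only by intervals whose centres lie within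
  \<open>r + r'\<close> of its own centre; separation leaves at most
  \<open>2 * r / \<rho>' + 2\<close> of these. The first summand is what independence predicts, the
  second a boundary effect.\<close>

lemma measure_thicken_Int_le:
  assumes H: "finite H" "finite H'" and sep: "\<And>x y. x \<in> H' \<Longrightarrow> y \<in> H' \<Longrightarrow> x \<noteq> y \<Longrightarrow> \<rho>' \<le> \<bar>x - y\<bar>"
    and r: "0 < r" "0 < r'" "2 * r' \<le> \<rho>'"
  shows "measure lebesgue (thicken H r \<inter> thicken H' r') \<le> card H * (2 * r' * (2 * r / \<rho>' + 2))"
proof -
  have one: "measure lebesgue ({z - r..z + r} \<inter> thicken H' r') \<le> 2 * r' * (2 * r / \<rho>' + 2)" for z
  proof -
    define H'' where "H'' = H' \<inter> {z - (r + r')..z + (r + r')}"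
    have fin: "finite H''" using H by (simp add: H''_def)
    have "{z - r..z + r} \<inter> thicken H' r' \<subseteq> thicken H'' r'"
      unfolding thicken_def H''_def by fastforce
    then have "measure lebesgue ({z - r..z + r} \<inter> thicken H' r') \<le> measure lebesgue (thicken H'' r')"
      using lmeasurable_thicken[OF fin] lmeasurable_thicken[OF H(2)] by (intro measure_mono_fmeasurable) auto
    also have "\<dots> \<le> 2 * r' * card H''" using fin r by (intro measure_thicken_le) auto
    also have "\<dots> \<le> 2 * r' * (2 * r / \<rho>' + 2)"
    proof (rule mult_left_mono)
      have "real (card H'') \<le> ((z + (r + r')) - (z - (r + r'))) / \<rho>' + 1"
        by (rule card_separated_le) (use sep r in \<open>auto simp: H''_def\<close>)
      also have "\<dots> = 2 * r / \<rho>' + 2 * r' / \<rho>' + 1" by (simp add: add_divide_distrib)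
      also have "2 * r' / \<rho>' \<le> 1" using r by simp
      finally show "real (card H'') \<le> 2 * r / \<rho>' + 2" by simp
    qed (use r in simp)
    finally show ?thesis .
  qed
  have e: "thicken H r \<inter> thicken H' r' = (\<Union>z\<in>H. {z - r..z + r} \<inter> thicken H' r')"
    by (auto simp: thicken_def)
  have "measure lebesgue (thicken H r \<inter> thicken H' r') \<le> (\<Sum>z\<in>H. measure lebesgue ({z - r..z + r} \<inter> thicken H' r'))"
    unfolding e using H fmeasurableD[OF lmeasurable_thicken[OF H(2)]] by (intro measure_UNION_le sets.Int) auto
  also have "\<dots> \<le> (\<Sum>z\<in>H. 2 * r' * (2 * r / \<rho>' + 2))" using one by (intro sum_mono)
  finally show ?thesis by simp
qed

text \<open>If \<open>e t\<close> is the measure of the neighbourhood at scale \<open>t\<close> and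
  \<open>S\<close> their sum, the pair overlaps for \<open>s < t\<close> are at most
  \<open>16 * e s * e t / L\<close> plus a boundary term. By \<open>tail\<close> the boundary terms
  for fixed \<open>s\<close> sum to at most \<open>2 * e s\<close>. Counting both orders and the
  diagonal gives \<open>32 * S\<^sup>2 / L + 5 * S\<close>, and \<open>S \<ge> L\<close> turns this
  into \<open>37 / L * S\<^sup>2\<close>.\<close>

lemma ubiquity_lower_bound:
  fixes H :: "nat \<Rightarrow> real set" and r \<rho> :: "nat \<Rightarrow> real"
  assumes L: "0 < L" and F: "finite F" and H: "\<And>t. t \<in> F \<Longrightarrow> finite (H t)"
    and sep: "\<And>t x y. t \<in> F \<Longrightarrow> x \<in> H t \<Longrightarrow> y \<in> H t \<Longrightarrow> x \<noteq> y \<Longrightarrow> \<rho> t \<le> \<bar>x - y\<bar>"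
    and many: "\<And>t. t \<in> F \<Longrightarrow> L \<le> 16 * \<rho> t * card (H t)"
    and r: "\<And>t. t \<in> F \<Longrightarrow> 0 < r t \<and> 3 * r t \<le> \<rho> t"
    and tail: "\<And>t. t \<in> F \<Longrightarrow> (\<Sum>s\<in>{s\<in>F. t < s}. r s) \<le> r t"
    and big: "L \<le> (\<Sum>t\<in>F. 2 * r t * card (H t))"
  shows "L / 37 \<le> measure lebesgue (\<Union>t\<in>F. thicken (H t) (r t))"
proof -
  define e where "e = (\<lambda>t. 2 * r t * card (H t))"
  define S where "S = (\<Sum>t\<in>F. e t)"
  have rp: "0 < r t" "2 * r t < \<rho> t" "2 * r t \<le> \<rho> t" if "t \<in> F" for t using r[OF that] by auto
  have e0: "0 \<le> e t" if "t \<in> F" for t using rp[OF that] by (simp add: e_def)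
  have me: "measure lebesgue (thicken (H t) (r t)) = e t" if "t \<in> F" for t
    unfolding e_def by (rule measure_thicken[OF H[OF that] sep[OF that]]) (use rp[OF that] in auto)
  have SL: "L \<le> S" using big by (simp add: S_def e_def)
  define m where "m = (\<lambda>s t. measure lebesgue (thicken (H s) (r s) \<inter> thicken (H t) (r t)))"
  define b where "b = (\<lambda>s t. if s < t then 16 * e s * e t / L + 4 * card (H s) * r t else 0)"
  have m_less: "m s t \<le> b s t" if st: "s \<in> F" "t \<in> F" "s < t" for s t
  proof -
    have "m s t \<le> card (H s) * (2 * r t * (2 * r s / \<rho> t + 2))"
      unfolding m_def by (rule measure_thicken_Int_le[OF H[OF st(1)] H[OF st(2)] sep[OF st(2)]]) (use rp st in auto)
    also have "\<dots> = e s * (2 * r t / \<rho> t) + 4 * card (H s) * r t" by (simp add: e_def algebra_simps)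
    also have "e s * (2 * r t / \<rho> t) \<le> e s * (16 * e t / L)"
    \<comment> \<open>The hypothesis \<open>many\<close> enters: up to the factor 16, the local
      density \<open>2 * r t / \<rho> t\<close> is the global density
      \<open>e t / L\<close>.\<close>
    proof (rule mult_left_mono)
      have "L * (2 * r t) \<le> 16 * \<rho> t * card (H t) * (2 * r t)"
        using many[OF st(2)] rp[OF st(2)] by (intro mult_right_mono) auto
      then show "2 * r t / \<rho> t \<le> 16 * e t / L" using rp[OF st(2)] L by (simp add: e_def field_simps)
    qed (use e0 st in auto)
    finally show ?thesis using st by (simp add: b_def mult.assoc mult.left_commute)
  qed
  have b0: "0 \<le> b s t" if "s \<in> F" "t \<in> F" for s t
    using e0[OF that(1)] e0[OF that(2)] less_imp_le[OF rp(1)[OF that(2)]] L by (simp add: b_def)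
  have m_le: "m s t \<le> (if s = t then e t else 0) + b s t + b t s" if st: "s \<in> F" "t \<in> F" for s t
  proof (cases s t rule: linorder_cases)
    case less
    then show ?thesis using m_less[OF st less] b0[OF st(2,1)] by simp
  next
    case equal
    then show ?thesis using b0[OF st] b0[OF st(2,1)] me[OF st(2)] by (simp add: m_def)
  next
    case greater
    then show ?thesis using m_less[OF st(2,1) greater] b0[OF st] by (simp add: m_def Int_commute)
  qed
  have sb: "(\<Sum>s\<in>F. \<Sum>t\<in>F. b s t) \<le> 16 * S\<^sup>2 / L + 2 * S"
  proof -
    have "(\<Sum>t\<in>F. b s t) \<le> 16 * e s * S / L + 2 * e s" if s: "s \<in> F" for s
    proof -
      have "(\<Sum>t\<in>F. b s t) \<le> (\<Sum>t\<in>F. 16 * e s * e t / L + (if s < t then 4 * card (H s) * r t else 0))"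
        using e0 s L by (intro sum_mono) (auto simp: b_def)
      also have "\<dots> = 16 * e s * S / L + 4 * card (H s) * (\<Sum>t\<in>{t\<in>F. s < t}. r t)"
        unfolding S_def using F
        by (simp add: sum.distrib sum_distrib_left sum_divide_distrib sum.inter_filter[symmetric])
      also have "\<dots> \<le> 16 * e s * S / L + 4 * card (H s) * r s"
        using tail[OF s] by (intro add_left_mono mult_left_mono) auto
      finally show ?thesis by (simp add: e_def mult_ac)
    qed
    then have "(\<Sum>s\<in>F. \<Sum>t\<in>F. b s t) \<le> (\<Sum>s\<in>F. 16 * e s * S / L + 2 * e s)" by (rule sum_mono)
    also have "\<dots> = 16 * S\<^sup>2 / L + 2 * S"
      by (simp add: S_def sum.distrib sum_distrib_left sum_divide_distrib sum_distrib_right power2_eq_square mult_ac)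
    finally show ?thesis .
  qed
  have "(\<Sum>s\<in>F. \<Sum>t\<in>F. m s t) \<le> (\<Sum>s\<in>F. \<Sum>t\<in>F. (if s = t then e t else 0) + b s t + b t s)"
    using m_le by (intro sum_mono) auto
  also have "\<dots> = S + (\<Sum>s\<in>F. \<Sum>t\<in>F. b s t) + (\<Sum>s\<in>F. \<Sum>t\<in>F. b t s)"
    using F by (simp add: sum.distrib S_def)
  also have "(\<Sum>s\<in>F. \<Sum>t\<in>F. b t s) = (\<Sum>s\<in>F. \<Sum>t\<in>F. b s t)" by (rule sum.swap)
  also have "S + (\<Sum>s\<in>F. \<Sum>t\<in>F. b s t) + (\<Sum>s\<in>F. \<Sum>t\<in>F. b s t) \<le> 32 * S\<^sup>2 / L + 5 * S" using sb by simp
  also have "\<dots> \<le> 37 / L * S\<^sup>2"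
  proof -
    have "S * L \<le> S * S" using SL L by (intro mult_left_mono) auto
    then show ?thesis using L by (simp add: field_simps power2_eq_square)
  qed
  finally have pairs: "(\<Sum>s\<in>F. \<Sum>t\<in>F. m s t) \<le> 37 / L * S\<^sup>2" .
  have "1 / (37 / L) \<le> measure lebesgue (\<Union>t\<in>F. thicken (H t) (r t))"
  proof (rule measure_UN_ge_second_moment[OF F])
    show "S = (\<Sum>i\<in>F. measure lebesgue (thicken (H i) (r i)))" using me by (simp add: S_def)
    show "(\<Sum>i\<in>F. \<Sum>j\<in>F. measure lebesgue (thicken (H i) (r i) \<inter> thicken (H j) (r j))) \<le> 37 / L * S\<^sup>2"
      using pairs by (simp add: m_def)
  qed (use H lmeasurable_thicken SL L in auto)
  then show ?thesis by simp
qed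

section \<open>From a fixed proportion of every interval to full measure\<close>

text \<open>A direct substitute for Lebesgue density points: the complement, of measure
  \<open>\<mu>\<close>, is covered by nonoverlapping intervals of total length at most
  \<open>\<mu> + e\<close>, and it occupies at most the proportion \<open>1 - \<kappa>\<close> of
  each. Thus \<open>\<mu>\<close> is at most about \<open>(1 - \<kappa>) * (\<mu> + e)\<close>,
  which for small \<open>e\<close> is impossible unless \<open>\<mu> = 0\<close>.\<close>

lemma negligible_of_local_lower_bound:
  fixes A B :: real
  assumes \<kappa>: "0 < \<kappa>" and W: "W \<in> sets lebesgue"
    and lower: "\<And>\<alpha> L. 0 < L \<Longrightarrow> {\<alpha>..\<alpha>+L} \<subseteq> {A..B} \<Longrightarrow>
      \<exists>E\<in>lmeasurable. E \<subseteq> W \<inter> {\<alpha>..\<alpha>+L} \<and> \<kappa> * L \<le> measure lebesgue E"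
  shows "negligible ({A..B} - W)"
proof -
  define S where "S = {A..B} - W"
  define \<mu> where "\<mu> = measure lebesgue S"
  have S: "S \<in> lmeasurable" unfolding S_def using W by (intro fmeasurable_Diff) auto
  \<comment> \<open>The second alternative takes care of covers all of whose intervals are single
    points.\<close>
  have bound: "\<mu> - e < (1 - \<kappa>) * (\<mu> + e) \<or> \<mu> \<le> e" if e: "0 < e" for e
  proof -
    have "S \<subseteq> cbox A B" by (auto simp: S_def)
    then obtain \<D> where D: "countable \<D>"
        "\<And>K. K \<in> \<D> \<Longrightarrow> K \<subseteq> cbox A B \<and> K \<noteq> {} \<and> (\<exists>c d. K = cbox c d)"
        "pairwise (\<lambda>A B. interior A \<inter> interior B = {}) \<D>"
        "S \<subseteq> \<Union>\<D>" "\<Union>\<D> \<in> lmeasurable" "measure lebesgue (\<Union>\<D>) \<le> measure lebesgue S + e"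
      using measurable_outer_intervals_bounded[OF S _ e] by metis
    have K: "K \<in> lmeasurable" "measure lebesgue (S \<inter> K) \<le> (1 - \<kappa>) * measure lebesgue K" if K: "K \<in> \<D>" for K
    proof -
      obtain c d where cd: "K = {c..d}" "c \<le> d" "{c..d} \<subseteq> {A..B}" using D(2)[OF K] by auto
      show Km: "K \<in> lmeasurable" using cd by simp
      show "measure lebesgue (S \<inter> K) \<le> (1 - \<kappa>) * measure lebesgue K"
      proof (cases "c = d")
        case True
        have "measure lebesgue (S \<inter> K) \<le> measure lebesgue K"
          using S Km by (intro measure_mono_fmeasurable) auto
        then show ?thesis using True cd by simp
      next
        case False
        then obtain E where E: "E \<in> lmeasurable" "E \<subseteq> W \<inter> {c..c + (d - c)}" "\<kappa> * (d - c) \<le> measure lebesgue E"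
          using lower[of "d - c" c] cd by auto
        have "measure lebesgue (S \<inter> K) \<le> measure lebesgue (K - E)"
          using S Km E by (intro measure_mono_fmeasurable) (auto simp: S_def)
        also have "\<dots> = measure lebesgue K - measure lebesgue E"
          using E Km cd by (intro measurable_measure_Diff) (auto simp: fmeasurableD)
        finally show ?thesis using E(3) cd by (simp add: algebra_simps)
      qed
    qed
    have \<kappa>1: "0 \<le> 1 - \<kappa>" if "K \<in> \<D>" "0 < measure lebesgue K" for K
    proof -
      have "0 \<le> (1 - \<kappa>) * measure lebesgue K" using K(2)[OF that(1)] measure_nonneg order_trans by blast
      then show ?thesis using that(2) by (simp add: zero_le_mult_iff)
    qed
    show ?thesis
    proof (cases "\<exists>K\<in>\<D>. 0 < measure lebesgue K")
      case False
      have "negligible (\<Union>\<D>)"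
        using D(1) K(1) False by (intro negligible_countable_Union) (auto simp: negligible_iff_measure not_less measure_le_0_iff)
      then have "negligible S" using D(4) negligible_subset by blast
      then show ?thesis using e by (simp add: \<mu>_def negligible_imp_measure0)
    next
      case True
      then have k1: "0 \<le> 1 - \<kappa>" using \<kappa>1 by blast
      have fin: "measure lebesgue (\<Union>\<D>') \<le> (1 - \<kappa>) * (\<mu> + e)"
        if D': "\<D>' \<subseteq> (\<inter>) S ` \<D>" "finite \<D>'" for \<D>'
      proof -
        obtain \<F> where F: "\<F> \<subseteq> \<D>" "finite \<F>" "\<D>' = (\<inter>) S ` \<F>"
          using finite_subset_image[OF D'(2,1)] by blast
        have "\<Union>\<D>' = (\<Union>K\<in>\<F>. S \<inter> K)" using F by auto
        then have "measure lebesgue (\<Union>\<D>') \<le> (\<Sum>K\<in>\<F>. measure lebesgue (S \<inter> K))"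
          using F S K(1) by (auto intro!: measure_UNION_le simp del: Int_UN_distrib2 UN_simps)
        also have "\<dots> \<le> (\<Sum>K\<in>\<F>. (1 - \<kappa>) * measure lebesgue K)" using F K(2) by (intro sum_mono) auto
        also have "\<dots> = (1 - \<kappa>) * (\<Sum>K\<in>\<F>. measure lebesgue K)" by (simp add: sum_distrib_left)
        also have "(\<Sum>K\<in>\<F>. measure lebesgue K) = measure lebesgue (\<Union>\<F>)"
        proof (rule measure_negligible_finite_Union[symmetric])
          show "pairwise (\<lambda>S T. negligible (S \<inter> T)) \<F>"
          proof (rule pairwiseI)
            fix K K' assume KK: "K \<in> \<F>" "K' \<in> \<F>" "K \<noteq> K'"
            then have i: "interior K \<inter> interior K' = {}" using D(3) F(1) by (auto simp: pairwise_def)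
            obtain c d c' d' where cd: "K = cbox c d" "K' = cbox c' d'" using D(2) F(1) KK by (metis subsetD)
            have "interior (K \<inter> K') = {}" using i by simp
            moreover have "convex (K \<inter> K')" using cd by (auto intro: convex_Int)
            ultimately show "negligible (K \<inter> K')" by (simp add: negligible_convex_interior)
          qed
        qed (use F K in auto)
        also have "\<dots> \<le> \<mu> + e"
        proof -
          have "measure lebesgue (\<Union>\<F>) \<le> measure lebesgue (\<Union>\<D>)"
            using F K(1) D(5) by (intro measure_mono_fmeasurable) (auto intro!: fmeasurableD fmeasurable.finite_Union)
          then show ?thesis using D(6) by (simp add: \<mu>_def)
        qed
        finally show ?thesis using k1 by (simp add: mult_left_mono)
      qed
      have c: "countable ((\<inter>) S ` \<D>)" using D(1) by simp
      have m: "X \<in> lmeasurable" if "X \<in> (\<inter>) S ` \<D>" for X using that S K(1) by auto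
      obtain \<D>' where D': "\<D>' \<subseteq> (\<inter>) S ` \<D>" "finite \<D>'"
          "measure lebesgue (\<Union>((\<inter>) S ` \<D>)) - e < measure lebesgue (\<Union>\<D>')"
        using measure_countable_Union_approachable[OF c e m fin] by blast
      have "\<Union>((\<inter>) S ` \<D>) = S" using D(4) by auto
      then have "\<mu> - e < (1 - \<kappa>) * (\<mu> + e)" using D'(3) fin[OF D'(1,2)] by (simp add: \<mu>_def)
      then show ?thesis ..
    qed
  qed
  have "\<kappa> * \<mu> \<le> 0"
  proof (rule ccontr)
    assume "\<not> ?thesis"
    then have m: "0 < \<mu>" "0 < \<kappa> * \<mu>" using \<kappa> by (auto simp: not_le zero_less_mult_iff)
    \<comment> \<open>\<open>e < \<mu>\<close> rules out the second alternative of
      \<open>bound\<close>; the first one would give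
      \<open>\<kappa> * \<mu> + \<kappa> * e < 2 * e\<close>, against
      \<open>2 * e \<le> \<kappa> * \<mu>\<close>.\<close>
    define e where "e = min (\<mu> / 2) (\<kappa> * \<mu> / 2)"
    have "0 < e" "e < \<mu>" "e \<le> \<kappa> * \<mu> / 2" using m by (auto simp: e_def)
    moreover have "0 < \<kappa> * e" using calculation \<kappa> by simp
    moreover have "\<mu> - e < (1 - \<kappa>) * (\<mu> + e)" using bound[of e] calculation by auto
    ultimately show False by (simp add: algebra_simps)
  qed
  then have "\<mu> = 0" using \<kappa> measure_nonneg[of lebesgue S] by (auto simp: \<mu>_def mult_le_0_iff)
  then show ?thesis using S unfolding S_def[symmetric] \<mu>_def by (simp add: negligible_iff_measure)
qed

lemma dist_nearest_int_le: "dist_nearest_int x \<le> \<bar>x - real_of_int m\<bar>"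
  unfolding dist_nearest_int_def using infdist_le[of "real_of_int m" \<int> x] by (simp add: dist_real_def)

lemma continuous_on_dist_nearest_int: "continuous_on S g \<Longrightarrow> continuous_on S (\<lambda>x. dist_nearest_int (g x))"
  unfolding dist_nearest_int_def by (rule continuous_on_infdist)

lemma sum_geometric_tail_le:
  fixes F :: "nat set"
  assumes "finite F"
  shows "(\<Sum>s\<in>{s\<in>F. t < s}. 1 / 2 ^ s) \<le> (1 / 2 ^ t :: real)"
proof -
  have e: "(\<Sum>s\<in>{t<..t+m}. 1 / 2 ^ s) = 1 / 2 ^ t - (1 / 2 ^ (t + m) :: real)" for m
  proof (induction m)
    case (Suc m)
    have i: "{t<..t + Suc m} = insert (t + Suc m) {t<..t+m}" by auto
    have a: "(\<Sum>s\<in>insert (t + Suc m) {t<..t+m}. 1 / 2 ^ s) = 1 / 2 ^ (t + Suc m) + (\<Sum>s\<in>{t<..t+m}. 1 / 2 ^ s :: real)"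
      by (rule sum.insert) auto
    have b: "1 / 2 ^ (t + Suc m) = (1 / 2 ^ (t + m)) / (2::real)" by simp
    have c: "x / 2 + (y - x) = y - x / 2" for x y :: real by simp
    show ?case unfolding i a b Suc by (rule c)
  qed simp
  obtain m where "F \<subseteq> {..m}" using assms by (meson finite_nat_iff_bounded_le)
  then have "(\<Sum>s\<in>{s\<in>F. t < s}. 1 / 2 ^ s) \<le> (\<Sum>s\<in>{t<..t+m}. 1 / 2 ^ s :: real)"
    by (intro sum_mono2) auto
  then show ?thesis unfolding e by (smt (verit) divide_pos_pos zero_less_power)
qed

lemma approximating_functionD:
  assumes "approximating_function \<psi>"
  shows "0 < x \<Longrightarrow> 0 < \<psi> x" "0 < x \<Longrightarrow> x \<le> y \<Longrightarrow> \<psi> y \<le> \<psi> x"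
  using assms by (auto simp: approximating_function_def monotone_on_def)

section \<open>Approximable points on a convex graph\<close>

context convex_graph
begin

text \<open>Infinitely many denominators are expressed by arbitrarily large ones: the approximable
  points are the intersection of these sets over all \<open>n0\<close>.\<close>

definition approx_pts :: "(real \<Rightarrow> real) \<Rightarrow> (real \<Rightarrow> real) \<Rightarrow> nat \<Rightarrow> real set" where
  "approx_pts \<psi>1 \<psi>2 n0 = {x\<in>{A..B}. \<exists>q::nat. n0 \<le> q \<and> 1 \<le> q \<and>
     dist_nearest_int (q * x) < \<psi>1 q \<and> dist_nearest_int (q * f x) < \<psi>2 q}"

text \<open>At the scale \<open>2 ^ t\<close>, good fractions with tolerance \<open>2 / den \<psi> t\<close> (at most \<open>\<psi> (2 ^ t) / 2\<close>) are
  found within distance \<open>gap \<psi> t\<close> of most points.\<close>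

definition den :: "(real \<Rightarrow> real) \<Rightarrow> nat \<Rightarrow> nat" where
  "den \<psi> t = nat \<lceil>max (4 / \<psi> (2 ^ t)) (1 / eps)\<rceil>"

definition gap :: "(real \<Rightarrow> real) \<Rightarrow> nat \<Rightarrow> real" where
  "gap \<psi> t = 2 * real (den \<psi> t) / (qfrac * (2 ^ t)\<^sup>2)"

text \<open>\<open>den \<psi> t\<close> is comparable to \<open>1 / \<psi> (2 ^ t)\<close>: in the
  upper bound, the additive constants are absorbed by means of
  \<open>\<psi> (2 ^ t) \<le> \<psi> 1\<close>.\<close>

lemma den_bounds:
  assumes \<psi>: "approximating_function \<psi>"
  shows "4 / \<psi> (2 ^ t) \<le> den \<psi> t" "1 / eps \<le> den \<psi> t"
    "den \<psi> t \<le> (4 + (1 / eps + 1) * \<psi> 1) / \<psi> (2 ^ t)" "0 < real (den \<psi> t)"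
proof -
  have p: "0 < \<psi> (2 ^ t)" "\<psi> (2 ^ t) \<le> \<psi> 1" using approximating_functionD[OF \<psi>] by auto
  have e: "0 < 1 / eps" using eps by simp
  define m where "m = max (4 / \<psi> (2 ^ t)) (1 / eps)"
  have m: "0 < m" "m \<le> 4 / \<psi> (2 ^ t) + 1 / eps" using e p by (auto simp: m_def less_max_iff_disj)
  have d: "real (den \<psi> t) = of_int \<lceil>m\<rceil>" using m by (simp add: den_def m_def)
  show "4 / \<psi> (2 ^ t) \<le> den \<psi> t" "1 / eps \<le> den \<psi> t"
  proof -
    have "4 / \<psi> (2 ^ t) \<le> m" "1 / eps \<le> m" by (auto simp: m_def)
    then show "4 / \<psi> (2 ^ t) \<le> den \<psi> t" "1 / eps \<le> den \<psi> t"
      unfolding d using le_of_int_ceiling[of m] by (auto intro: order_trans)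
  qed
  then show "0 < real (den \<psi> t)" using e by linarith
  have "real (den \<psi> t) \<le> m + 1" unfolding d by (rule of_int_ceiling_le_add_one)
  also have "\<dots> \<le> 4 / \<psi> (2 ^ t) + (1 / eps + 1) * 1" using m(2) by simp
  also have "\<dots> \<le> 4 / \<psi> (2 ^ t) + (1 / eps + 1) * (\<psi> 1 / \<psi> (2 ^ t))"
    using p e by (intro add_left_mono mult_left_mono) auto
  also have "\<dots> = (4 + (1 / eps + 1) * \<psi> 1) / \<psi> (2 ^ t)" by (simp add: add_divide_distrib)
  finally show "den \<psi> t \<le> (4 + (1 / eps + 1) * \<psi> 1) / \<psi> (2 ^ t)" .
qed

lemma gap_pos: "approximating_function \<psi> \<Longrightarrow> 0 < gap \<psi> t"
  using den_bounds(4)[of \<psi> t] qfrac by (simp add: gap_def)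

lemma bounded_f1: "\<exists>M\<ge>0. \<forall>x\<in>{A..B}. \<bar>f1 x\<bar> \<le> M"
proof (intro exI conjI ballI)
  have c2: "0 \<le> c2" using c1 c12 by simp
  then show "0 \<le> \<bar>f1 A\<bar> + c2 * (B - A)" using AB by simp
  fix x assume x: "x \<in> {A..B}"
  have "\<bar>f1 x - f1 A\<bar> \<le> c2 * \<bar>x - A\<bar>" using f1_bilipschitz(2)[OF x, of A] AB by auto
  also have "\<dots> \<le> c2 * (B - A)" using x c2 by (intro mult_left_mono) auto
  finally show "\<bar>f1 x\<bar> \<le> \<bar>f1 A\<bar> + c2 * (B - A)" by linarith
qed

lemma f_lipschitz:
  assumes M: "\<And>x. x \<in> {A..B} \<Longrightarrow> \<bar>f1 x\<bar> \<le> M" and "x \<in> {A..B}" "z \<in> {A..B}"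
  shows "\<bar>f x - f z\<bar> \<le> M * \<bar>x - z\<bar>"
proof -
  have *: "\<bar>f v - f u\<bar> \<le> M * \<bar>v - u\<bar>" if uv: "u \<in> {A..B}" "v \<in> {A..B}" "u < v" for u v
  proof -
    have "\<exists>w. u < w \<and> w < v \<and> f v - f u = (v - u) * f1 w" using uv by (intro MVT2 f1) auto
    then obtain w where w: "u < w" "w < v" "f v - f u = (v - u) * f1 w" by blast
    then have "\<bar>f1 w\<bar> \<le> M" using uv by (intro M) auto
    then show ?thesis unfolding w(3) using uv by (simp add: abs_mult mult.commute mult_right_mono)
  qed
  show ?thesis
    using *[of x z] *[of z x] assms(2,3) by (cases x z rule: linorder_cases) (auto simp: abs_minus_commute)
qed

text \<open>The error budget: moving from \<open>p / q\<close> to \<open>x\<close> changes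
  \<open>q x\<close> by at most \<open>w\<close> and \<open>q f\<close> by at most
  \<open>M * w\<close>, where \<open>w + M * w = \<psi>1 (2 ^ t) / 4\<close>. The fraction itself
  contributes at most \<open>\<psi>2 (2 ^ t) / 2\<close> in the second coordinate, and
  \<open>\<psi>1 \<le> \<psi>2\<close> at this scale keeps the total below
  \<open>\<psi>2 (2 ^ t)\<close>. Since \<open>q \<le> 2 ^ t\<close>, both functions are at least as
  large at \<open>q\<close>.\<close>

lemma good_fraction_approx:
  assumes \<psi>1: "approximating_function \<psi>1" and \<psi>2: "approximating_function \<psi>2"
    and M: "0 \<le> M" "\<And>x. x \<in> {A..B} \<Longrightarrow> \<bar>f1 x\<bar> \<le> M"
    and le: "\<psi>1 (2 ^ t) \<le> \<psi>2 (2 ^ t)" and n0: "real n0 \<le> qfrac * 2 ^ t"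
    and good: "good_fraction (2 ^ t) (den \<psi>2 t) q p" and z: "p / q \<in> {A..B}"
    and x: "x \<in> {A..B}" "\<bar>x - p / q\<bar> \<le> \<psi>1 (2 ^ t) / (4 * (1 + M)) / 2 ^ t"
  shows "x \<in> approx_pts \<psi>1 \<psi>2 n0"
proof -
  obtain r :: int where q: "qfrac * 2 ^ t \<le> q" "q \<le> (2::int) ^ t" and r: "\<bar>q * f (p / q) - r\<bar> \<le> 2 / den \<psi>2 t"
    using good unfolding good_fraction_def by auto
  have q0: "0 < real_of_int q" using q(1) qfrac by (smt (verit) mult_pos_pos zero_less_power)
  have qle: "real_of_int q \<le> 2 ^ t" using q(2) by (metis of_int_le_iff of_int_numeral of_int_power)
  have p1: "0 < \<psi>1 (2 ^ t)" "0 < \<psi>2 (2 ^ t)" using approximating_functionD[OF \<psi>1] approximating_functionD[OF \<psi>2] by auto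
  have mono: "\<psi>1 (2 ^ t) \<le> \<psi>1 q" "\<psi>2 (2 ^ t) \<le> \<psi>2 q"
    using approximating_functionD(2)[OF \<psi>1 q0 qle] approximating_functionD(2)[OF \<psi>2 q0 qle] by auto
  have dx: "q * \<bar>x - p / q\<bar> \<le> \<psi>1 (2 ^ t) / (4 * (1 + M))"
  proof -
    have "q * \<bar>x - p / q\<bar> \<le> 2 ^ t * (\<psi>1 (2 ^ t) / (4 * (1 + M)) / 2 ^ t)"
      using x(2) qle q0 by (intro mult_mono) auto
    then show ?thesis by simp
  qed
  define w where "w = \<psi>1 (2 ^ t) / (4 * (1 + M))"
  have "(1 + M) * w = \<psi>1 (2 ^ t) / 4" using M(1) by (simp add: w_def field_simps)
  then have small: "w + M * w = \<psi>1 (2 ^ t) / 4" by (simp add: distrib_right)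
  have w0: "0 \<le> w" using p1 M(1) by (simp add: w_def)
  have Mw: "0 \<le> M * w" using M(1) w0 by simp
  have i: "int (nat q) = q" "real (nat q) = q" using q0 by auto
  have "dist_nearest_int (nat q * x) \<le> \<bar>q * x - p\<bar>" using dist_nearest_int_le[of "nat q * x" p] i by simp
  also have "\<dots> = q * \<bar>x - p / q\<bar>"
  proof -
    have "q * x - p = q * (x - p / q)" using q0 by (simp add: field_simps)
    then show ?thesis using q0 by (simp add: abs_mult)
  qed
  also have "\<dots> \<le> \<psi>1 (2 ^ t) / 4" using dx[folded w_def] small Mw by linarith
  also have "\<dots> < \<psi>1 (nat q)" using mono(1) p1 i by simp
  finally have 1: "dist_nearest_int (nat q * x) < \<psi>1 (nat q)" .
  have "dist_nearest_int (nat q * f x) \<le> \<bar>q * f x - r\<bar>" using dist_nearest_int_le[of "nat q * f x" r] i by simp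
  also have "\<dots> \<le> \<bar>q * f (p / q) - r\<bar> + \<bar>q * (f x - f (p / q))\<bar>"
  proof -
    have "q * f x - r = (q * f (p / q) - r) + q * (f x - f (p / q))" by (simp add: algebra_simps)
    then show ?thesis by linarith
  qed
  also have "\<bar>q * (f x - f (p / q))\<bar> \<le> M * (q * \<bar>x - p / q\<bar>)"
    using mult_left_mono[OF f_lipschitz[OF M(2) x(1) z], of "real_of_int q"] q0 by (simp add: abs_mult mult_ac)
  also have "M * (q * \<bar>x - p / q\<bar>) \<le> M * w" using dx[folded w_def] M(1) by (rule mult_left_mono)
  also have "\<dots> \<le> \<psi>1 (2 ^ t) / 4" using small w0 by linarith
  also have "\<bar>q * f (p / q) - r\<bar> \<le> \<psi>2 (2 ^ t) / 2"
  proof -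
    have "4 \<le> den \<psi>2 t * \<psi>2 (2 ^ t)" using den_bounds(1)[OF \<psi>2, of t] p1 by (simp add: pos_divide_le_eq)
    then have "2 / den \<psi>2 t \<le> \<psi>2 (2 ^ t) / 2" using den_bounds(4)[OF \<psi>2, of t] by (simp add: field_simps)
    then show ?thesis using r by linarith
  qed
  finally have "dist_nearest_int (nat q * f x) \<le> \<psi>2 (2 ^ t) / 2 + \<psi>1 (2 ^ t) / 4" by simp
  also have "\<dots> < \<psi>2 (nat q)" using le mono(2) p1 i by simp
  finally have 2: "dist_nearest_int (nat q * f x) < \<psi>2 (nat q)" .
  have "real n0 \<le> real (nat q)" using n0 q(1) i by linarith
  then show ?thesis unfolding approx_pts_def using 1 2 x q0 by (auto intro!: exI[of _ "nat q"])
qed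

lemma finite_good_fractions: "finite {z\<in>{A..B}. \<exists>q p. good_fraction N n q p \<and> 0 < q \<and> z = p / q}"
proof -
  define P where "P = \<lceil>N * (\<bar>A\<bar> + \<bar>B\<bar>)\<rceil>"
  have "{z\<in>{A..B}. \<exists>q p. good_fraction N n q p \<and> 0 < q \<and> z = p / q} \<subseteq> (\<lambda>(q, p). real_of_int p / real_of_int q) ` ({0..int N} \<times> {-P..P})"
  proof clarify
    fix q p :: int assume z: "p / q \<in> {A..B}" and g: "good_fraction N n q p" and q: "0 < q"
    have qN: "q \<le> int N" using g by (auto simp: good_fraction_def)
    have "\<bar>real_of_int p\<bar> = q * \<bar>p / q\<bar>" using q by simp
    also have "\<dots> \<le> N * (\<bar>A\<bar> + \<bar>B\<bar>)" using z qN q by (intro mult_mono) auto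
    finally have "\<bar>real_of_int p\<bar> \<le> of_int P" unfolding P_def by linarith
    then have "p \<in> {-P..P}" by (simp add: abs_le_iff)
    then show "p / q \<in> (\<lambda>(q, p). real_of_int p / real_of_int q) ` ({0..int N} \<times> {-P..P})"
      using q qN by (intro image_eqI[of _ _ "(q, p)"]) auto
  qed
  then show ?thesis by (rule finite_subset) simp
qed

text \<open>The set \<open>H\<close> collects good fractions that are separated at distance
  \<open>gap\<close>, numerous enough that intervals of length \<open>gap\<close> about them would
  have total length comparable to \<open>L\<close>, and each surrounded by approximable
  points.\<close>

lemma ubiquitous_system:
  assumes \<psi>1: "approximating_function \<psi>1" and \<psi>2: "approximating_function \<psi>2"
    and M: "0 \<le> M" "\<And>x. x \<in> {A..B} \<Longrightarrow> \<bar>f1 x\<bar> \<le> M"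
    and T: "\<And>t. t \<in> T \<Longrightarrow> \<psi>1 (2 ^ t) \<le> \<psi>2 (2 ^ t) \<and> (3/4) ^ t \<le> 2 ^ t * (\<psi>2 (2 ^ t))\<^sup>2"
    and L: "0 < L" and J: "{\<alpha>..\<alpha>+L} \<subseteq> {A..B}"
  shows "\<exists>t1. \<forall>t\<in>T. t1 \<le> t \<longrightarrow> (\<exists>H. finite H \<and> H \<subseteq> {\<alpha> + gap \<psi>2 t..\<alpha> + L - gap \<psi>2 t} \<and>
     (\<forall>x\<in>H. \<forall>y\<in>H. x \<noteq> y \<longrightarrow> gap \<psi>2 t \<le> \<bar>x - y\<bar>) \<and> L \<le> 16 * gap \<psi>2 t * card H \<and>
     (\<forall>z\<in>H. \<forall>x\<in>{A..B}. \<bar>x - z\<bar> \<le> \<psi>1 (2 ^ t) / (4 * (1 + M)) / 2 ^ t \<longrightarrow> x \<in> approx_pts \<psi>1 \<psi>2 n0))"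
proof -
  obtain K where K: "1 \<le> K" and cover: "\<And>(N::nat) (n::nat). 1 / eps \<le> real n \<Longrightarrow> K * real n \<le> real N \<Longrightarrow>
    outer_le {x\<in>{\<alpha>..<\<alpha>+L}. \<not> (\<exists>q p. \<bar>x - p / q\<bar> < 2 * real n / (qfrac * (real N)\<^sup>2) \<and>
       (p / q \<in> {A..B} \<longrightarrow> good_fraction N n q p))} (L / 2)"
    using good_fractions_cover[OF L J] by blast
  define M0 where "M0 = 4 + (1 / eps + 1) * \<psi>2 1"
  have M0: "0 < M0" unfolding M0_def
    using approximating_functionD(1)[OF \<psi>2, of 1] eps by (intro add_pos_pos mult_pos_pos) auto
  \<comment> \<open>The summands ensure \<open>K * n \<le> 2 ^ t\<close>,
    \<open>16 * \<rho> \<le> L\<close> and \<open>n0 \<le> qfrac * 2 ^ t\<close> for all scales from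
    \<open>t1\<close> on.\<close>
  define X where "X = (K * M0)\<^sup>2 + 32 / (qfrac * L) + n0 / qfrac"
  obtain t1 where t1: "X < (3/2) ^ t1" using real_arch_pow[of "3/2" X] by auto
  show ?thesis
  proof (intro exI[of _ t1] ballI impI)
    fix t assume t: "t \<in> T" "t1 \<le> t"
    have p2: "0 < \<psi>2 (2 ^ t)" using approximating_functionD(1)[OF \<psi>2] by simp
    have "(3/2) ^ t1 \<le> (3/2 :: real) ^ t" using t(2) by (intro power_increasing) auto
    then have X: "X \<le> (3/2) ^ t" using t1 by linarith
    have n: "0 \<le> (K * M0)\<^sup>2" "0 \<le> 32 / (qfrac * L)" "0 \<le> n0 / qfrac" using qfrac L by auto
    have "(3/2) ^ t \<le> (2 :: real) ^ t" by (intro power_mono) auto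
    then have X': "(K * M0)\<^sup>2 \<le> (3/2) ^ t" "32 / (qfrac * L) \<le> 2 ^ t" "n0 / qfrac \<le> 2 ^ t"
      using X n unfolding X_def by linarith+
    \<comment> \<open>The lower bound in \<open>T\<close> makes
      \<open>(2 ^ t * \<psi>2 (2 ^ t))\<^sup>2\<close> grow at least like \<open>(3/2) ^ t\<close>,
      so it overtakes any constant.\<close>
    have "(3/2) ^ t = (2 :: real) ^ t * (3/4) ^ t" by (simp flip: power_mult_distrib)
    also have "\<dots> \<le> 2 ^ t * (2 ^ t * (\<psi>2 (2 ^ t))\<^sup>2)" using T[OF t(1)] by (intro mult_left_mono) auto
    also have "\<dots> = (2 ^ t * \<psi>2 (2 ^ t))\<^sup>2" by (simp add: power2_eq_square)
    finally have "(K * M0)\<^sup>2 \<le> (2 ^ t * \<psi>2 (2 ^ t))\<^sup>2" using X'(1) by linarith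
    then have KM: "K * M0 \<le> 2 ^ t * \<psi>2 (2 ^ t)" by (rule power2_le_imp_le) (use p2 in simp)
    define n where "n = den \<psi>2 t"
    define \<rho> where "\<rho> = gap \<psi>2 t"
    note nb = den_bounds[OF \<psi>2, of t, folded n_def M0_def]
    have Kn: "K * n \<le> 2 ^ t"
    proof -
      have "K * n \<le> K * (M0 / \<psi>2 (2 ^ t))" using nb(3) K by (intro mult_left_mono) auto
      also have "\<dots> \<le> 2 ^ t" using KM p2 by (simp add: field_simps)
      finally show ?thesis .
    qed
    have n1: "real n \<le> 2 ^ t" using mult_right_mono[OF K, of "real n"] Kn by linarith
    have \<rho>0: "0 < \<rho>" unfolding \<rho>_def by (rule gap_pos[OF \<psi>2])
    have \<rho>L: "16 * \<rho> \<le> L"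
    proof -
      have "\<rho> \<le> 2 * 2 ^ t / (qfrac * (2 ^ t)\<^sup>2)"
        unfolding \<rho>_def gap_def n_def[symmetric] using n1 qfrac by (intro divide_right_mono) auto
      also have "\<dots> = 2 / (qfrac * 2 ^ t)" by (simp add: power2_eq_square)
      finally have "16 * \<rho> \<le> 32 / (qfrac * 2 ^ t)" by simp
      also have "\<dots> \<le> L" using X'(2) qfrac L by (simp add: field_simps)
      finally show ?thesis .
    qed
    \<comment> \<open>The distance \<open>\<rho>\<close> from the ends keeps the neighbourhoods of
      radius at most \<open>gap\<close> inside the interval.\<close>
    define S where "S = {z\<in>{A..B}. \<exists>q p. good_fraction (2 ^ t) n q p \<and> 0 < q \<and> z = p / q} \<inter> {\<alpha> + \<rho>..\<alpha> + L - \<rho>}"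
    have "finite S" unfolding S_def using finite_good_fractions by blast
    from maximal_separated_subset[OF this, of \<rho>]
    obtain H where H: "H \<subseteq> S" "\<And>x y. x \<in> H \<Longrightarrow> y \<in> H \<Longrightarrow> x \<noteq> y \<Longrightarrow> \<rho> \<le> \<bar>x - y\<bar>"
      "\<And>x. x \<in> S \<Longrightarrow> \<exists>y\<in>H. \<bar>x - y\<bar> < \<rho> \<or> x = y" by blast
    have fH: "finite H" using H(1) \<open>finite S\<close> by (rule finite_subset)
    define bad where "bad = {x\<in>{\<alpha>..<\<alpha>+L}. \<not> (\<exists>q p. \<bar>x - p / q\<bar> < \<rho> \<and> (p / q \<in> {A..B} \<longrightarrow> good_fraction (2 ^ t) n q p))}"
    have bad: "outer_le bad (L / 2)"
      using cover[of n "2 ^ t"] nb(2) Kn unfolding bad_def \<rho>_def gap_def n_def[symmetric] by simp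
    have qpos: "0 < q" if "good_fraction (2 ^ t) n q p" for q p
    proof -
      have "0 < qfrac * real (2 ^ t)" using qfrac by simp
      moreover have "qfrac * real (2 ^ t) \<le> real_of_int q" using that unfolding good_fraction_def by blast
      ultimately have "0 < real_of_int q" by linarith
      then show ?thesis by simp
    qed
    have sub: "{\<alpha>..<\<alpha>+L} \<subseteq> bad \<union> ({\<alpha>..\<alpha>+2*\<rho>} \<union> ({\<alpha>+L-2*\<rho>..\<alpha>+L} \<union> (\<Union>z\<in>H. {z - 2*\<rho>..z + 2*\<rho>})))"
    proof
      fix x assume x: "x \<in> {\<alpha>..<\<alpha>+L}"
      show "x \<in> bad \<union> ({\<alpha>..\<alpha>+2*\<rho>} \<union> ({\<alpha>+L-2*\<rho>..\<alpha>+L} \<union> (\<Union>z\<in>H. {z - 2*\<rho>..z + 2*\<rho>})))"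
      proof (cases "x \<in> bad \<or> x \<le> \<alpha> + 2*\<rho> \<or> \<alpha> + L - 2*\<rho> \<le> x")
        case False
        then obtain q p where qp: "\<bar>x - p / q\<bar> < \<rho>" "p / q \<in> {A..B} \<longrightarrow> good_fraction (2 ^ t) n q p"
          using x unfolding bad_def by blast
        have z: "p / q \<in> {\<alpha> + \<rho>..\<alpha> + L - \<rho>}" using qp(1) False by auto
        then have "p / q \<in> {A..B}" using J \<rho>0 by auto
        then have "p / q \<in> S" using qp(2) z qpos unfolding S_def by blast
        then obtain y where y: "y \<in> H" "\<bar>p / q - y\<bar> < \<rho> \<or> p / q = y" using H(3) by blast
        then have "x \<in> {y - 2*\<rho>..y + 2*\<rho>}" using qp(1) by auto
        then show ?thesis using y(1) by blast
      qed (use x in auto)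
    qed
    \<comment> \<open>Half of the interval may be exceptional and the two ends take
      \<open>4 * \<rho> \<le> L / 4\<close>. Every other point lies within \<open>2 * \<rho>\<close>
      of \<open>H\<close>, so \<open>4 * \<rho> * card H \<ge> L / 4\<close>, which is the origin of
      the factor 16.\<close>
    have "outer_le {\<alpha>..<\<alpha>+L} (L / 2 + (2 * \<rho> + (2 * \<rho> + 2 * (2 * \<rho>) * card H)))"
    proof (rule outer_le_mono[OF _ sub order_refl])
      have "outer_le {\<alpha>..\<alpha>+2*\<rho>} (2 * \<rho>)" using outer_le_interval[of \<alpha> "\<alpha>+2*\<rho>"] \<rho>0 by simp
      moreover have "outer_le {\<alpha>+L-2*\<rho>..\<alpha>+L} (2 * \<rho>)" using outer_le_interval[of "\<alpha>+L-2*\<rho>" "\<alpha>+L"] \<rho>0 by simp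
      moreover have "outer_le (\<Union>z\<in>H. {z - 2*\<rho>..z + 2*\<rho>}) (2 * (2 * \<rho>) * card H)"
        using outer_le_UN_intervals[OF fH, of "2 * \<rho>"] \<rho>0 by simp
      ultimately show "outer_le (bad \<union> ({\<alpha>..\<alpha>+2*\<rho>} \<union> ({\<alpha>+L-2*\<rho>..\<alpha>+L} \<union> (\<Union>z\<in>H. {z - 2*\<rho>..z + 2*\<rho>}))))
         (L / 2 + (2 * \<rho> + (2 * \<rho> + 2 * (2 * \<rho>) * card H)))"
        using bad \<rho>0 L by (intro outer_le_Un) auto
    qed
    from outer_le_interval_imp[OF this] have "L \<le> L / 2 + (2 * \<rho> + (2 * \<rho> + 2 * (2 * \<rho>) * card H))"
      using L \<rho>0 by simp
    then have many: "L \<le> 16 * \<rho> * card H" using \<rho>L by simp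
    have n0: "real n0 \<le> qfrac * 2 ^ t" using X'(3) qfrac by (simp add: pos_divide_le_eq mult.commute)
    have "x \<in> approx_pts \<psi>1 \<psi>2 n0"
      if z: "z \<in> H" and x: "x \<in> {A..B}" "\<bar>x - z\<bar> \<le> \<psi>1 (2 ^ t) / (4 * (1 + M)) / 2 ^ t" for z x
    proof -
      obtain q p :: int where qp: "good_fraction (2 ^ t) n q p" "z = p / q" "z \<in> {A..B}"
        using z H(1) unfolding S_def by blast
      have le: "\<psi>1 (2 ^ t) \<le> \<psi>2 (2 ^ t)" using T[OF t(1)] by simp
      show ?thesis
        by (rule good_fraction_approx[OF \<psi>1 \<psi>2 M le n0 qp(1)[unfolded n_def]]) (use qp x in auto)
    qed
    then show "\<exists>H. finite H \<and> H \<subseteq> {\<alpha> + gap \<psi>2 t..\<alpha> + L - gap \<psi>2 t} \<and>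
     (\<forall>x\<in>H. \<forall>y\<in>H. x \<noteq> y \<longrightarrow> gap \<psi>2 t \<le> \<bar>x - y\<bar>) \<and> L \<le> 16 * gap \<psi>2 t * card H \<and>
     (\<forall>z\<in>H. \<forall>x\<in>{A..B}. \<bar>x - z\<bar> \<le> \<psi>1 (2 ^ t) / (4 * (1 + M)) / 2 ^ t \<longrightarrow> x \<in> approx_pts \<psi>1 \<psi>2 n0)"
      unfolding \<rho>_def[symmetric] using fH H many unfolding S_def by (intro exI[of _ H]) blast
  qed
qed

text \<open>\<open>a t\<close> is, up to a constant, a lower bound for the ratio of the radius
  \<open>r t\<close> to \<open>gap \<psi>2 t\<close>. If some late scale has
  \<open>a t \<ge> 1\<close>, that scale alone fills a fixed proportion. Otherwise the radii are
  small compared with the gaps, and finitely many scales are combined by the second moment bound.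
  The constant \<open>\<kappa>\<close> is independent of the interval and of
  \<open>n0\<close>.\<close>

lemma local_lower_bound:
  assumes \<psi>1: "approximating_function \<psi>1" and \<psi>2: "approximating_function \<psi>2"
    and T: "\<And>t. t \<in> T \<Longrightarrow> \<psi>1 (2 ^ t) \<le> \<psi>2 (2 ^ t) \<and> (3/4) ^ t \<le> 2 ^ t * (\<psi>2 (2 ^ t))\<^sup>2"
    and div: "\<not> summable (\<lambda>t. if t \<in> T then 2 ^ t * (\<psi>1 (2 ^ t) * \<psi>2 (2 ^ t)) else 0)"
  shows "\<exists>\<kappa>>0. \<forall>\<alpha> L n0. 0 < L \<longrightarrow> {\<alpha>..\<alpha>+L} \<subseteq> {A..B} \<longrightarrow>
     (\<exists>E\<in>lmeasurable. E \<subseteq> approx_pts \<psi>1 \<psi>2 n0 \<inter> {\<alpha>..\<alpha>+L} \<and> \<kappa> * L \<le> measure lebesgue E)"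
proof -
  obtain M where M: "0 \<le> M" "\<And>x. x \<in> {A..B} \<Longrightarrow> \<bar>f1 x\<bar> \<le> M" using bounded_f1 by blast
  define M0 where "M0 = 4 + (1 / eps + 1) * \<psi>2 1"
  have M0: "0 < M0" unfolding M0_def
    using approximating_functionD(1)[OF \<psi>2, of 1] eps by (intro add_pos_pos mult_pos_pos) auto
  define r where "r = (\<lambda>t. \<psi>1 (2 ^ t) / (4 * (1 + M)) / 2 ^ t)"
  define a where "a = (\<lambda>t. 2 ^ t * (\<psi>1 (2 ^ t) * \<psi>2 (2 ^ t)))"
  \<comment> \<open>The constant for which \<open>r t \<ge> g * a t * gap \<psi>2 t\<close>;
    \<open>M0\<close> comes from the upper bound for \<open>den\<close>.\<close>
  define g where "g = qfrac / (8 * (1 + M) * M0)"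
  have g: "0 < g" using qfrac M M0 by (simp add: g_def)
  have p: "0 < \<psi>1 (2 ^ t)" "0 < \<psi>2 (2 ^ t)" for t :: nat
    using approximating_functionD(1)[OF \<psi>1] approximating_functionD(1)[OF \<psi>2] by auto
  have r0: "0 < r t" for t using p M by (simp add: r_def)
  have a0: "0 < a t" for t using p by (simp add: a_def)
  have gp: "0 < gap \<psi>2 t" for t by (rule gap_pos[OF \<psi>2])
  have r_gap: "g * a t * gap \<psi>2 t \<le> r t" for t
  proof -
    have "gap \<psi>2 t \<le> 2 * (M0 / \<psi>2 (2 ^ t)) / (qfrac * (2 ^ t)\<^sup>2)"
      unfolding gap_def M0_def using den_bounds(3)[OF \<psi>2, of t] qfrac by (intro divide_right_mono mult_left_mono) auto
    then have "g * a t * gap \<psi>2 t \<le> g * a t * (2 * (M0 / \<psi>2 (2 ^ t)) / (qfrac * (2 ^ t)\<^sup>2))"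
      using g a0[of t] by (intro mult_left_mono) auto
    also have "\<dots> = r t"
    proof -
      have alg: "c / (8 * N * m) * (Q * (P * R)) * (2 * (m / R) / (c * Q\<^sup>2)) = P / (4 * N) / Q"
        if "0 < c" "0 < N" "0 < m" "0 < Q" "0 < P" "0 < R" for c N m Q P R :: real
        using that by (simp add: field_simps power2_eq_square)
      show ?thesis unfolding g_def a_def r_def by (rule alg) (use M(1) M0 qfrac(1) p[of t] in auto)
    qed
    finally show ?thesis .
  qed
  have gap_ge: "8 / (\<psi>2 (2 ^ t) * (2 ^ t)\<^sup>2) \<le> gap \<psi>2 t" for t
  proof -
    have "8 / (\<psi>2 (2 ^ t) * (2 ^ t)\<^sup>2) = 2 * (4 / \<psi>2 (2 ^ t)) / (2 ^ t)\<^sup>2" by simp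
    also have "\<dots> \<le> 2 * real (den \<psi>2 t) / (2 ^ t)\<^sup>2"
      using den_bounds(1)[OF \<psi>2, of t] by (intro divide_right_mono mult_left_mono) auto
    also have "\<dots> \<le> 2 * real (den \<psi>2 t) / (qfrac * (2 ^ t)\<^sup>2)"
      using qfrac by (intro divide_left_mono) (auto simp: mult_le_cancel_right1)
    finally show ?thesis by (simp add: gap_def)
  qed
  define \<delta> where "\<delta> = min (1/3) g"
  have \<delta>: "0 < \<delta>" "\<delta> \<le> 1/3" "\<delta> \<le> g" using g by (auto simp: \<delta>_def)
  define \<kappa> where "\<kappa> = min (\<delta> / 8) (1 / 37)"
  have \<kappa>: "0 < \<kappa>" using \<delta> by (simp add: \<kappa>_def)
  show ?thesis
  proof (intro exI[of _ \<kappa>] conjI allI impI \<kappa>)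
    fix \<alpha> L :: real and n0 :: nat
    assume L: "0 < L" and J: "{\<alpha>..\<alpha>+L} \<subseteq> {A..B}"
    define P where "P = (\<lambda>t H. finite H \<and> H \<subseteq> {\<alpha> + gap \<psi>2 t..\<alpha> + L - gap \<psi>2 t} \<and>
     (\<forall>x\<in>H. \<forall>y\<in>H. x \<noteq> y \<longrightarrow> gap \<psi>2 t \<le> \<bar>x - y\<bar>) \<and> L \<le> 16 * gap \<psi>2 t * card H \<and>
     (\<forall>z\<in>H. \<forall>x\<in>{A..B}. \<bar>x - z\<bar> \<le> r t \<longrightarrow> x \<in> approx_pts \<psi>1 \<psi>2 n0))"
    obtain t1 where t1: "\<forall>t\<in>T. t1 \<le> t \<longrightarrow> (\<exists>H. P t H)"
      using ubiquitous_system[OF \<psi>1 \<psi>2 M T L J, where ?n0.0 = n0] unfolding r_def P_def by blast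
    then have "\<forall>t\<in>{t\<in>T. t1 \<le> t}. \<exists>H. P t H" by blast
    from bchoice[OF this] obtain H where "\<And>t. t \<in> T \<Longrightarrow> t1 \<le> t \<Longrightarrow> P t (H t)" by blast
    then have H: "finite (H t)" "H t \<subseteq> {\<alpha> + gap \<psi>2 t..\<alpha> + L - gap \<psi>2 t}"
      "\<And>x y. x \<in> H t \<Longrightarrow> y \<in> H t \<Longrightarrow> x \<noteq> y \<Longrightarrow> gap \<psi>2 t \<le> \<bar>x - y\<bar>"
      "L \<le> 16 * gap \<psi>2 t * card (H t)"
      "\<And>z x. z \<in> H t \<Longrightarrow> x \<in> {A..B} \<Longrightarrow> \<bar>x - z\<bar> \<le> r t \<Longrightarrow> x \<in> approx_pts \<psi>1 \<psi>2 n0"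
      if "t \<in> T" "t1 \<le> t" for t
      using that unfolding P_def by blast+
    have sub: "thicken (H t) s \<subseteq> approx_pts \<psi>1 \<psi>2 n0 \<inter> {\<alpha>..\<alpha>+L}"
      if t: "t \<in> T" "t1 \<le> t" and s: "s \<le> r t" "s \<le> gap \<psi>2 t" for t s
    proof
      fix x assume "x \<in> thicken (H t) s"
      then obtain z where z: "z \<in> H t" "\<bar>x - z\<bar> \<le> s" by (auto simp: thicken_def abs_le_iff)
      have "x \<in> {\<alpha>..\<alpha>+L}" using z H(2)[OF t] s by force
      moreover have "x \<in> approx_pts \<psi>1 \<psi>2 n0" using H(5)[OF t z(1)] z(2) s(1) calculation J by force
      ultimately show "x \<in> approx_pts \<psi>1 \<psi>2 n0 \<inter> {\<alpha>..\<alpha>+L}" by blast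
    qed
    show "\<exists>E\<in>lmeasurable. E \<subseteq> approx_pts \<psi>1 \<psi>2 n0 \<inter> {\<alpha>..\<alpha>+L} \<and> \<kappa> * L \<le> measure lebesgue E"
    proof (cases "\<exists>t\<in>T. t1 \<le> t \<and> 1 \<le> a t")
      case True
      then obtain t where t: "t \<in> T" "t1 \<le> t" "1 \<le> a t" by blast
      \<comment> \<open>Here \<open>r t \<ge> g * gap \<psi>2 t\<close>. The radius is cut to at
        most a third of the gap, so that the intervals are disjoint and their lengths add
        up.\<close>
      define s where "s = \<delta> * gap \<psi>2 t"
      have s0: "0 < s" using \<delta> gp[of t] by (simp add: s_def)
      have "g * 1 * gap \<psi>2 t \<le> g * a t * gap \<psi>2 t" using t(3) g gp[of t] by (intro mult_right_mono mult_left_mono) auto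
      moreover have "s \<le> g * gap \<psi>2 t" unfolding s_def using \<delta>(3) gp[of t] by (intro mult_right_mono) auto
      ultimately have sr: "s \<le> r t" using r_gap[of t] by simp
      have "s \<le> 1/3 * gap \<psi>2 t" unfolding s_def using \<delta>(2) gp[of t] by (intro mult_right_mono) auto
      then have sg: "2 * s < gap \<psi>2 t" "s \<le> gap \<psi>2 t" using gp[of t] by auto
      have "measure lebesgue (thicken (H t) s) = 2 * s * card (H t)"
        by (rule measure_thicken[OF H(1) H(3)]) (use t s0 sg in auto)
      also have "\<dots> = \<delta> / 8 * (16 * gap \<psi>2 t * card (H t))" by (simp add: s_def)
      finally have "measure lebesgue (thicken (H t) s) \<ge> \<delta> / 8 * L"
        using mult_left_mono[OF H(4)[OF t(1,2)], of "\<delta> / 8"] \<delta> by simp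
      moreover have "\<kappa> * L \<le> \<delta> / 8 * L" using L by (intro mult_right_mono) (auto simp: \<kappa>_def)
      ultimately have "\<kappa> * L \<le> measure lebesgue (thicken (H t) s)" by linarith
      then show ?thesis using sub[OF t(1,2) sr sg(2)] lmeasurable_thicken[OF H(1)[OF t(1,2)]] by blast
    next
      case False
      define T' where "T' = {t\<in>T. t1 \<le> t}"
      have a1: "a t < 1" if "t \<in> T'" for t using False that by (auto simp: T'_def not_le)
      have r3: "3 * r t \<le> gap \<psi>2 t" if t: "t \<in> T'" for t
      proof -
        have "3 * r t = 3 / (4 * (1 + M)) * a t / (\<psi>2 (2 ^ t) * (2 ^ t)\<^sup>2)"
          using p[of t] M by (simp add: r_def a_def power2_eq_square)
        also have "\<dots> \<le> 8 / (\<psi>2 (2 ^ t) * (2 ^ t)\<^sup>2)"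
        proof (rule divide_right_mono)
          have "3 / (4 * (1 + M)) * a t \<le> 3 / 4 * 1"
            using a1[OF t] a0[of t] M by (intro mult_mono) (auto simp: field_simps)
          then show "3 / (4 * (1 + M)) * a t \<le> 8" by simp
        qed (use p[of t] in simp)
        also have "\<dots> \<le> gap \<psi>2 t" by (rule gap_ge)
        finally show ?thesis .
      qed
      \<comment> \<open>The threshold \<open>8 / g\<close> is what makes the neighbourhoods have
        total measure at least \<open>L\<close>, since the one at scale \<open>t\<close> has measure
        at least \<open>L * g * a t / 8\<close>. Restricting to \<open>t \<ge> t1\<close> removes
        finitely many terms and preserves divergence.\<close>
      have "\<exists>n. 8 / g < (\<Sum>t<n. if t \<in> T' then a t else 0)"
      proof (rule ccontr)
        assume "\<not> ?thesis"
        then have s: "summable (\<lambda>t. if t \<in> T' then a t else 0)"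
          using a0 by (intro summableI_nonneg_bounded[where x = "8 / g"]) (auto simp: not_less less_imp_le)
        have ev: "eventually (\<lambda>t. (if t \<in> T' then a t else 0) = (if t \<in> T then a t else 0)) sequentially"
          using eventually_ge_at_top[of t1] by eventually_elim (auto simp: T'_def)
        from summable_cong[OF ev, THEN iffD1, OF s] show False using div unfolding a_def by simp
      qed
      then obtain n where n: "8 / g < (\<Sum>t<n. if t \<in> T' then a t else 0)" by blast
      define F where "F = {t\<in>T'. t < n}"
      have F: "finite F" "\<And>t. t \<in> F \<Longrightarrow> t \<in> T'" "\<And>t. t \<in> F \<Longrightarrow> t \<in> T \<and> t1 \<le> t" by (auto simp: F_def T'_def)
      have "(\<Sum>t<n. if t \<in> T' then a t else 0) = sum a ({..<n} \<inter> T')" by (simp add: sum.If_cases)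
      also have "{..<n} \<inter> T' = F" by (auto simp: F_def)
      finally have sumF: "8 / g < sum a F" using n by simp
      have "L / 37 \<le> measure lebesgue (\<Union>t\<in>F. thicken (H t) (r t))"
      proof (rule ubiquity_lower_bound[where \<rho> = "gap \<psi>2", OF L F(1)])
        show "0 < r t \<and> 3 * r t \<le> gap \<psi>2 t" if "t \<in> F" for t using r0 r3 F(2)[OF that] by blast
        show "(\<Sum>s\<in>{s\<in>F. t < s}. r s) \<le> r t" if "t \<in> F" for t
        proof -
          have "(\<Sum>s\<in>{s\<in>F. t < s}. r s) \<le> (\<Sum>s\<in>{s\<in>F. t < s}. \<psi>1 (2 ^ t) / (4 * (1 + M)) * (1 / 2 ^ s))"
          proof (rule sum_mono)
            fix s assume "s \<in> {s\<in>F. t < s}"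
            then have "\<psi>1 (2 ^ s) \<le> \<psi>1 (2 ^ t)" by (intro approximating_functionD(2)[OF \<psi>1]) auto
            then have "\<psi>1 (2 ^ s) / (4 * (1 + M)) / 2 ^ s \<le> \<psi>1 (2 ^ t) / (4 * (1 + M)) / 2 ^ s"
              using M by (intro divide_right_mono) auto
            then show "r s \<le> \<psi>1 (2 ^ t) / (4 * (1 + M)) * (1 / 2 ^ s)" by (simp add: r_def)
          qed
          also have "\<dots> = \<psi>1 (2 ^ t) / (4 * (1 + M)) * (\<Sum>s\<in>{s\<in>F. t < s}. 1 / 2 ^ s)" by (simp only: sum_distrib_left)
          also have "\<dots> \<le> \<psi>1 (2 ^ t) / (4 * (1 + M)) * (1 / 2 ^ t)"
            using sum_geometric_tail_le[OF F(1)] p[of t] M by (intro mult_left_mono) auto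
          finally show ?thesis by (simp add: r_def)
        qed
        have "L * g * (8 / g) \<le> L * g * sum a F" using sumF L g by (intro mult_left_mono) auto
        moreover have "L * g * (8 / g) = 8 * L" using g by simp
        moreover have "L * g * sum a F \<le> 8 * (\<Sum>t\<in>F. 2 * r t * card (H t))"
        proof -
          have "L * g * a t \<le> 8 * (2 * r t * card (H t))" if t: "t \<in> F" for t
          proof -
            have "L * (g * a t) \<le> 16 * gap \<psi>2 t * card (H t) * (g * a t)"
              using H(4) F(3)[OF t] g a0[of t] by (intro mult_right_mono) auto
            also have "\<dots> = 16 * (g * a t * gap \<psi>2 t) * card (H t)" by simp
            also have "\<dots> \<le> 16 * r t * card (H t)" using r_gap[of t] by (intro mult_right_mono) auto
            finally show ?thesis by simp
          qed
          then show ?thesis by (simp only: sum_distrib_left) (rule sum_mono)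
        qed
        ultimately show "L \<le> (\<Sum>t\<in>F. 2 * r t * card (H t))" by linarith
      qed (use H F(3) in auto)
      moreover have "\<kappa> * L \<le> L / 37" using L by (simp add: \<kappa>_def min_mult_distrib_right)
      moreover have "(\<Union>t\<in>F. thicken (H t) (r t)) \<in> lmeasurable"
        using F(1,3) H(1) lmeasurable_thicken by (intro fmeasurable.finite_UN) auto
      moreover have "(\<Union>t\<in>F. thicken (H t) (r t)) \<subseteq> approx_pts \<psi>1 \<psi>2 n0 \<inter> {\<alpha>..\<alpha>+L}"
      proof (rule UN_least)
        fix t assume t: "t \<in> F"
        show "thicken (H t) (r t) \<subseteq> approx_pts \<psi>1 \<psi>2 n0 \<inter> {\<alpha>..\<alpha>+L}"
          using sub[of t "r t"] F(3)[OF t] r3[OF F(2)[OF t]] r0[of t] by auto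
      qed
      ultimately show ?thesis by (metis order_trans)
    qed
  qed
qed

end

section \<open>Passage to infinitely many denominators\<close>

context convex_graph
begin

lemma approx_pts_measurable: "approx_pts \<psi>1 \<psi>2 n0 \<in> sets lebesgue"
proof -
  have cf: "continuous_on {A..B} f"
    by (rule DERIV_continuous_on[where D = f1]) (use f1 in \<open>blast intro: has_field_derivative_at_within\<close>)
  define V where "V = (\<lambda>q::nat. {x\<in>{A..B}. dist_nearest_int (q * x) < \<psi>1 q \<and> dist_nearest_int (q * f x) < \<psi>2 q})"
  have "V q \<in> sets lebesgue" for q
  proof -
    define h where "h = (\<lambda>x::real. (dist_nearest_int (q * x), dist_nearest_int (q * f x)))"
    have "continuous_on {A..B} h"
      unfolding h_def by (intro continuous_intros continuous_on_dist_nearest_int cf)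
    then have "openin (top_of_set {A..B}) ({A..B} \<inter> h -` ({..<\<psi>1 q} \<times> {..<\<psi>2 q}))"
      by (rule continuous_openin_preimage_gen) (intro open_Times open_lessThan)
    moreover have "V q = {A..B} \<inter> h -` ({..<\<psi>1 q} \<times> {..<\<psi>2 q})" by (auto simp: V_def h_def)
    ultimately obtain U where "open U" "V q = {A..B} \<inter> U" unfolding openin_open by auto
    then show ?thesis by auto
  qed
  then have "(\<Union>q\<in>{q. n0 \<le> q \<and> 1 \<le> q}. V q) \<in> sets lebesgue"
    by (intro sets.countable_UN' countableI_type) auto
  moreover have "approx_pts \<psi>1 \<psi>2 n0 = (\<Union>q\<in>{q. n0 \<le> q \<and> 1 \<le> q}. V q)"
    by (auto simp: approx_pts_def V_def)
  ultimately show ?thesis by simp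
qed

theorem negligible_graph_nonapproximable:
  assumes \<psi>1: "approximating_function \<psi>1" and \<psi>2: "approximating_function \<psi>2"
    and T: "\<And>t. t \<in> T \<Longrightarrow> \<psi>1 (2 ^ t) \<le> \<psi>2 (2 ^ t) \<and> (3/4) ^ t \<le> 2 ^ t * (\<psi>2 (2 ^ t))\<^sup>2"
    and div: "\<not> summable (\<lambda>t. if t \<in> T then 2 ^ t * (\<psi>1 (2 ^ t) * \<psi>2 (2 ^ t)) else 0)"
  shows "negligible {x\<in>{A..B}. (x, f x) \<notin> simul_approx \<psi>1 \<psi>2}"
proof -
  obtain \<kappa> where \<kappa>: "0 < \<kappa>" "\<And>\<alpha> L n0. 0 < L \<Longrightarrow> {\<alpha>..\<alpha>+L} \<subseteq> {A..B} \<Longrightarrow>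
     (\<exists>E\<in>lmeasurable. E \<subseteq> approx_pts \<psi>1 \<psi>2 n0 \<inter> {\<alpha>..\<alpha>+L} \<and> \<kappa> * L \<le> measure lebesgue E)"
    using local_lower_bound[OF assms] by blast
  have "negligible ({A..B} - approx_pts \<psi>1 \<psi>2 n0)" for n0
    by (rule negligible_of_local_lower_bound[OF \<kappa>(1) approx_pts_measurable \<kappa>(2)])
  then have "negligible (\<Union>n0. {A..B} - approx_pts \<psi>1 \<psi>2 n0)" by (intro negligible_Union_nat) auto
  moreover have "{x\<in>{A..B}. (x, f x) \<notin> simul_approx \<psi>1 \<psi>2} \<subseteq> (\<Union>n0. {A..B} - approx_pts \<psi>1 \<psi>2 n0)"
    by (auto simp: simul_approx_def approx_pts_def infinite_nat_iff_unbounded_le)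
  ultimately show ?thesis by (rule negligible_subset)
qed

end

section \<open>Symmetries of the approximation problem\<close>

lemma dist_nearest_int_minus: "dist_nearest_int (- x) = dist_nearest_int x"
proof -
  have *: "dist_nearest_int (- x) \<le> dist_nearest_int x" for x
  proof -
    have "dist_nearest_int (- x) \<le> dist x a" if a: "a \<in> \<int>" for a
    proof -
      obtain m :: int where "a = of_int m" using a Ints_cases by blast
      then show ?thesis using dist_nearest_int_le[of "- x" "- m"] by (simp add: dist_real_def)
    qed
    moreover have "(\<int> :: real set) \<noteq> {}" by auto
    ultimately show ?thesis unfolding dist_nearest_int_def[of x] infdist_def by (simp add: cINF_greatest)
  qed
  show ?thesis using *[of x] *[of "- x"] by simp
qed

lemma simul_approx_minus: "(x, - y) \<in> simul_approx \<psi>1 \<psi>2 \<longleftrightarrow> (x, y) \<in> simul_approx \<psi>1 \<psi>2"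
  by (simp add: simul_approx_def dist_nearest_int_minus)

lemma simul_approx_swap: "(x, y) \<in> simul_approx \<psi>1 \<psi>2 \<longleftrightarrow> (y, x) \<in> simul_approx \<psi>2 \<psi>1"
  unfolding simul_approx_def by (simp add: conj_commute conj_left_commute)

text \<open>The image of the compact interval under \<open>f2\<close> is a compact interval that
  misses 0, so \<open>f2\<close> has constant sign and is bounded away from 0. A negative sign is
  handled by the reflection \<open>y \<mapsto> - y\<close>, which preserves distances to the
  integers.\<close>

lemma negligible_curved_graph_nonapproximable:
  assumes AB: "A < B"
    and f1: "\<And>x. x \<in> {A..B} \<Longrightarrow> (f has_real_derivative f1 x) (at x)"
    and f2: "\<And>x. x \<in> {A..B} \<Longrightarrow> (f1 has_real_derivative f2 x) (at x)"
    and c: "continuous_on {A..B} f2" and nz: "\<And>x. x \<in> {A..B} \<Longrightarrow> f2 x \<noteq> 0"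
    and \<psi>1: "approximating_function \<psi>1" and \<psi>2: "approximating_function \<psi>2"
    and T: "\<And>t. t \<in> T \<Longrightarrow> \<psi>1 (2 ^ t) \<le> \<psi>2 (2 ^ t) \<and> (3/4) ^ t \<le> 2 ^ t * (\<psi>2 (2 ^ t))\<^sup>2"
    and div: "\<not> summable (\<lambda>t. if t \<in> T then 2 ^ t * (\<psi>1 (2 ^ t) * \<psi>2 (2 ^ t)) else 0)"
  shows "negligible {x\<in>{A..B}. (x, f x) \<notin> simul_approx \<psi>1 \<psi>2}"
proof -
  have "compact (f2 ` {A..B})" "connected (f2 ` {A..B})"
    using c by (auto intro: compact_continuous_image connected_continuous_image)
  then obtain lo hi where img: "f2 ` {A..B} = {lo..hi}"
    using connected_compact_interval_1[of "f2 ` {A..B}"] by auto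
  have b: "lo \<le> f2 x \<and> f2 x \<le> hi" if "x \<in> {A..B}" for x using img that by (metis atLeastAtMost_iff imageI)
  have "lo \<le> hi" using b[of A] AB by auto
  then have "0 \<notin> {lo..hi}" "lo \<in> {lo..hi}" using nz img by (metis imageE, auto)
  then consider "0 < lo" | "hi < 0" by force
  then show ?thesis
  proof cases
    case 1
    interpret convex_graph f f1 f2 A B lo hi by unfold_locales (use AB f1 f2 b 1 in auto)
    show ?thesis by (rule negligible_graph_nonapproximable[OF \<psi>1 \<psi>2 T div])
  next
    case 2
    interpret convex_graph "\<lambda>x. - f x" "\<lambda>x. - f1 x" "\<lambda>x. - f2 x" A B "- hi" "- lo"
      by unfold_locales (use AB b 2 in \<open>auto intro!: DERIV_minus f1 f2\<close>)
    show ?thesis using negligible_graph_nonapproximable[OF \<psi>1 \<psi>2 T div] by (simp add: simul_approx_minus)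
  qed
qed

section \<open>Dyadic form of the divergence condition\<close>

lemma condensed_divergence:
  assumes \<psi>1: "approximating_function \<psi>1" and \<psi>2: "approximating_function \<psi>2"
    and div: "filterlim (\<lambda>N. \<Sum>h=1..N. \<psi>1 (real h) * \<psi>2 (real h)) at_top sequentially"
  shows "\<not> summable (\<lambda>t. 2 ^ t * (\<psi>1 (2 ^ t) * \<psi>2 (2 ^ t)))"
proof
  assume s: "summable (\<lambda>t. 2 ^ t * (\<psi>1 (2 ^ t) * \<psi>2 (2 ^ t)))"
  \<comment> \<open>The value at 0 is set to 0 because nothing is known about \<open>\<psi>1\<close>
    and \<open>\<psi>2\<close> there.\<close>
  define F where "F = (\<lambda>n::nat. if n = 0 then 0 else \<psi>1 n * \<psi>2 n)"
  note pos = approximating_functionD(1)[OF \<psi>1] approximating_functionD(1)[OF \<psi>2]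
  have F0: "0 \<le> F n" for n using pos by (auto simp: F_def less_imp_le)
  have "summable F \<longleftrightarrow> summable (\<lambda>n. 2 ^ n * F (2 ^ n))"
  proof (rule condensation_test)
    fix m :: nat assume m: "0 < m"
    have "\<psi>1 (Suc m) * \<psi>2 (Suc m) \<le> \<psi>1 m * \<psi>2 m"
      using m pos by (intro mult_mono approximating_functionD(2)[OF \<psi>1] approximating_functionD(2)[OF \<psi>2]) (auto simp: less_imp_le)
    then show "F (Suc m) \<le> F m" using m by (simp add: F_def)
  qed (rule F0)
  then have sF: "summable F" using s by (simp add: F_def)
  have "(\<Sum>h=1..N. \<psi>1 (real h) * \<psi>2 (real h)) \<le> suminf F" for N
  proof -
    have "(\<Sum>h=1..N. \<psi>1 (real h) * \<psi>2 (real h)) = sum F {1..N}" by (intro sum.cong) (auto simp: F_def)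
    also have "\<dots> \<le> suminf F" using sF F0 by (intro sum_le_suminf) auto
    finally show ?thesis .
  qed
  moreover obtain N where "suminf F < (\<Sum>h=1..N. \<psi>1 (real h) * \<psi>2 (real h))"
    using div unfolding filterlim_at_top_dense by (meson eventually_happens trivial_limit_sequentially)
  ultimately show False by (meson not_le)
qed

text \<open>Scales at which both functions are small contribute a convergent sum, so the approximation
  may be based on the coordinate with the smaller function.\<close>

lemma dominated_divergence:
  assumes \<psi>1: "approximating_function \<psi>1" and \<psi>2: "approximating_function \<psi>2"
    and div: "\<not> summable (\<lambda>t. 2 ^ t * (\<psi>1 (2 ^ t) * \<psi>2 (2 ^ t)))"
  obtains T where "\<And>t. t \<in> T \<Longrightarrow> \<psi>1 (2 ^ t) \<le> \<psi>2 (2 ^ t) \<and> (3/4) ^ t \<le> 2 ^ t * (\<psi>2 (2 ^ t))\<^sup>2"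
      "\<not> summable (\<lambda>t. if t \<in> T then 2 ^ t * (\<psi>1 (2 ^ t) * \<psi>2 (2 ^ t)) else 0)"
    | T where "\<And>t. t \<in> T \<Longrightarrow> \<psi>2 (2 ^ t) \<le> \<psi>1 (2 ^ t) \<and> (3/4) ^ t \<le> 2 ^ t * (\<psi>1 (2 ^ t))\<^sup>2"
      "\<not> summable (\<lambda>t. if t \<in> T then 2 ^ t * (\<psi>2 (2 ^ t) * \<psi>1 (2 ^ t)) else 0)"
proof -
  define T1 where "T1 = {t. \<psi>1 (2 ^ t) \<le> \<psi>2 (2 ^ t) \<and> (3/4) ^ t \<le> 2 ^ t * (\<psi>2 (2 ^ t))\<^sup>2}"
  define T2 where "T2 = {t. \<psi>2 (2 ^ t) \<le> \<psi>1 (2 ^ t) \<and> (3/4) ^ t \<le> 2 ^ t * (\<psi>1 (2 ^ t))\<^sup>2}"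
  define a where "a = (\<lambda>t::nat. 2 ^ t * (\<psi>1 (2 ^ t) * \<psi>2 (2 ^ t)))"
  have pos: "0 < \<psi>1 (2 ^ t)" "0 < \<psi>2 (2 ^ t)" for t :: nat
    using approximating_functionD(1)[OF \<psi>1] approximating_functionD(1)[OF \<psi>2] by auto
  have a0: "0 \<le> a t" for t using pos[of t] by (simp add: a_def)
  have sq: "2 ^ t * (u * v) \<le> 2 ^ t * v\<^sup>2" if "u \<le> v" "0 < u" for u v :: real and t :: nat
    using that by (simp add: power2_eq_square mult_right_mono)
  \<comment> \<open>Outside \<open>T1\<close> and \<open>T2\<close> the larger function violates its
    lower bound, so \<open>a t\<close> is at most \<open>2 ^ t\<close> times its square, hence below
    the geometric term.\<close>
  have le: "a t \<le> (if t \<in> T1 then a t else 0) + (if t \<in> T2 then a t else 0) + (3/4) ^ t" for t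
  proof (cases "t \<in> T1 \<or> t \<in> T2")
    case True
    then show ?thesis using a0[of t] by (auto intro: add_nonneg_nonneg)
  next
    case False
    have "a t \<le> (3/4) ^ t"
    proof (cases "\<psi>1 (2 ^ t) \<le> \<psi>2 (2 ^ t)")
      case True
      then have "2 ^ t * (\<psi>2 (2 ^ t))\<^sup>2 < (3/4) ^ t" using False by (auto simp: T1_def)
      then show ?thesis using sq[OF True pos(1), of t] unfolding a_def by linarith
    next
      case F: False
      then have le: "\<psi>2 (2 ^ t) \<le> \<psi>1 (2 ^ t)" by simp
      then have "2 ^ t * (\<psi>1 (2 ^ t))\<^sup>2 < (3/4) ^ t" using False by (auto simp: T2_def)
      then show ?thesis using sq[OF le pos(2), of t] unfolding a_def mult.commute[of "\<psi>1 (2 ^ t)"] by linarith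
    qed
    then show ?thesis using False by simp
  qed
  have "\<not> (summable (\<lambda>t. if t \<in> T1 then a t else 0) \<and> summable (\<lambda>t. if t \<in> T2 then a t else 0))"
  proof
    assume s: "summable (\<lambda>t. if t \<in> T1 then a t else 0) \<and> summable (\<lambda>t. if t \<in> T2 then a t else 0)"
    have "summable (\<lambda>t. (if t \<in> T1 then a t else 0) + (if t \<in> T2 then a t else 0) + (3/4) ^ t)"
      using s by (intro summable_add) auto
    then have "summable a" by (rule summable_comparison_test'[where N = 0]) (use le a0 in auto)
    then show False using div by (simp add: a_def)
  qed
  then consider "\<not> summable (\<lambda>t. if t \<in> T1 then a t else 0)" | "\<not> summable (\<lambda>t. if t \<in> T2 then a t else 0)" by blast
  then show thesis
  proof cases
    case 1
    then show thesis using that(1)[of T1] unfolding a_def T1_def by blast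
  next
    case 2
    have "(\<lambda>t. if t \<in> T2 then a t else 0) = (\<lambda>t. if t \<in> T2 then 2 ^ t * (\<psi>2 (2 ^ t) * \<psi>1 (2 ^ t)) else 0)"
      by (auto simp: a_def)
    from that(2)[OF _ 2[unfolded this]] show thesis by (simp add: T2_def)
  qed
qed

section \<open>Regular arcs as graphs\<close>

text \<open>Since \<open>u1\<close> never vanishes, \<open>u\<close> is a diffeomorphism and the arc
  is the graph of \<open>v \<circ> h\<close> with \<open>h\<close> its inverse. The exceptional set
  of the graph is null, and the differentiable map \<open>h\<close> carries it to a null set of
  parameters. Only the case of divergence along scales with the smaller function on the first
  coordinate is treated.\<close>

lemma negligible_regular_arc_half:
  fixes u v :: "real \<Rightarrow> real"
  assumes ab: "a < b" "{a..b} \<subseteq> I" and I: "open I" "is_interval I"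
    and u: "\<And>t. t \<in> I \<Longrightarrow> (u has_real_derivative u1 t) (at t)" "\<And>t. t \<in> I \<Longrightarrow> (u1 has_real_derivative u2 t) (at t)"
    and v: "\<And>t. t \<in> I \<Longrightarrow> (v has_real_derivative v1 t) (at t)" "\<And>t. t \<in> I \<Longrightarrow> (v1 has_real_derivative v2 t) (at t)"
    and c: "continuous_on I u2" "continuous_on I v2"
    and nz: "\<And>t. t \<in> I \<Longrightarrow> u1 t \<noteq> 0" "\<And>t. t \<in> I \<Longrightarrow> u1 t * v2 t - v1 t * u2 t \<noteq> 0"
    and \<psi>1: "approximating_function \<psi>1" and \<psi>2: "approximating_function \<psi>2"
    and T: "\<And>t. t \<in> T \<Longrightarrow> \<psi>1 (2 ^ t) \<le> \<psi>2 (2 ^ t) \<and> (3/4) ^ t \<le> 2 ^ t * (\<psi>2 (2 ^ t))\<^sup>2"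
    and div: "\<not> summable (\<lambda>t. if t \<in> T then 2 ^ t * (\<psi>1 (2 ^ t) * \<psi>2 (2 ^ t)) else 0)"
  shows "negligible {t\<in>{a..b}. (u t, v t) \<notin> simul_approx \<psi>1 \<psi>2}"
proof -
  have inj: "inj_on u I"
  proof (rule inj_onI, rule ccontr)
    have *: False if st: "s \<in> I" "t \<in> I" "u s = u t" "s < t" for s t
    proof -
      have sub: "{s..t} \<subseteq> I" using I(2) st(1,2) unfolding is_interval_1 by (meson atLeastAtMost_iff subsetI)
      then have "\<exists>z. s < z \<and> z < t \<and> u t - u s = (t - s) * u1 z" using st by (intro MVT2 u(1)) auto
      then obtain z where z: "s < z" "z < t" "u t - u s = (t - s) * u1 z" by blast
      then have "z \<in> {s..t}" by simp
      then have "u1 z \<noteq> 0" using sub nz(1) by blast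
      then show False using z st by simp
    qed
    fix s t assume "s \<in> I" "t \<in> I" "u s = u t" "s \<noteq> t"
    then show False using *[of s t] *[of t s] by (cases s t rule: linorder_cases) auto
  qed
  define h where "h = inv_into I u"
  have hu: "h (u t) = t" if "t \<in> I" for t using inj that by (simp add: h_def)
  have cu: "continuous_on I u" by (rule DERIV_continuous_on[where D = u1]) (use u in \<open>blast intro: has_field_derivative_at_within\<close>)
  have cu1: "continuous_on I u1" by (rule DERIV_continuous_on[where D = u2]) (use u in \<open>blast intro: has_field_derivative_at_within\<close>)
  have cv1: "continuous_on I v1" by (rule DERIV_continuous_on[where D = v2]) (use v in \<open>blast intro: has_field_derivative_at_within\<close>)
  have hd: "(h has_real_derivative inverse (u1 t)) (at (u t))" if "t \<in> I" for t
    unfolding has_field_derivative_def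
    by (rule has_derivative_inverse_strong[OF I(1) that cu hu u(1)[OF that, unfolded has_field_derivative_def]])
      (use nz(1)[OF that] in \<open>auto simp: fun_eq_iff\<close>)
  have "compact (u ` {a..b})" "connected (u ` {a..b})"
    using continuous_on_subset[OF cu ab(2)] by (auto intro: compact_continuous_image connected_continuous_image)
  then obtain A B where img: "u ` {a..b} = {A..B}"
    using connected_compact_interval_1[of "u ` {a..b}"] by auto
  have tI: "\<exists>t. t \<in> I \<and> y = u t \<and> h y = t" if y: "y \<in> {A..B}" for y
  proof -
    obtain t where "t \<in> {a..b}" "y = u t" using y unfolding img[symmetric] by blast
    then show ?thesis using ab(2) hu by blast
  qed
  have AB: "A < B"
  proof -
    have "u a \<in> {A..B}" "u b \<in> {A..B}" using img ab by auto
    moreover have "a \<in> I" "b \<in> I" using ab by auto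
    then have "u a \<noteq> u b" using inj_onD[OF inj, of a b] ab(1) by auto
    ultimately show ?thesis by auto
  qed
  define f where "f = (\<lambda>y. v (h y))"
  define f1 where "f1 = (\<lambda>y. v1 (h y) / u1 (h y))"
  \<comment> \<open>Quotient and chain rule; the numerator is that of the signed curvature, so
    \<open>f2\<close> has no zeros.\<close>
  define f2 where "f2 = (\<lambda>y. (v2 (h y) * u1 (h y) - v1 (h y) * u2 (h y)) / (u1 (h y)) ^ 3)"
  have ch: "continuous_on {A..B} h"
  proof (rule DERIV_continuous_on[where D = "\<lambda>y. inverse (u1 (h y))"])
    fix y assume "y \<in> {A..B}"
    then obtain t where t: "t \<in> I" "y = u t" "h y = t" using tI by blast
    show "(h has_real_derivative inverse (u1 (h y))) (at y within {A..B})"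
      unfolding t(3) unfolding t(2) by (rule has_field_derivative_at_within[OF hd[OF t(1)]])
  qed
  have hI: "h ` {A..B} \<subseteq> I"
  proof
    fix t assume "t \<in> h ` {A..B}"
    then obtain y where "y \<in> {A..B}" "t = h y" by blast
    then show "t \<in> I" using tI by blast
  qed
  note cc = continuous_on_compose2[OF _ ch hI]
  have neg: "negligible {x\<in>{A..B}. (x, f x) \<notin> simul_approx \<psi>1 \<psi>2}"
  proof (rule negligible_curved_graph_nonapproximable[OF AB _ _ _ _ \<psi>1 \<psi>2 T div])
    fix y assume "y \<in> {A..B}"
    then obtain t where t: "t \<in> I" "y = u t" "h y = t" using tI by blast
    have hd': "(h has_real_derivative inverse (u1 t)) (at y)" using hd[OF t(1)] t(2) by simp
    have "(f has_real_derivative v1 t * inverse (u1 t)) (at y)"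
      unfolding f_def by (rule DERIV_chain2[OF _ hd']) (use v(1)[OF t(1)] t in simp)
    then show "(f has_real_derivative f1 y) (at y)" using t by (simp add: f1_def divide_inverse)
    have "((\<lambda>s. v1 s / u1 s) has_real_derivative (v2 t * u1 t - v1 t * u2 t) / (u1 t * u1 t)) (at t)"
      by (rule DERIV_divide[OF v(2)[OF t(1)] u(2)[OF t(1)] nz(1)[OF t(1)]])
    then have "(f1 has_real_derivative (v2 t * u1 t - v1 t * u2 t) / (u1 t * u1 t) * inverse (u1 t)) (at y)"
      unfolding f1_def by (intro DERIV_chain2[where f = "\<lambda>s. v1 s / u1 s", OF _ hd']) (use t in simp)
    then show "(f1 has_real_derivative f2 y) (at y)"
      using t by (simp add: f2_def divide_inverse power3_eq_cube mult.assoc)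
    show "f2 y \<noteq> 0" using nz[OF t(1)] t by (simp add: f2_def mult.commute)
  next
    show "continuous_on {A..B} f2" unfolding f2_def
      by (intro continuous_intros cc[OF c(1)] cc[OF c(2)] cc[OF cu1] cc[OF cv1]) (use hI nz in auto)
  qed
  have "negligible (h ` {x\<in>{A..B}. (x, f x) \<notin> simul_approx \<psi>1 \<psi>2})"
  proof (rule negligible_differentiable_image_negligible[OF _ neg])
    show "h differentiable_on {x\<in>{A..B}. (x, f x) \<notin> simul_approx \<psi>1 \<psi>2}"
      unfolding differentiable_on_def
    proof
      fix y assume "y \<in> {x\<in>{A..B}. (x, f x) \<notin> simul_approx \<psi>1 \<psi>2}"
      then obtain t where t: "t \<in> I" "y = u t" using tI by blast
      show "h differentiable at y within {x\<in>{A..B}. (x, f x) \<notin> simul_approx \<psi>1 \<psi>2}"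
        using hd[OF t(1)] t(2) by (metis differentiable_at_withinI real_differentiable_def)
    qed
  qed simp
  moreover have "{t\<in>{a..b}. (u t, v t) \<notin> simul_approx \<psi>1 \<psi>2} \<subseteq> h ` {x\<in>{A..B}. (x, f x) \<notin> simul_approx \<psi>1 \<psi>2}"
  proof
    fix t assume t: "t \<in> {t\<in>{a..b}. (u t, v t) \<notin> simul_approx \<psi>1 \<psi>2}"
    then have "h (u t) = t" "u t \<in> {A..B}" using hu ab(2) img by auto
    then show "t \<in> h ` {x\<in>{A..B}. (x, f x) \<notin> simul_approx \<psi>1 \<psi>2}"
      using t by (intro image_eqI[of _ _ "u t"]) (auto simp: f_def)
  qed
  ultimately show ?thesis by (rule negligible_subset)
qed

text \<open>Divergence persists along the scales where one fixed function is the smaller one. If it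
  is \<open>\<psi>2\<close>, the coordinates are exchanged, and the arc has to be a graph over the
  second axis; this is why both \<open>u1\<close> and \<open>v1\<close> must be nonzero.\<close>

lemma negligible_regular_arc:
  fixes u v :: "real \<Rightarrow> real"
  assumes ab: "a < b" "{a..b} \<subseteq> I" and I: "open I" "is_interval I"
    and u: "\<And>t. t \<in> I \<Longrightarrow> (u has_real_derivative u1 t) (at t)" "\<And>t. t \<in> I \<Longrightarrow> (u1 has_real_derivative u2 t) (at t)"
    and v: "\<And>t. t \<in> I \<Longrightarrow> (v has_real_derivative v1 t) (at t)" "\<And>t. t \<in> I \<Longrightarrow> (v1 has_real_derivative v2 t) (at t)"
    and c: "continuous_on I u2" "continuous_on I v2"
    and nz: "\<And>t. t \<in> I \<Longrightarrow> u1 t \<noteq> 0" "\<And>t. t \<in> I \<Longrightarrow> v1 t \<noteq> 0" "\<And>t. t \<in> I \<Longrightarrow> u1 t * v2 t - v1 t * u2 t \<noteq> 0"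
    and \<psi>1: "approximating_function \<psi>1" and \<psi>2: "approximating_function \<psi>2"
    and div: "filterlim (\<lambda>N. \<Sum>h=1..N. \<psi>1 (real h) * \<psi>2 (real h)) at_top sequentially"
  shows "negligible {t\<in>{a..b}. (u t, v t) \<notin> simul_approx \<psi>1 \<psi>2}"
proof (rule dominated_divergence[OF \<psi>1 \<psi>2 condensed_divergence[OF \<psi>1 \<psi>2 div]])
  fix T assume "\<And>t. t \<in> T \<Longrightarrow> \<psi>1 (2 ^ t) \<le> \<psi>2 (2 ^ t) \<and> (3/4) ^ t \<le> 2 ^ t * (\<psi>2 (2 ^ t))\<^sup>2"
      "\<not> summable (\<lambda>t. if t \<in> T then 2 ^ t * (\<psi>1 (2 ^ t) * \<psi>2 (2 ^ t)) else 0)"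
  from negligible_regular_arc_half[OF ab I u v c nz(1,3) \<psi>1 \<psi>2 this] show ?thesis .
next
  fix T assume T: "\<And>t. t \<in> T \<Longrightarrow> \<psi>2 (2 ^ t) \<le> \<psi>1 (2 ^ t) \<and> (3/4) ^ t \<le> 2 ^ t * (\<psi>1 (2 ^ t))\<^sup>2"
      "\<not> summable (\<lambda>t. if t \<in> T then 2 ^ t * (\<psi>2 (2 ^ t) * \<psi>1 (2 ^ t)) else 0)"
  have nz': "v1 t * u2 t - u1 t * v2 t \<noteq> 0" if "t \<in> I" for t using nz(3)[OF that] by simp
  from negligible_regular_arc_half[OF ab I v u c(2,1) nz(2) nz' \<psi>2 \<psi>1 T]
  show ?thesis by (simp add: simul_approx_swap[of _ _ \<psi>1 \<psi>2])
qed

section \<open>Planar curves\<close>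

lemma local_param_3D:
  assumes "local_param 3 C \<gamma> I"
  obtains u1 u2 v1 v2 where
    "\<And>t. t \<in> I \<Longrightarrow> ((\<lambda>s. fst (\<gamma> s)) has_real_derivative u1 t) (at t)"
    "\<And>t. t \<in> I \<Longrightarrow> (u1 has_real_derivative u2 t) (at t)"
    "\<And>t. t \<in> I \<Longrightarrow> ((\<lambda>s. snd (\<gamma> s)) has_real_derivative v1 t) (at t)"
    "\<And>t. t \<in> I \<Longrightarrow> (v1 has_real_derivative v2 t) (at t)"
    "continuous_on I u2" "continuous_on I v2"
    "\<And>t. t \<in> I \<Longrightarrow> param_curvature \<gamma> t \<noteq> 0 \<Longrightarrow> u1 t * v2 t - v1 t * u2 t \<noteq> 0"
proof -
  have I: "open I" using assms by (simp add: local_param_def)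
  have "C_diff_on (Suc (Suc (Suc 0))) \<gamma> I" using assms by (simp add: local_param_def numeral_3_eq_3)
  then obtain g1 g2 g3 where g: "\<And>t. t \<in> I \<Longrightarrow> (\<gamma> has_vector_derivative g1 t) (at t)"
      "\<And>t. t \<in> I \<Longrightarrow> (g1 has_vector_derivative g2 t) (at t)"
      "\<And>t. t \<in> I \<Longrightarrow> (g2 has_vector_derivative g3 t) (at t)"
    unfolding C_diff_on.simps by blast
  have fs: "((\<lambda>s. fst (h s)) has_real_derivative fst h') (at t)" "((\<lambda>s. snd (h s)) has_real_derivative snd h') (at t)"
    if "(h has_vector_derivative h') (at t)" for h :: "real \<Rightarrow> real \<times> real" and h' t
    using bounded_linear.has_vector_derivative[OF bounded_linear_fst that]
      bounded_linear.has_vector_derivative[OF bounded_linear_snd that]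
    by (auto simp: has_real_derivative_iff_has_vector_derivative)
  have cg2: "continuous_on I g2"
    using g(3) by (meson continuous_at_imp_continuous_on has_vector_derivative_continuous)
  have d1: "vector_derivative \<gamma> (at t) = g1 t" if "t \<in> I" for t
    using g(1)[OF that] by (rule vector_derivative_at)
  have d2: "vector_derivative (\<lambda>s. vector_derivative \<gamma> (at s)) (at t) = g2 t" if t: "t \<in> I" for t
  proof (rule vector_derivative_at)
    show "((\<lambda>s. vector_derivative \<gamma> (at s)) has_vector_derivative g2 t) (at t)"
      using has_vector_derivative_transform_within_open[OF g(2)[OF t] I t] d1 by metis
  qed
  show thesis
  proof (rule that[of "\<lambda>t. fst (g1 t)" "\<lambda>t. fst (g2 t)" "\<lambda>t. snd (g1 t)" "\<lambda>t. snd (g2 t)"])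
    show "continuous_on I (\<lambda>t. fst (g2 t))" "continuous_on I (\<lambda>t. snd (g2 t))"
      using cg2 by (auto intro: continuous_intros)
    show "fst (g1 t) * snd (g2 t) - snd (g1 t) * fst (g2 t) \<noteq> 0" if "t \<in> I" "param_curvature \<gamma> t \<noteq> 0" for t
      using that(2) by (auto simp: param_curvature_def Let_def d1[OF that(1)] d2[OF that(1)])
  qed (use fs g in auto)
qed

text \<open>A zero with nonzero derivative is isolated, and a set all of whose points are isolated
  is locally negligible, hence negligible. This disposes of the points with horizontal or vertical
  tangent.\<close>

lemma negligible_isolated_zeros:
  fixes P :: "real \<Rightarrow> real"
  assumes "\<And>t. t \<in> Z \<Longrightarrow> P t = 0" "\<And>t. t \<in> Z \<Longrightarrow> \<exists>D. D \<noteq> 0 \<and> (P has_real_derivative D) (at t)"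
  shows "negligible Z"
proof (rule iffD2[OF locally_negligible_alt], rule ballI)
  fix t assume t: "t \<in> Z"
  obtain D where D: "D \<noteq> 0" "(P has_real_derivative D) (at t)" using assms(2)[OF t] by blast
  then have "((\<lambda>y. (P y - P t) / (y - t)) \<longlongrightarrow> D) (at t)" by (simp add: has_field_derivative_iff)
  then have "eventually (\<lambda>y. (P y - P t) / (y - t) \<noteq> 0) (at t)" using D(1) by (rule tendsto_imp_eventually_ne)
  then obtain S where S: "open S" "t \<in> S" "\<And>y. y \<in> S \<Longrightarrow> y \<noteq> t \<Longrightarrow> (P y - P t) / (y - t) \<noteq> 0"
    unfolding eventually_at_topological by blast
  have "y = t" if "y \<in> Z" "y \<in> S" for y
    using S(3)[OF that(2)] assms(1)[OF that(1)] assms(1)[OF t] by (cases "y = t") simp_all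
  then have "Z \<inter> S = {t}" using S(2) t by blast
  then have "negligible (Z \<inter> S)" by simp
  moreover have "openin (top_of_set Z) (Z \<inter> S)" by (rule openin_open_Int[OF S(1)])
  ultimately show "\<exists>U. openin (top_of_set Z) U \<and> t \<in> U \<and> negligible U" using S(2) t by blast
qed

text \<open>Near a parameter where both coordinate derivatives and the curvature are nonzero, a
  small arc is a graph over either axis, and local negligibility suffices. The remaining parameters
  with nonzero curvature are zeros of \<open>u1 * v1\<close>.\<close>

lemma negligible_param_nonapproximable:
  assumes \<gamma>: "local_param 3 C \<gamma> I" and \<psi>1: "approximating_function \<psi>1" and \<psi>2: "approximating_function \<psi>2"
    and div: "filterlim (\<lambda>N. \<Sum>h=1..N. \<psi>1 (real h) * \<psi>2 (real h)) at_top sequentially"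
  shows "negligible {t\<in>I. param_curvature \<gamma> t \<noteq> 0 \<and> \<gamma> t \<notin> simul_approx \<psi>1 \<psi>2}"
proof -
  have I: "open I" "is_interval I" using \<gamma> by (auto simp: local_param_def)
  define u v where "u = (\<lambda>s. fst (\<gamma> s))" and "v = (\<lambda>s. snd (\<gamma> s))"
  obtain u1 u2 v1 v2 where
    u: "\<And>t. t \<in> I \<Longrightarrow> (u has_real_derivative u1 t) (at t)" "\<And>t. t \<in> I \<Longrightarrow> (u1 has_real_derivative u2 t) (at t)"
    and v: "\<And>t. t \<in> I \<Longrightarrow> (v has_real_derivative v1 t) (at t)" "\<And>t. t \<in> I \<Longrightarrow> (v1 has_real_derivative v2 t) (at t)"
    and c: "continuous_on I u2" "continuous_on I v2"
    and curv: "\<And>t. t \<in> I \<Longrightarrow> param_curvature \<gamma> t \<noteq> 0 \<Longrightarrow> u1 t * v2 t - v1 t * u2 t \<noteq> 0"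
    using local_param_3D[OF \<gamma>] unfolding u_def v_def by metis
  define W where "W = (\<lambda>t. u1 t * v2 t - v1 t * u2 t)"
  define P where "P = (\<lambda>t. u1 t * v1 t)"
  have cu1: "continuous_on I u1" by (rule DERIV_continuous_on[where D = u2]) (use u in \<open>blast intro: has_field_derivative_at_within\<close>)
  have cv1: "continuous_on I v1" by (rule DERIV_continuous_on[where D = v2]) (use v in \<open>blast intro: has_field_derivative_at_within\<close>)
  define G where "G = {t\<in>I. W t * P t \<noteq> 0}"
  have "continuous_on I (\<lambda>t. W t * P t)" unfolding W_def P_def by (intro continuous_intros c cu1 cv1)
  then have "open (I \<inter> (\<lambda>t. W t * P t) -` (- {0}))" by (rule continuous_open_preimage[OF _ I(1)]) (simp add: open_Compl)
  moreover have "G = I \<inter> (\<lambda>t. W t * P t) -` (- {0})" by (auto simp: G_def)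
  ultimately have G: "open G" by simp
  define bad where "bad = {t\<in>G. \<gamma> t \<notin> simul_approx \<psi>1 \<psi>2}"
  have "negligible bad"
  proof (rule iffD2[OF locally_negligible_alt], rule ballI)
    fix t assume t: "t \<in> bad"
    then have "t \<in> G" by (simp add: bad_def)
    then obtain e where e: "0 < e" "cball t e \<subseteq> G" using G open_contains_cball by blast
    define N where "N = ball t e"
    have NG: "N \<subseteq> G" using e(2) ball_subset_cball by (auto simp: N_def)
    then have NI: "N \<subseteq> I" by (auto simp: G_def)
    have "negligible {s\<in>{t - e/2..t + e/2}. (u s, v s) \<notin> simul_approx \<psi>1 \<psi>2}"
    proof (rule negligible_regular_arc[OF _ _ _ _ _ _ _ _ _ _ _ _ _ \<psi>1 \<psi>2 div, where I = N])
      show "{t - e/2..t + e/2} \<subseteq> N" using e(1) by (auto simp: N_def dist_real_def)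
      show "is_interval N" by (simp add: N_def is_interval_ball_real)
      show "continuous_on N u2" "continuous_on N v2" using c NI continuous_on_subset by blast+
      show "u1 s \<noteq> 0" "v1 s \<noteq> 0" "u1 s * v2 s - v1 s * u2 s \<noteq> 0" if "s \<in> N" for s
        using NG that by (auto simp: G_def W_def P_def)
    qed (use e u v NI in \<open>auto simp: N_def\<close>)
    moreover have "bad \<inter> ball t (e/2) \<subseteq> {s\<in>{t - e/2..t + e/2}. (u s, v s) \<notin> simul_approx \<psi>1 \<psi>2}"
      by (auto simp: bad_def u_def v_def dist_real_def abs_if split: if_splits)
    ultimately have "negligible (bad \<inter> ball t (e/2))" by (rule negligible_subset)
    then show "\<exists>U. openin (top_of_set bad) U \<and> t \<in> U \<and> negligible U"
      using t e(1) by (intro exI[of _ "bad \<inter> ball t (e/2)"]) (auto simp: openin_open_Int)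
  qed
  moreover have "negligible {t\<in>I. W t \<noteq> 0 \<and> P t = 0}"
  proof (rule negligible_isolated_zeros[where P = P])
    fix t assume t: "t \<in> {t\<in>I. W t \<noteq> 0 \<and> P t = 0}"
    then have "(P has_real_derivative u2 t * v1 t + v2 t * u1 t) (at t)"
      unfolding P_def by (intro DERIV_mult u v) auto
    \<comment> \<open>If one of \<open>u1\<close>, \<open>v1\<close> vanishes at \<open>t\<close>,
      this sum equals \<open>W t\<close> up to sign.\<close>
    moreover have "u2 t * v1 t + v2 t * u1 t \<noteq> 0" using t by (auto simp: P_def W_def)
    ultimately show "\<exists>D. D \<noteq> 0 \<and> (P has_real_derivative D) (at t)" by blast
  qed auto
  ultimately have "negligible (bad \<union> {t\<in>I. W t \<noteq> 0 \<and> P t = 0})" by (rule negligible_Un)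
  moreover have "{t\<in>I. param_curvature \<gamma> t \<noteq> 0 \<and> \<gamma> t \<notin> simul_approx \<psi>1 \<psi>2} \<subseteq> bad \<union> {t\<in>I. W t \<noteq> 0 \<and> P t = 0}"
    using curv by (auto simp: bad_def G_def W_def)
  ultimately show ?thesis by (rule negligible_subset)
qed

section \<open>Null sets for arc length\<close>

definition arc_cover :: "(real \<times> real) set \<Rightarrow> (real \<times> real) set \<Rightarrow> (nat \<Rightarrow> real \<Rightarrow> real \<times> real) \<Rightarrow>
    (nat \<Rightarrow> real set) \<Rightarrow> (nat \<Rightarrow> real) \<Rightarrow> (nat \<Rightarrow> real) \<Rightarrow> bool" where
  "arc_cover C A \<gamma> I a b \<longleftrightarrow> (\<forall>n. local_param 1 C (\<gamma> n) (I n) \<and> {a n..b n} \<subseteq> I n) \<and>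
     A \<subseteq> (\<Union>n. \<gamma> n ` {a n..b n})"

lemma curve_measure_eq:
  "curve_measure C A = Inf {(\<Sum>n. ennreal (arc_length (\<gamma> n) (a n) (b n))) | \<gamma> I a b. arc_cover C A \<gamma> I a b}"
  by (simp only: curve_measure_def arc_cover_def)

lemma curve_measure_le:
  "arc_cover C A \<gamma> I a b \<Longrightarrow> curve_measure C A \<le> (\<Sum>n. ennreal (arc_length (\<gamma> n) (a n) (b n)))"
  unfolding curve_measure_eq by (rule Inf_lower) (rule CollectI, rule exI[of _ \<gamma>], rule exI[of _ I], rule exI[of _ a], rule exI[of _ b], simp)

lemma curve_measure_zeroD:
  assumes "curve_measure C A = 0" "0 < e"
  obtains \<gamma> I a b where "arc_cover C A \<gamma> I a b" "(\<Sum>n. ennreal (arc_length (\<gamma> n) (a n) (b n))) < ennreal e"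
proof -
  have "Inf {(\<Sum>n. ennreal (arc_length (\<gamma> n) (a n) (b n))) | \<gamma> I a b. arc_cover C A \<gamma> I a b} < ennreal e"
    using assms by (simp add: curve_measure_eq)
  then show thesis using that unfolding Inf_less_iff by blast
qed

lemma curve_measure_subset_zero:
  assumes "curve_measure C B = 0" "A \<subseteq> B"
  shows "curve_measure C A = 0"
proof -
  have "curve_measure C A \<le> curve_measure C B"
    unfolding curve_measure_eq
  proof (intro Inf_superset_mono subsetI)
    fix x assume "x \<in> {(\<Sum>n. ennreal (arc_length (\<gamma> n) (a n) (b n))) | \<gamma> I a b. arc_cover C B \<gamma> I a b}"
    then obtain \<gamma> I a b where x: "x = (\<Sum>n. ennreal (arc_length (\<gamma> n) (a n) (b n)))" "arc_cover C B \<gamma> I a b" by blast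
    have "arc_cover C A \<gamma> I a b" using x(2) assms(2) unfolding arc_cover_def by (meson order_trans)
    then show "x \<in> {(\<Sum>n. ennreal (arc_length (\<gamma> n) (a n) (b n))) | \<gamma> I a b. arc_cover C A \<gamma> I a b}"
      using x(1) by blast
  qed
  then show ?thesis using assms(1) by simp
qed

text \<open>The cover of \<open>A k\<close> is given total length below
  \<open>e / 2 ^ (k + 1)\<close>; \<open>prod_decode\<close> merges the countably many covers into a
  single sequence of arcs.\<close>

lemma curve_measure_UN_zero:
  fixes A :: "nat \<Rightarrow> (real \<times> real) set"
  assumes "\<And>k. curve_measure C (A k) = 0"
  shows "curve_measure C (\<Union>k. A k) = 0"
proof (rule ccontr)
  assume nz: "curve_measure C (\<Union>k. A k) \<noteq> 0"
  then have "0 < curve_measure C (\<Union>k. A k)" by (simp add: zero_less_iff_neq_zero)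
  then obtain x where x: "0 < x" "x < curve_measure C (\<Union>k. A k)" using dense by blast
  then obtain e where xe: "x = ennreal e" by (cases x) auto
  have e: "0 < e" "ennreal e < curve_measure C (\<Union>k. A k)" using x xe by (auto simp: ennreal_less_zero_iff)
  have "\<exists>\<gamma> I a b. arc_cover C (A k) \<gamma> I a b \<and> (\<Sum>n. ennreal (arc_length (\<gamma> n) (a n) (b n))) < ennreal (e * (1/2) ^ Suc k)" for k
  proof -
    have pos: "0 < e * (1/2) ^ Suc k" using e(1) by simp
    show ?thesis by (rule curve_measure_zeroD[OF assms pos]) blast
  qed
  then obtain \<gamma> I a b where cov: "\<And>k. arc_cover C (A k) (\<gamma> k) (I k) (a k) (b k)"
      and small: "\<And>k. (\<Sum>n. ennreal (arc_length (\<gamma> k n) (a k n) (b k n))) < ennreal (e * (1/2) ^ Suc k)" by metis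
  define F where "F = (\<lambda>(k, n). ennreal (arc_length (\<gamma> k n) (a k n) (b k n)))"
  have "arc_cover C (\<Union>k. A k) (\<lambda>i. case prod_decode i of (k, n) \<Rightarrow> \<gamma> k n) (\<lambda>i. case prod_decode i of (k, n) \<Rightarrow> I k n)
      (\<lambda>i. case prod_decode i of (k, n) \<Rightarrow> a k n) (\<lambda>i. case prod_decode i of (k, n) \<Rightarrow> b k n)"
    unfolding arc_cover_def
  proof (intro conjI allI UN_least)
    fix i
    obtain k n where kn: "prod_decode i = (k, n)" by force
    show "local_param 1 C (case prod_decode i of (k, n) \<Rightarrow> \<gamma> k n) (case prod_decode i of (k, n) \<Rightarrow> I k n)"
      "{case prod_decode i of (k, n) \<Rightarrow> a k n..case prod_decode i of (k, n) \<Rightarrow> b k n} \<subseteq> (case prod_decode i of (k, n) \<Rightarrow> I k n)"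
      using cov[of k] unfolding kn arc_cover_def by auto
  next
    fix k
    show "A k \<subseteq> (\<Union>i. (case prod_decode i of (k, n) \<Rightarrow> \<gamma> k n) ` {case prod_decode i of (k, n) \<Rightarrow> a k n..case prod_decode i of (k, n) \<Rightarrow> b k n})"
    proof
      fix x assume "x \<in> A k"
      then obtain n where "x \<in> \<gamma> k n ` {a k n..b k n}" using cov[of k] unfolding arc_cover_def by blast
      then show "x \<in> (\<Union>i. (case prod_decode i of (k, n) \<Rightarrow> \<gamma> k n) ` {case prod_decode i of (k, n) \<Rightarrow> a k n..case prod_decode i of (k, n) \<Rightarrow> b k n})"
        by (intro UN_I[of "prod_encode (k, n)"]) auto
    qed
  qed
  then have "curve_measure C (\<Union>k. A k) \<le> (\<Sum>i. F (prod_decode i))"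
    unfolding F_def by (rule order_trans[OF curve_measure_le]) (simp add: case_prod_beta)
  also have "\<dots> = (\<Sum>k. \<Sum>n. F (k, n))" by (rule suminf_ennreal_2dimen) simp
  also have "\<dots> \<le> (\<Sum>k. ennreal (e * (1/2) ^ Suc k))"
    using small by (intro suminf_le) (auto simp: F_def less_imp_le)
  also have "\<dots> = ennreal e"
  proof -
    have "(\<lambda>k. e * (1/2) ^ Suc k) sums (e * 1)" by (intro sums_mult power_half_series)
    then show ?thesis using e(1) by (intro suminf_ennreal_eq) auto
  qed
  finally show False using e(2) by simp
qed

lemma local_param_1_of_3: "local_param 3 C \<gamma> I \<Longrightarrow> local_param 1 C \<gamma> I"
proof -
  assume \<gamma>: "local_param 3 C \<gamma> I"
  then have "C_diff_on (Suc (Suc (Suc 0))) \<gamma> I" by (simp add: local_param_def numeral_3_eq_3)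
  then obtain g1 g2 where g: "\<And>t. t \<in> I \<Longrightarrow> (\<gamma> has_vector_derivative g1 t) (at t)"
      "\<And>t. t \<in> I \<Longrightarrow> (g1 has_vector_derivative g2 t) (at t)"
    unfolding C_diff_on.simps by blast
  then have "continuous_on I g1"
    by (meson continuous_at_imp_continuous_on has_vector_derivative_continuous)
  then have "C_diff_on (Suc 0) \<gamma> I" using g(1) unfolding C_diff_on.simps by blast
  then show ?thesis using \<gamma> by (simp add: local_param_def)
qed

lemma continuous_on_norm_vector_derivative:
  assumes "local_param 1 C \<gamma> I"
  shows "continuous_on I (\<lambda>t. norm (vector_derivative \<gamma> (at t)))"
proof -
  obtain g1 where g: "\<And>t. t \<in> I \<Longrightarrow> (\<gamma> has_vector_derivative g1 t) (at t)" "continuous_on I g1"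
    using assms by (auto simp: local_param_def)
  have "continuous_on I (\<lambda>t. norm (g1 t))" using g(2) by (intro continuous_intros)
  moreover have "vector_derivative \<gamma> (at t) = g1 t" if "t \<in> I" for t using g(1)[OF that] by (rule vector_derivative_at)
  ultimately show ?thesis by (simp cong: continuous_on_cong)
qed

lemma arc_length_le:
  assumes \<gamma>: "local_param 1 C \<gamma> I" and ab: "{a..b} \<subseteq> I" "a \<le> b"
    and M: "\<And>t. t \<in> {a..b} \<Longrightarrow> norm (vector_derivative \<gamma> (at t)) \<le> M"
  shows "arc_length \<gamma> a b \<le> M * (b - a)"
proof -
  have "continuous_on {a..b} (\<lambda>t. norm (vector_derivative \<gamma> (at t)))"
    using continuous_on_norm_vector_derivative[OF \<gamma>] ab(1) by (rule continuous_on_subset)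
  then have "(\<lambda>t. norm (vector_derivative \<gamma> (at t))) integrable_on {a..b}" by (rule integrable_continuous_real)
  then have "arc_length \<gamma> a b \<le> integral {a..b} (\<lambda>_. M)"
    unfolding arc_length_def by (intro integral_le M) auto
  then show ?thesis using ab(2) by (simp add: mult.commute)
qed

text \<open>On a compact interval the speed is bounded by some \<open>M\<close>. A cover of the null
  set by nonoverlapping intervals of total length at most \<open>e / M\<close> is mapped to arcs of
  total length at most \<open>e\<close>.\<close>

lemma curve_measure_image_negligible_Icc:
  assumes \<gamma>: "local_param 1 C \<gamma> I" and ab: "{a..b} \<subseteq> I" and N: "negligible N"
  shows "curve_measure C (\<gamma> ` (N \<inter> {a..b})) = 0"
proof (rule ccontr)
  assume nz: "curve_measure C (\<gamma> ` (N \<inter> {a..b})) \<noteq> 0"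
  then have "0 < curve_measure C (\<gamma> ` (N \<inter> {a..b}))" by (simp add: zero_less_iff_neq_zero)
  then obtain x where x: "0 < x" "x < curve_measure C (\<gamma> ` (N \<inter> {a..b}))" using dense by blast
  then obtain e where xe: "x = ennreal e" by (cases x) auto
  have e: "0 < e" "ennreal e < curve_measure C (\<gamma> ` (N \<inter> {a..b}))" using x xe by (auto simp: ennreal_less_zero_iff)
  have "compact ((\<lambda>t. norm (vector_derivative \<gamma> (at t))) ` {a..b})"
    using continuous_on_subset[OF continuous_on_norm_vector_derivative[OF \<gamma>] ab] by (intro compact_continuous_image) auto
  then have "\<exists>M>0. \<forall>x\<in>(\<lambda>t. norm (vector_derivative \<gamma> (at t))) ` {a..b}. norm x \<le> M"
    using compact_imp_bounded bounded_pos by blast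
  then obtain M where M: "0 < M" "\<And>t. t \<in> {a..b} \<Longrightarrow> norm (vector_derivative \<gamma> (at t)) \<le> M" by auto
  define S where "S = N \<inter> {a..b}"
  have S: "negligible S" "S \<subseteq> cbox a b" unfolding S_def using N by (auto intro: negligible_subset)
  have Sl: "S \<in> lmeasurable" using S(1) by (simp add: negligible_iff_measure)
  have "0 < e / M" using e M by simp
  from measurable_outer_intervals_bounded[OF Sl S(2) this]
  obtain \<D> where D: "countable \<D>"
        "\<And>K. K \<in> \<D> \<Longrightarrow> K \<subseteq> cbox a b \<and> K \<noteq> {} \<and> (\<exists>c d. K = cbox c d)"
        "pairwise (\<lambda>A B. interior A \<inter> interior B = {}) \<D>"
        "S \<subseteq> \<Union>\<D>" "\<Union>\<D> \<in> lmeasurable" "measure lebesgue (\<Union>\<D>) \<le> measure lebesgue S + e / M"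
    by metis
  have mD: "measure lebesgue (\<Union>\<D>) \<le> e / M" using D(6) S(1) by (simp add: negligible_imp_measure0)
  have "\<forall>K\<in>\<D>. \<exists>p. K = {fst p..snd p} \<and> fst p \<le> snd p"
  proof
    fix K assume K: "K \<in> \<D>"
    then obtain c d where "K = cbox c d" "K \<noteq> {}" using D(2) by blast
    then show "\<exists>p. K = {fst p..snd p} \<and> fst p \<le> snd p" by (intro exI[of _ "(c, d)"]) auto
  qed
  from bchoice[OF this] obtain ends where ends: "\<And>K. K \<in> \<D> \<Longrightarrow> K = {fst (ends K)..snd (ends K)}"
      "\<And>K. K \<in> \<D> \<Longrightarrow> fst (ends K) \<le> snd (ends K)" by blast
  define R where "R = to_nat_on \<D> ` \<D>"
  \<comment> \<open>Indices outside the enumeration get the empty interval from 1 to 0, so a finite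
    family also becomes a sequence of arcs.\<close>
  define c where "c = (\<lambda>n. if n \<in> R then fst (ends (from_nat_into \<D> n)) else (1::real))"
  define d where "d = (\<lambda>n. if n \<in> R then snd (ends (from_nat_into \<D> n)) else (0::real))"
  define J where "J = (\<lambda>n. if n \<in> R then I else {})"
  have K: "from_nat_into \<D> n \<in> \<D>" "to_nat_on \<D> (from_nat_into \<D> n) = n" if "n \<in> R" for n
    using that D(1) by (auto simp: R_def)
  have cd: "{c n..d n} = from_nat_into \<D> n" "c n \<le> d n" if "n \<in> R" for n
    using ends[OF K(1)[OF that]] that by (auto simp: c_def d_def)
  have cd_sub: "{c n..d n} \<subseteq> {a..b}" for n
  proof (cases "n \<in> R")
    case True
    then show ?thesis using cd(1)[OF True] D(2)[OF K(1)[OF True]] by simp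
  qed (simp add: c_def d_def)
  have "local_param 1 C \<gamma> {}"
    by (auto simp: local_param_def homeomorphism_def)
  then have "arc_cover C (\<gamma> ` (N \<inter> {a..b})) (\<lambda>_. \<gamma>) J c d"
    unfolding arc_cover_def
  proof (intro conjI allI)
    fix n
    show "local_param 1 C \<gamma> (J n)" using \<gamma> \<open>local_param 1 C \<gamma> {}\<close> by (simp add: J_def)
    show "{c n..d n} \<subseteq> J n" using cd_sub[of n] ab by (auto simp: J_def c_def d_def)
  next
    show "\<gamma> ` (N \<inter> {a..b}) \<subseteq> (\<Union>n. \<gamma> ` {c n..d n})"
    proof (rule image_subsetI)
      fix t assume "t \<in> N \<inter> {a..b}"
      then obtain X where X: "X \<in> \<D>" "t \<in> X" using D(4) by (auto simp: S_def)
      have "to_nat_on \<D> X \<in> R" "from_nat_into \<D> (to_nat_on \<D> X) = X" using X(1) D(1) by (auto simp: R_def)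
      then have "t \<in> {c (to_nat_on \<D> X)..d (to_nat_on \<D> X)}" using cd(1) X(2) by simp
      then show "\<gamma> t \<in> (\<Union>n. \<gamma> ` {c n..d n})" by blast
    qed
  qed
  then have "curve_measure C (\<gamma> ` (N \<inter> {a..b})) \<le> (\<Sum>n. ennreal (arc_length \<gamma> (c n) (d n)))" by (rule curve_measure_le)
  \<comment> \<open>Passing to open intervals loses no length and makes them disjoint, as the closed
    ones may share endpoints.\<close>
  also have "\<dots> \<le> (\<Sum>n. ennreal M * emeasure lborel {c n<..<d n})"
  proof (rule suminf_le)
    fix n
    show "ennreal (arc_length \<gamma> (c n) (d n)) \<le> ennreal M * emeasure lborel {c n<..<d n}"
    proof (cases "n \<in> R")
      case True
      have "arc_length \<gamma> (c n) (d n) \<le> M * (d n - c n)"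
        by (rule arc_length_le[OF \<gamma>]) (use cd(2)[OF True] cd_sub[of n] ab M(2) in auto)
      then have "ennreal (arc_length \<gamma> (c n) (d n)) \<le> ennreal (M * (d n - c n))" by (rule ennreal_leI)
      then show ?thesis using cd(2)[OF True] M(1) by (simp add: ennreal_mult)
    next
      case False
      then show ?thesis by (simp add: c_def d_def arc_length_def)
    qed
  qed auto
  also have "\<dots> = ennreal M * (\<Sum>n. emeasure lborel {c n<..<d n})" by (rule ennreal_suminf_cmult)
  also have "(\<Sum>n. emeasure lborel {c n<..<d n}) = emeasure lborel (\<Union>n. {c n<..<d n})"
  proof (rule suminf_emeasure)
    show "disjoint_family (\<lambda>n. {c n<..<d n})"
      unfolding disjoint_family_on_def
    proof (intro ballI impI)
      fix m n :: nat assume mn: "m \<noteq> n"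
      show "{c m<..<d m} \<inter> {c n<..<d n} = {}"
      proof (cases "m \<in> R \<and> n \<in> R")
        case True
        have "from_nat_into \<D> m \<noteq> from_nat_into \<D> n" using K(2)[of m] K(2)[of n] True mn by metis
        then have "interior {c m..d m} \<inter> interior {c n..d n} = {}"
          using D(3) K(1) cd(1) True unfolding pairwise_def by auto
        then show ?thesis by (simp add: interior_atLeastAtMost_real)
      qed (auto simp: c_def d_def)
    qed
  qed auto
  also have "emeasure lborel (\<Union>n. {c n<..<d n}) = emeasure lebesgue (\<Union>n. {c n<..<d n})" by simp
  also have "\<dots> \<le> emeasure lebesgue (\<Union>\<D>)"
  proof (rule emeasure_mono)
    show "(\<Union>n. {c n<..<d n}) \<subseteq> \<Union>\<D>"
    proof (rule UN_least)
      fix n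
      show "{c n<..<d n} \<subseteq> \<Union>\<D>"
      proof (cases "n \<in> R")
        case True
        have "{c n<..<d n} \<subseteq> {c n..d n}" by auto
        then show ?thesis using cd(1)[OF True] K(1)[OF True] by auto
      qed (simp add: c_def d_def)
    qed
  qed (use D(5) in \<open>simp add: fmeasurableD\<close>)
  also have "emeasure lebesgue (\<Union>\<D>) = ennreal (measure lebesgue (\<Union>\<D>))"
    using D(5) by (rule emeasure_eq_measure2)
  also have "\<dots> \<le> ennreal (e / M)" using mD by (rule ennreal_leI)
  also have "ennreal M * ennreal (e / M) = ennreal e" using M(1) e(1) by (simp add: ennreal_mult[symmetric])
  finally have "curve_measure C (\<gamma> ` (N \<inter> {a..b})) \<le> ennreal e" by (simp add: mult_left_mono)
  then show False using e(2) by simp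
qed

lemma curve_measure_countable_UN_zero:
  assumes "countable X" "\<And>x. x \<in> X \<Longrightarrow> curve_measure C (A x) = 0"
  shows "curve_measure C (\<Union>x\<in>X. A x) = 0"
proof (cases "X = {}")
  case True
  have "local_param 1 C (\<lambda>_. 0) {}" by (auto simp: local_param_def homeomorphism_def)
  then have "arc_cover C {} (\<lambda>_ _. 0) (\<lambda>_. {}) (\<lambda>_. 1) (\<lambda>_. 0)" by (simp add: arc_cover_def)
  from curve_measure_le[OF this] show ?thesis using True by (simp add: arc_length_def)
next
  case False
  have "curve_measure C (\<Union>k. A (from_nat_into X k)) = 0"
    using assms(2) from_nat_into[OF False] by (intro curve_measure_UN_zero) blast
  moreover have "(\<Union>x\<in>X. A x) \<subseteq> (\<Union>k. A (from_nat_into X k))"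
  proof
    fix y assume "y \<in> (\<Union>x\<in>X. A x)"
    then obtain x where x: "x \<in> X" "y \<in> A x" by blast
    have "x = from_nat_into X (to_nat_on X x)" using x(1) assms(1) by simp
    then show "y \<in> (\<Union>k. A (from_nat_into X k))" using x(2) by (intro UN_I[of "to_nat_on X x"]) simp_all
  qed
  ultimately show ?thesis by (rule curve_measure_subset_zero)
qed

text \<open>The open domain is a countable union of compact intervals, on each of which the speed is
  bounded.\<close>

lemma curve_measure_image_negligible:
  assumes \<gamma>: "local_param 1 C \<gamma> I" and N: "negligible N" "N \<subseteq> I"
  shows "curve_measure C (\<gamma> ` N) = 0"
proof -
  have "open I" using \<gamma> by (simp add: local_param_def)
  then obtain \<D> where D: "countable \<D>" "\<D> \<subseteq> Pow I" "\<And>X. X \<in> \<D> \<Longrightarrow> \<exists>a b. X = cbox a b" "\<Union>\<D> = I"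
    using open_countable_Union_open_cbox by metis
  have "curve_measure C (\<Union>X\<in>\<D>. \<gamma> ` (N \<inter> X)) = 0"
  proof (rule curve_measure_countable_UN_zero[OF D(1)])
    fix X assume X: "X \<in> \<D>"
    then obtain a b where ab: "X = {a..b}" using D(3)[OF X] by auto
    then have "{a..b} \<subseteq> I" using D(2) X by auto
    from curve_measure_image_negligible_Icc[OF \<gamma> this N(1)] show "curve_measure C (\<gamma> ` (N \<inter> X)) = 0"
      unfolding ab .
  qed
  moreover have "\<gamma> ` N \<subseteq> (\<Union>X\<in>\<D>. \<gamma> ` (N \<inter> X))" using N(2) D(4) by blast
  ultimately show ?thesis by (rule curve_measure_subset_zero)
qed

text \<open>By the Lindelof property countably many local parametrizations cover the curve, so a
  countable union of null sets arises: the flat points, null by nondegeneracy, and for each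
  parametrization the image of a null set of parameters.\<close>

theorem theorem1:
  fixes \<psi>1 \<psi>2 :: "real \<Rightarrow> real" and C :: "(real \<times> real) set"
  assumes "approximating_function \<psi>1" and "approximating_function \<psi>2"
    and "planar_curve 3 C" and "nondegenerate_curve C"
    and "filterlim (\<lambda>N. \<Sum>h=1..N. \<psi>1 (real h) * \<psi>2 (real h)) at_top sequentially"
  shows "curve_measure C (C - simul_approx \<psi>1 \<psi>2) = 0"
proof -
  define \<F> where "\<F> = {U. \<exists>\<gamma> I. local_param 3 C \<gamma> I \<and> U = \<gamma> ` I}"
  have "openin (top_of_set C) U" if "U \<in> \<F>" for U using that by (auto simp: \<F>_def local_param_def)
  from Lindelof_openin[OF this] obtain \<G> where G: "\<G> \<subseteq> \<F>" "countable \<G>" "\<Union>\<G> = \<Union>\<F>" by blast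
  have C: "C \<subseteq> \<Union>\<G>" using assms(3) unfolding G(3) \<F>_def planar_curve_def by blast
  define flat where "flat = {p \<in> C. has_curvature C p 0}"
  have flat: "curve_measure C flat = 0" using assms(4) by (simp add: nondegenerate_curve_def flat_def)
  have "curve_measure C (U - simul_approx \<psi>1 \<psi>2 - flat) = 0" if U: "U \<in> \<G>" for U
  proof -
    obtain \<gamma> I where \<gamma>: "local_param 3 C \<gamma> I" "U = \<gamma> ` I" using U G(1) unfolding \<F>_def by blast
    have "U \<subseteq> C" using \<gamma> by (auto simp: local_param_def dest: openin_imp_subset)
    define N where "N = {t\<in>I. param_curvature \<gamma> t \<noteq> 0 \<and> \<gamma> t \<notin> simul_approx \<psi>1 \<psi>2}"
    have "negligible N" unfolding N_def by (rule negligible_param_nonapproximable[OF \<gamma>(1) assms(1,2,5)])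
    then have "curve_measure C (\<gamma> ` N) = 0"
      by (rule curve_measure_image_negligible[OF local_param_1_of_3[OF \<gamma>(1)]]) (simp add: N_def)
    moreover have "U - simul_approx \<psi>1 \<psi>2 - flat \<subseteq> \<gamma> ` N"
    proof
      fix p assume p: "p \<in> U - simul_approx \<psi>1 \<psi>2 - flat"
      then obtain t where t: "t \<in> I" "p = \<gamma> t" using \<gamma>(2) by blast
      have "\<not> has_curvature C p 0" using p \<open>U \<subseteq> C\<close> by (auto simp: flat_def)
      \<comment> \<open>If the curvature computed from \<open>\<gamma>\<close> were 0, this
        parametrization would itself witness that \<open>p\<close> is flat.\<close>
      then have "param_curvature \<gamma> t \<noteq> 0" using \<gamma>(1) t unfolding has_curvature_def by blast
      then show "p \<in> \<gamma> ` N" using p t by (auto simp: N_def)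
    qed
    ultimately show ?thesis by (rule curve_measure_subset_zero)
  qed
  then have "curve_measure C (\<Union>U\<in>\<G>. U - simul_approx \<psi>1 \<psi>2 - flat) = 0"
    by (rule curve_measure_countable_UN_zero[OF G(2)])
  then have "curve_measure C (\<Union>k::nat. if k = 0 then flat else (\<Union>U\<in>\<G>. U - simul_approx \<psi>1 \<psi>2 - flat)) = 0"
    using flat by (intro curve_measure_UN_zero) simp
  moreover have "C - simul_approx \<psi>1 \<psi>2 \<subseteq> (\<Union>k::nat. if k = 0 then flat else (\<Union>U\<in>\<G>. U - simul_approx \<psi>1 \<psi>2 - flat))"
  proof
    fix p assume p: "p \<in> C - simul_approx \<psi>1 \<psi>2"
    show "p \<in> (\<Union>k::nat. if k = 0 then flat else (\<Union>U\<in>\<G>. U - simul_approx \<psi>1 \<psi>2 - flat))"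
    proof (cases "p \<in> flat")
      case True
      then show ?thesis by (intro UN_I[of 0]) auto
    next
      case False
      then show ?thesis using p C by (intro UN_I[of 1]) auto
    qed
  qed
  ultimately show ?thesis by (rule curve_measure_subset_zero)
qed

end
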